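(* Let $R$ be a commutative noetherian ring, let $f_1, \ldots, f_r \in R$, and let $M$ be a finitely generated $R$-module. Then the following statements are equivalent: (i) $f_1, \ldots, f_r$ is a regular sequence on $M$. (ii) $\operatorname{depth}_{R_{\mathfrak p}}(M_{\mathfrak p}) \geq r$ for every $\mathfrak p \in \operatorname{Supp}(M/(f_1, \ldots, f_r)M)$. (iii) $\operatorname{depth}_{R_{\mathfrak p}}(M_{\mathfrak p}) \geq r$ for every $\mathfrak p \in \operatorname{Ass}(M/(f_1, \ldots, f_r)M)$.
   Context: Let $R$ be a commutative noetherian ring, $f_1,\ldots,f_r \in R$, and $M$ an $R$-module. Strongly regular sequence: $f_1,\ldots,f_r$ is a strongly regular sequence on $M$ if for every $i = 1,\ldots,r$ the element $f_i$ is a non-zero divisor for $M/(f_1,\ldots,f_{i-1})M$, i.e. multiplication by $f_i$ on this module is injective. It is not required that $M \neq (f_1,\ldots,f_r)M$; in particular every sequence is strongly regular on the zero module. Regular sequence: $f_1,\ldots,f_r$ is a regular sequence on $M$ if for every $\mathfrak p \in \operatorname{Supp}(M/(f_1,\ldots,f_r)M)$ the sequence (of images of) $f_1,\ldots,f_r$ in the local ring $R_{\mathfrak p}$ is a strongly regular sequence on the $R_{\mathfrak p}$-module $M_{\mathfrak p}$. (This is weaker than being strongly regular.) Depth: for a noetherian local ring $(R,\mathfrak m_R)$ and a non-zero $R$-module $M$, $\operatorname{depth}_R(M)$ is the length of a maximal regular sequence on $M$ consisting of elements of the maximal ideal $\mathfrak m_R$. For finitely generated $M \neq 0$ this equals $\min\{i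 \in \mathbb N \mid \operatorname{Ext}^i_R(R/\mathfrak m_R, M) \neq 0\}$. $\operatorname{Supp}$ and $\operatorname{Ass}$ denote the support and the set of associated primes of an $R$-module. *)

theory Defs
  imports "HOL-Algebra.Module" "HOL-Algebra.QuotRing" "HOL-Algebra.Ring_Divisibility"
    "HOL-Library.Extended_Nat"
begin

section \<open>Generated submodules and quotient modules\<close>

definition submodule_span ::
  "('a, 'c) ring_scheme \<Rightarrow> ('a, 'b, 'd) module_scheme \<Rightarrow> 'b set \<Rightarrow> 'b set"
  where "submodule_span R M A = \<Inter>{N. submodule N R M \<and> A \<subseteq> N}"

definition fin_gen_module :: "('a, 'c) ring_scheme \<Rightarrow> ('a, 'b, 'd) module_scheme \<Rightarrow> bool"
  where "fin_gen_module R M \<longleftrightarrow>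
    module R M \<and> (\<exists>A \<subseteq> carrier M. finite A \<and> carrier M = submodule_span R M A)"

definition ideal_smult ::
  "('a, 'c) ring_scheme \<Rightarrow> 'a set \<Rightarrow> ('a, 'b, 'd) module_scheme \<Rightarrow> 'b set"
  where "ideal_smult R I M = submodule_span R M {a \<odot>\<^bsub>M\<^esub> m | a m. a \<in> I \<and> m \<in> carrier M}"

text \<open>
  The record type of modules extends that of rings; the ring multiplication and unit of a module
  are irrelevant and left \<open>undefined\<close> below.
\<close>

definition quot_module :: "('a, 'b, 'd) module_scheme \<Rightarrow> 'b set \<Rightarrow> ('a, 'b set) module"
  where "quot_module M N =
    \<lparr>carrier = a_rcosets\<^bsub>M\<^esub> N, mult = undefined, one = undefined, zero = N, add = set_add M,
     smult = (\<lambda>a X. \<Union>m\<in>X. N +>\<^bsub>M\<^esub> (a \<odot>\<^bsub>M\<^esub> m))\<rparr>"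

text \<open>The module \<open>M/(f\<^sub>1, \<dots>, f\<^sub>k)M\<close>; for the empty list this is \<open>M/0\<close>.\<close>

definition quot_seq ::
  "('a, 'c) ring_scheme \<Rightarrow> ('a, 'b, 'd) module_scheme \<Rightarrow> 'a list \<Rightarrow> ('a, 'b set) module"
  where "quot_seq R M fs = quot_module M (ideal_smult R (Idl\<^bsub>R\<^esub> (set fs)) M)"


section \<open>Localization\<close>

text \<open>
  Here \<open>S\<close> is a multiplicative subset of \<open>R\<close>, and fractions are equivalence classes of pairs
  (numerator, denominator). The operations are given on all representatives at once: by
  compatibility with the equivalence relation, all the united classes coincide.
\<close>

definition ring_loc_rel :: "('a, 'c) ring_scheme \<Rightarrow> 'a set \<Rightarrow> (('a \<times> 'a) \<times> ('a \<times> 'a)) set"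
  where "ring_loc_rel R S = {((a, s), (b, t)). a \<in> carrier R \<and> b \<in> carrier R \<and> s \<in> S \<and> t \<in> S \<and>
    (\<exists>u\<in>S. u \<otimes>\<^bsub>R\<^esub> (t \<otimes>\<^bsub>R\<^esub> a) = u \<otimes>\<^bsub>R\<^esub> (s \<otimes>\<^bsub>R\<^esub> b))}"

definition ring_frac :: "('a, 'c) ring_scheme \<Rightarrow> 'a set \<Rightarrow> 'a \<Rightarrow> 'a \<Rightarrow> ('a \<times> 'a) set"
  where "ring_frac R S a s = ring_loc_rel R S `` {(a, s)}"

definition ring_loc :: "('a, 'c) ring_scheme \<Rightarrow> 'a set \<Rightarrow> ('a \<times> 'a) set ring"
  where "ring_loc R S =
    \<lparr>carrier = (carrier R \<times> S) // ring_loc_rel R S,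
     mult = (\<lambda>X Y. \<Union>(a, s)\<in>X. \<Union>(b, t)\<in>Y. ring_frac R S (a \<otimes>\<^bsub>R\<^esub> b) (s \<otimes>\<^bsub>R\<^esub> t)),
     one = ring_frac R S \<one>\<^bsub>R\<^esub> \<one>\<^bsub>R\<^esub>,
     zero = ring_frac R S \<zero>\<^bsub>R\<^esub> \<one>\<^bsub>R\<^esub>,
     add = (\<lambda>X Y. \<Union>(a, s)\<in>X. \<Union>(b, t)\<in>Y.
       ring_frac R S (t \<otimes>\<^bsub>R\<^esub> a \<oplus>\<^bsub>R\<^esub> s \<otimes>\<^bsub>R\<^esub> b) (s \<otimes>\<^bsub>R\<^esub> t))\<rparr>"

definition mod_loc_rel ::
  "('a, 'c) ring_scheme \<Rightarrow> 'a set \<Rightarrow> ('a, 'b, 'd) module_scheme \<Rightarrow> (('b \<times> 'a) \<times> ('b \<times> 'a)) set"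
  where "mod_loc_rel R S M = {((m, s), (n, t)). m \<in> carrier M \<and> n \<in> carrier M \<and> s \<in> S \<and> t \<in> S \<and>
    (\<exists>u\<in>S. u \<odot>\<^bsub>M\<^esub> (t \<odot>\<^bsub>M\<^esub> m) = u \<odot>\<^bsub>M\<^esub> (s \<odot>\<^bsub>M\<^esub> n))}"

definition mod_frac ::
  "('a, 'c) ring_scheme \<Rightarrow> 'a set \<Rightarrow> ('a, 'b, 'd) module_scheme \<Rightarrow> 'b \<Rightarrow> 'a \<Rightarrow> ('b \<times> 'a) set"
  where "mod_frac R S M m s = mod_loc_rel R S M `` {(m, s)}"

definition mod_loc ::
  "('a, 'c) ring_scheme \<Rightarrow> 'a set \<Rightarrow> ('a, 'b, 'd) module_scheme
    \<Rightarrow> (('a \<times> 'a) set, ('b \<times> 'a) set) module"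
  where "mod_loc R S M =
    \<lparr>carrier = (carrier M \<times> S) // mod_loc_rel R S M,
     mult = undefined, one = undefined,
     zero = mod_frac R S M \<zero>\<^bsub>M\<^esub> \<one>\<^bsub>R\<^esub>,
     add = (\<lambda>X Y. \<Union>(m, s)\<in>X. \<Union>(n, t)\<in>Y.
       mod_frac R S M (t \<odot>\<^bsub>M\<^esub> m \<oplus>\<^bsub>M\<^esub> s \<odot>\<^bsub>M\<^esub> n) (s \<otimes>\<^bsub>R\<^esub> t)),
     smult = (\<lambda>X Y. \<Union>(a, s)\<in>X. \<Union>(m, t)\<in>Y. mod_frac R S M (a \<odot>\<^bsub>M\<^esub> m) (s \<otimes>\<^bsub>R\<^esub> t))\<rparr>"

definition ring_at :: "('a, 'c) ring_scheme \<Rightarrow> 'a set \<Rightarrow> ('a \<times> 'a) set ring"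
  where "ring_at R p = ring_loc R (carrier R - p)"

definition mod_at ::
  "('a, 'c) ring_scheme \<Rightarrow> 'a set \<Rightarrow> ('a, 'b, 'd) module_scheme
    \<Rightarrow> (('a \<times> 'a) set, ('b \<times> 'a) set) module"
  where "mod_at R p M = mod_loc R (carrier R - p) M"

definition to_ring_at :: "('a, 'c) ring_scheme \<Rightarrow> 'a set \<Rightarrow> 'a \<Rightarrow> ('a \<times> 'a) set"
  where "to_ring_at R p a = ring_frac R (carrier R - p) a \<one>\<^bsub>R\<^esub>"


section \<open>Support and associated primes\<close>

definition Supp :: "('a, 'c) ring_scheme \<Rightarrow> ('a, 'b, 'd) module_scheme \<Rightarrow> 'a set set"
  where "Supp R M = {p. primeideal p R \<and> carrier (mod_at R p M) \<noteq> {\<zero>\<^bsub>mod_at R p M\<^esub>}}"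

definition annihilator :: "('a, 'c) ring_scheme \<Rightarrow> ('a, 'b, 'd) module_scheme \<Rightarrow> 'b \<Rightarrow> 'a set"
  where "annihilator R M m = {a \<in> carrier R. a \<odot>\<^bsub>M\<^esub> m = \<zero>\<^bsub>M\<^esub>}"

definition Ass :: "('a, 'c) ring_scheme \<Rightarrow> ('a, 'b, 'd) module_scheme \<Rightarrow> 'a set set"
  where "Ass R M = {p. primeideal p R \<and> (\<exists>m \<in> carrier M. p = annihilator R M m)}"


section \<open>Regular sequences and depth\<close>

definition strongly_regular_seq ::
  "('a, 'c) ring_scheme \<Rightarrow> ('a, 'b, 'd) module_scheme \<Rightarrow> 'a list \<Rightarrow> bool"
  where "strongly_regular_seq R M fs \<longleftrightarrow> set fs \<subseteq> carrier R \<and>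
    (\<forall>i < length fs. inj_on (\<lambda>x. (fs ! i) \<odot>\<^bsub>quot_seq R M (take i fs)\<^esub> x)
                            (carrier (quot_seq R M (take i fs))))"

definition regular_seq ::
  "('a, 'c) ring_scheme \<Rightarrow> ('a, 'b, 'd) module_scheme \<Rightarrow> 'a list \<Rightarrow> bool"
  where "regular_seq R M fs \<longleftrightarrow> set fs \<subseteq> carrier R \<and>
    (\<forall>p \<in> Supp R (quot_seq R M fs).
      strongly_regular_seq (ring_at R p) (mod_at R p M) (map (to_ring_at R p) fs))"

text \<open>For a local ring, \<open>max_ideal R\<close> is its maximal ideal.\<close>

definition max_ideal :: "('a, 'c) ring_scheme \<Rightarrow> 'a set"
  where "max_ideal R = (THE m. maximalideal m R)"

definition maximal_regular_seq ::
  "('a, 'c) ring_scheme \<Rightarrow> ('a, 'b, 'd) module_scheme \<Rightarrow> 'a list \<Rightarrow> bool"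
  where "maximal_regular_seq R M fs \<longleftrightarrow> set fs \<subseteq> max_ideal R \<and> regular_seq R M fs \<and>
    \<not> (\<exists>g \<in> max_ideal R. regular_seq R M (fs @ [g]))"

text \<open>
  The length of a maximal regular sequence is independent of the chosen sequence if \<open>R\<close> is a
  noetherian local ring and \<open>M\<close> a non-zero finitely generated module. If every regular sequence
  can be prolonged (as on the zero module), the depth is \<open>\<infinity>\<close>.
\<close>

definition depth :: "('a, 'c) ring_scheme \<Rightarrow> ('a, 'b, 'd) module_scheme \<Rightarrow> enat"
  where "depth R M =
    (if \<exists>fs. maximal_regular_seq R M fs
     then enat (THE n. \<exists>fs. maximal_regular_seq R M fs \<and> length fs = n)
     else \<infinity>)"

end

theory Submission
  imports Defs
begin

text \<open>
  Depth only enters through the exchange property: if \<open>M\<^sub>p\<close> admits a regular sequence of length \<open>n + 1\<close> in \<open>p\<close>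
  and \<open>x \<in> p\<close> is regular on \<open>M\<^sub>p\<close>, then \<open>M\<^sub>p/x M\<^sub>p\<close> admits one of length \<open>n\<close>. For (iii) implies (i), let
  \<open>I = (f\<^sub>1, \<dots>, f\<^sub>r)\<close>. Regularity on \<open>M\<^sub>p\<close> for all \<open>p \<in> Ass (M/IM)\<close> with \<open>p \<subseteq> q\<close> implies regularity on
  \<open>M\<^sub>q\<close>, by induction on \<open>r\<close> from the right. Let \<open>p \<in> Ass (M/IM)\<close> be minimal such that regularity fails
  on \<open>M\<^sub>p\<close>. Then for every prime \<open>q\<close> with \<open>I \<subseteq> q \<subseteq> p\<close> the depth of \<open>M\<^sub>q\<close> is at least \<open>r\<close>: for
  \<open>q = p\<close> by hypothesis, otherwise by regularity on \<open>M\<^sub>q\<close>. By prime avoidance this makes the sequence regular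
  on \<open>M\<^sub>p\<close>, a contradiction.
\<close>

section \<open>Localized regularity inside a module\<close>

text \<open>Quotients and localizations change the type of a module, so an induction along a
  sequence cannot pass from \<open>M\<close> to \<open>M/fM\<close>. All inductions run instead over
  submodules \<open>N\<close> of the fixed module \<open>M\<close>, standing for \<open>M/N\<close>;
  the actual quotients and localizations are connected to this picture afterwards.

  The defined depth uses regular sequences over \<open>R_p\<close>, and these localize once more, at
  primes of \<open>R_p\<close>. By Nakayama the maximal ideal of \<open>R_p\<close> lies in the
  support in question when \<open>M_p\<close> is nonzero, so regularity there is strong regularity.
  That all maximal regular sequences have the same length is again the exchange property.

  The obstacle in (iii) implies (i) is that depth is given only at \<open>Ass (M/IM)\<close>, while
  prime avoidance meets primes associated to the intermediate quotients and needs depth at these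
  too. Minimality of \<open>p\<close> helps because the associated primes inside a smaller
  \<open>q\<close> are then all good.\<close>

context module begin

definition mult_set :: "'a set \<Rightarrow> bool"
  where "mult_set S \<longleftrightarrow> S \<subseteq> carrier R \<and> \<one> \<in> S \<and> (\<forall>u\<in>S. \<forall>v\<in>S. u \<otimes> v \<in> S)"

text \<open>
  With \<open>S\<close> the complement of a prime \<open>p\<close>, \<open>saturation S N\<close> is the kernel of \<open>M \<rightarrow> (M/N)\<^sub>p\<close>. Thus
  \<open>nonzerodivisor S N f\<close> says that \<open>f\<close> acts injectively on \<open>(M/N)\<^sub>p\<close>, \<open>regular_at S N fs\<close> that \<open>fs\<close> is
  strongly regular on \<open>(M/N)\<^sub>p\<close>, and every localized statement is one about submodules of \<open>M\<close>.
\<close>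

definition saturation :: "'a set \<Rightarrow> 'c set \<Rightarrow> 'c set"
  where "saturation S N = {x \<in> carrier M. \<exists>u\<in>S. u \<odot>\<^bsub>M\<^esub> x \<in> N}"

definition add_multiples :: "'c set \<Rightarrow> 'a \<Rightarrow> 'c set"
  where "add_multiples N f = {n \<oplus>\<^bsub>M\<^esub> f \<odot>\<^bsub>M\<^esub> x | n x. n \<in> N \<and> x \<in> carrier M}"

definition nonzerodivisor :: "'a set \<Rightarrow> 'c set \<Rightarrow> 'a \<Rightarrow> bool"
  where "nonzerodivisor S N f \<longleftrightarrow> (\<forall>x\<in>carrier M. f \<odot>\<^bsub>M\<^esub> x \<in> saturation S N \<longrightarrow> x \<in> saturation S N)"

primrec add_multiples_list :: "'c set \<Rightarrow> 'a list \<Rightarrow> 'c set"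
  where "add_multiples_list N [] = N" | "add_multiples_list N (f # fs) = add_multiples_list (add_multiples N f) fs"

primrec regular_at :: "'a set \<Rightarrow> 'c set \<Rightarrow> 'a list \<Rightarrow> bool"
  where "regular_at S N [] \<longleftrightarrow> True" | "regular_at S N (f # fs) \<longleftrightarrow> nonzerodivisor S N f \<and> regular_at S (add_multiples N f) fs"

section \<open>Arithmetic and congruences modulo a submodule\<close>

lemma smult_lcomm:
  "a \<in> carrier R \<Longrightarrow> b \<in> carrier R \<Longrightarrow> x \<in> carrier M \<Longrightarrow> a \<odot>\<^bsub>M\<^esub> (b \<odot>\<^bsub>M\<^esub> x) = b \<odot>\<^bsub>M\<^esub> (a \<odot>\<^bsub>M\<^esub> x)"
  by (simp flip: smult_assoc1 add: R.m_comm)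

lemma smult_r_diff:
  "a \<in> carrier R \<Longrightarrow> x \<in> carrier M \<Longrightarrow> y \<in> carrier M \<Longrightarrow>
    a \<odot>\<^bsub>M\<^esub> (x \<ominus>\<^bsub>M\<^esub> y) = a \<odot>\<^bsub>M\<^esub> x \<ominus>\<^bsub>M\<^esub> a \<odot>\<^bsub>M\<^esub> y"
  by (simp add: M.minus_eq smult_r_distr smult_r_minus)

lemma minus_zero_M: "\<ominus>\<^bsub>M\<^esub> \<zero>\<^bsub>M\<^esub> = \<zero>\<^bsub>M\<^esub>"
  by (metis M.a_inv_closed M.l_zero M.r_neg M.zero_closed)

lemma minus_add_cancel:
  "x \<in> carrier M \<Longrightarrow> y \<in> carrier M \<Longrightarrow> x \<oplus>\<^bsub>M\<^esub> (y \<oplus>\<^bsub>M\<^esub> \<ominus>\<^bsub>M\<^esub> x) = y"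
  by (metis M.a_comm M.a_inv_closed M.add.m_closed M.r_neg1 M.r_neg2)

text \<open>A normal form for linear expressions: products of scalars become nested multiples, whose
  order is fixed by the permutative rule \<open>smult_lcomm\<close>.\<close>

lemmas module_simps = smult_assoc1 smult_lcomm smult_l_distr smult_r_distr smult_r_minus smult_l_minus
  M.minus_eq R.minus_eq M.a_ac M.minus_add M.r_neg M.l_neg M.r_neg1 M.r_neg2

lemma submodule_carrier: "submodule N R M \<Longrightarrow> x \<in> N \<Longrightarrow> x \<in> carrier M"
  using submoduleE(1) by blast

lemma submodule_zero: "submodule N R M \<Longrightarrow> \<zero>\<^bsub>M\<^esub> \<in> N"
  using subgroup.one_closed[OF submodule.axioms(1)] by fastforce

lemma submodule_diff: "submodule N R M \<Longrightarrow> x \<in> N \<Longrightarrow> y \<in> N \<Longrightarrow> x \<ominus>\<^bsub>M\<^esub> y \<in> N"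
  by (simp add: M.minus_eq submoduleE)

lemmas submodule_closed = submodule_carrier submodule_zero submodule_diff submoduleE(3-5)

lemma zero_submodule: "submodule {\<zero>\<^bsub>M\<^esub>} R M"
  by (rule submoduleI) auto

lemma diff_cancel_right:
  "submodule N R M \<Longrightarrow> x \<in> carrier M \<Longrightarrow> y \<in> N \<Longrightarrow> x \<ominus>\<^bsub>M\<^esub> y \<in> N \<Longrightarrow> x \<in> N"
  using submoduleE(5)[of N "x \<ominus>\<^bsub>M\<^esub> y" y] submodule_carrier[of N y]
  by (simp add: module_simps)

lemma diff_cancel_left:
  "submodule N R M \<Longrightarrow> x \<in> N \<Longrightarrow> y \<in> carrier M \<Longrightarrow> x \<ominus>\<^bsub>M\<^esub> y \<in> N \<Longrightarrow> y \<in> N"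
  using submodule_diff[of N x "x \<ominus>\<^bsub>M\<^esub> y"] submodule_carrier[of N x]
  by (simp add: module_simps minus_add_cancel)

lemma diff_trans:
  assumes "submodule N R M" "x \<in> carrier M" "y \<in> carrier M" "z \<in> carrier M"
    "x \<ominus>\<^bsub>M\<^esub> y \<in> N" "y \<ominus>\<^bsub>M\<^esub> z \<in> N"
  shows "x \<ominus>\<^bsub>M\<^esub> z \<in> N"
  using submoduleE(5)[OF assms(1,5,6)] assms(2-4) by (simp add: module_simps)

lemma diff_sym:
  assumes "submodule N R M" "x \<in> carrier M" "y \<in> carrier M" "x \<ominus>\<^bsub>M\<^esub> y \<in> N"
  shows "y \<ominus>\<^bsub>M\<^esub> x \<in> N"
  using submoduleE(3)[OF assms(1,4)] assms(2-3) by (simp add: module_simps)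

lemma diff_smult:
  assumes "submodule N R M" "x \<in> carrier M" "y \<in> carrier M" "a \<in> carrier R" "x \<ominus>\<^bsub>M\<^esub> y \<in> N"
  shows "a \<odot>\<^bsub>M\<^esub> x \<ominus>\<^bsub>M\<^esub> a \<odot>\<^bsub>M\<^esub> y \<in> N"
  using submoduleE(4)[OF assms(1,4,5)] assms(2-4) by (simp add: smult_r_diff)

section \<open>Multiplicative sets and saturation\<close>

lemma mult_setD: "mult_set S \<Longrightarrow> u \<in> S \<Longrightarrow> u \<in> carrier R" "mult_set S \<Longrightarrow> \<one> \<in> S"
  "mult_set S \<Longrightarrow> u \<in> S \<Longrightarrow> v \<in> S \<Longrightarrow> u \<otimes> v \<in> S"
  unfolding mult_set_def by auto

lemma mult_set_one: "mult_set {\<one>}"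
  by (simp add: mult_set_def)

lemma mult_set_prime:
  assumes "primeideal p R" shows "mult_set (carrier R - p)"
proof -
  interpret primeideal p R by fact
  show ?thesis
    using I_notcarr I_prime one_imp_carrier unfolding mult_set_def by auto
qed

lemma satI: "x \<in> carrier M \<Longrightarrow> u \<in> S \<Longrightarrow> u \<odot>\<^bsub>M\<^esub> x \<in> N \<Longrightarrow> x \<in> saturation S N"
  unfolding saturation_def by auto

lemma satE: "x \<in> saturation S N \<Longrightarrow> (\<And>u. x \<in> carrier M \<Longrightarrow> u \<in> S \<Longrightarrow> u \<odot>\<^bsub>M\<^esub> x \<in> N \<Longrightarrow> thesis) \<Longrightarrow> thesis"
  unfolding saturation_def by auto

lemma sat_carrier: "x \<in> saturation S N \<Longrightarrow> x \<in> carrier M"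
  unfolding saturation_def by auto

lemma sat_superset: "mult_set S \<Longrightarrow> submodule N R M \<Longrightarrow> N \<subseteq> saturation S N"
  using submodule_carrier mult_setD(2) by (force intro: satI)

lemma sat_mono: "N \<subseteq> K \<Longrightarrow> S \<subseteq> T \<Longrightarrow> saturation S N \<subseteq> saturation T K"
  unfolding saturation_def by auto

lemma sat_submodule:
  assumes S: "mult_set S" and N: "submodule N R M"
  shows "submodule (saturation S N) R M"
proof (rule submoduleI)
  show "saturation S N \<subseteq> carrier M" using sat_carrier by blast
  show "\<zero>\<^bsub>M\<^esub> \<in> saturation S N" using sat_superset[OF S N] submodule_zero[OF N] by blast
  show "\<ominus>\<^bsub>M\<^esub> a \<in> saturation S N" if "a \<in> saturation S N" for a
    using that S N by (auto elim!: satE intro!: satI simp: smult_r_minus mult_setD submoduleE)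
  show "a \<oplus>\<^bsub>M\<^esub> b \<in> saturation S N" if "a \<in> saturation S N" "b \<in> saturation S N" for a b
  proof -
    obtain u where u: "u \<in> S" "u \<odot>\<^bsub>M\<^esub> a \<in> N" "a \<in> carrier M" using \<open>a \<in> saturation S N\<close> by (rule satE)
    obtain v where v: "v \<in> S" "v \<odot>\<^bsub>M\<^esub> b \<in> N" "b \<in> carrier M" using \<open>b \<in> saturation S N\<close> by (rule satE)
    have c: "u \<in> carrier R" "v \<in> carrier R" using u v S mult_setD by auto
    have "(u \<otimes> v) \<odot>\<^bsub>M\<^esub> (a \<oplus>\<^bsub>M\<^esub> b) = v \<odot>\<^bsub>M\<^esub> (u \<odot>\<^bsub>M\<^esub> a) \<oplus>\<^bsub>M\<^esub> u \<odot>\<^bsub>M\<^esub> (v \<odot>\<^bsub>M\<^esub> b)"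
      using u v c by (simp add: module_simps)
    also have "\<dots> \<in> N" using u v c N by (simp add: submoduleE)
    finally show ?thesis using u v S by (intro satI[where u="u \<otimes> v"]) (auto simp: mult_setD)
  qed
  show "a \<odot>\<^bsub>M\<^esub> x \<in> saturation S N" if "a \<in> carrier R" "x \<in> saturation S N" for a x
  proof -
    obtain u where u: "u \<in> S" "u \<odot>\<^bsub>M\<^esub> x \<in> N" "x \<in> carrier M" using \<open>x \<in> saturation S N\<close> by (rule satE)
    have "u \<odot>\<^bsub>M\<^esub> (a \<odot>\<^bsub>M\<^esub> x) = a \<odot>\<^bsub>M\<^esub> (u \<odot>\<^bsub>M\<^esub> x)"
      using u that S by (intro smult_lcomm) (auto simp: mult_setD)
    also have "\<dots> \<in> N" using u that N by (simp add: submoduleE)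
    finally show ?thesis using u that S by (intro satI[where u=u]) (auto simp: mult_setD)
  qed
qed

text \<open>Elements of \<open>S\<close> act invertibly on the localization; the two witnesses
  simply multiply.\<close>

lemma sat_cancel:
  assumes S: "mult_set S" and "x \<in> carrier M" "u \<in> S" "u \<odot>\<^bsub>M\<^esub> x \<in> saturation S N"
  shows "x \<in> saturation S N"
proof -
  obtain v where v: "v \<in> S" "v \<odot>\<^bsub>M\<^esub> (u \<odot>\<^bsub>M\<^esub> x) \<in> N" using assms(4) by (rule satE)
  then have "(v \<otimes> u) \<odot>\<^bsub>M\<^esub> x \<in> N" using assms by (simp add: smult_assoc1 mult_setD)
  then show ?thesis using assms v by (intro satI[where u="v \<otimes> u"]) (auto simp: mult_setD)
qed

lemma sat_sat: "mult_set S \<Longrightarrow> submodule N R M \<Longrightarrow> saturation S (saturation S N) = saturation S N"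
  using sat_superset[of S "saturation S N"] sat_submodule[of S N] by (auto elim!: satE intro: sat_cancel satI)

lemma sat_one: "submodule N R M \<Longrightarrow> saturation {\<one>} N = N"
  unfolding saturation_def using submodule_carrier by auto

section \<open>Dividing out multiples of ring elements\<close>

lemma add_multiples_submodule:
  assumes N: "submodule N R M" and f: "f \<in> carrier R"
  shows "submodule (add_multiples N f) R M"
proof (rule submoduleI)
  show "add_multiples N f \<subseteq> carrier M" unfolding add_multiples_def using submodule_carrier[OF N] f by auto
  show "\<zero>\<^bsub>M\<^esub> \<in> add_multiples N f" unfolding add_multiples_def using f submodule_zero[OF N]
    by (intro CollectI exI[of _ "\<zero>\<^bsub>M\<^esub>"]) auto
  show "\<ominus>\<^bsub>M\<^esub> a \<in> add_multiples N f" if a: "a \<in> add_multiples N f" for a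
  proof -
    obtain n x where "n \<in> N" "x \<in> carrier M" "a = n \<oplus>\<^bsub>M\<^esub> f \<odot>\<^bsub>M\<^esub> x" using a unfolding add_multiples_def by blast
    then have "\<ominus>\<^bsub>M\<^esub> a = \<ominus>\<^bsub>M\<^esub> n \<oplus>\<^bsub>M\<^esub> f \<odot>\<^bsub>M\<^esub> (\<ominus>\<^bsub>M\<^esub> x)" "\<ominus>\<^bsub>M\<^esub> n \<in> N" "\<ominus>\<^bsub>M\<^esub> x \<in> carrier M"
      using N f by (auto simp: submodule_closed module_simps)
    then show ?thesis unfolding add_multiples_def by blast
  qed
  show "a \<oplus>\<^bsub>M\<^esub> b \<in> add_multiples N f" if ab: "a \<in> add_multiples N f" "b \<in> add_multiples N f" for a b
  proof -
    obtain n x where 1: "n \<in> N" "x \<in> carrier M" "a = n \<oplus>\<^bsub>M\<^esub> f \<odot>\<^bsub>M\<^esub> x" using ab unfolding add_multiples_def by blast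
    obtain m y where 2: "m \<in> N" "y \<in> carrier M" "b = m \<oplus>\<^bsub>M\<^esub> f \<odot>\<^bsub>M\<^esub> y" using ab unfolding add_multiples_def by blast
    have "n \<in> carrier M" "m \<in> carrier M" using 1 2 submodule_carrier[OF N] by auto
    then have "a \<oplus>\<^bsub>M\<^esub> b = (n \<oplus>\<^bsub>M\<^esub> m) \<oplus>\<^bsub>M\<^esub> f \<odot>\<^bsub>M\<^esub> (x \<oplus>\<^bsub>M\<^esub> y)" "n \<oplus>\<^bsub>M\<^esub> m \<in> N" "x \<oplus>\<^bsub>M\<^esub> y \<in> carrier M"
      using N f 1 2 by (auto simp: submodule_closed module_simps)
    then show ?thesis unfolding add_multiples_def by blast
  qed
  show "a \<odot>\<^bsub>M\<^esub> b \<in> add_multiples N f" if a: "a \<in> carrier R" and b: "b \<in> add_multiples N f" for a b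
  proof -
    obtain n x where "n \<in> N" "x \<in> carrier M" "b = n \<oplus>\<^bsub>M\<^esub> f \<odot>\<^bsub>M\<^esub> x" using b unfolding add_multiples_def by blast
    then have "a \<odot>\<^bsub>M\<^esub> b = a \<odot>\<^bsub>M\<^esub> n \<oplus>\<^bsub>M\<^esub> f \<odot>\<^bsub>M\<^esub> (a \<odot>\<^bsub>M\<^esub> x)" "a \<odot>\<^bsub>M\<^esub> n \<in> N" "a \<odot>\<^bsub>M\<^esub> x \<in> carrier M"
      using N f a by (auto simp: submodule_closed module_simps)
    then show ?thesis unfolding add_multiples_def by blast
  qed
qed

lemma add_multiples_iff:
  assumes N: "submodule N R M" and f: "f \<in> carrier R" and z: "z \<in> carrier M"
  shows "z \<in> add_multiples N f \<longleftrightarrow> (\<exists>x\<in>carrier M. z \<ominus>\<^bsub>M\<^esub> f \<odot>\<^bsub>M\<^esub> x \<in> N)"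
proof
  assume "z \<in> add_multiples N f"
  then obtain n x where *: "n \<in> N" "x \<in> carrier M" "z = n \<oplus>\<^bsub>M\<^esub> f \<odot>\<^bsub>M\<^esub> x" unfolding add_multiples_def by blast
  then have "z \<ominus>\<^bsub>M\<^esub> f \<odot>\<^bsub>M\<^esub> x = n" using f submodule_carrier[OF N] by (simp add: module_simps)
  then show "\<exists>x\<in>carrier M. z \<ominus>\<^bsub>M\<^esub> f \<odot>\<^bsub>M\<^esub> x \<in> N" using *(1,2) by (intro bexI[of _ x]) auto
next
  assume "\<exists>x\<in>carrier M. z \<ominus>\<^bsub>M\<^esub> f \<odot>\<^bsub>M\<^esub> x \<in> N"
  then obtain x where x: "x \<in> carrier M" "z \<ominus>\<^bsub>M\<^esub> f \<odot>\<^bsub>M\<^esub> x \<in> N" by blast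
  have "z = (z \<ominus>\<^bsub>M\<^esub> f \<odot>\<^bsub>M\<^esub> x) \<oplus>\<^bsub>M\<^esub> f \<odot>\<^bsub>M\<^esub> x" using x z f by (simp add: module_simps)
  then show "z \<in> add_multiples N f" using x unfolding add_multiples_def by blast
qed

lemma add_multiples_superset:
  assumes N: "submodule N R M" and f: "f \<in> carrier R" shows "N \<subseteq> add_multiples N f"
proof
  fix x assume x: "x \<in> N"
  then have "x \<ominus>\<^bsub>M\<^esub> f \<odot>\<^bsub>M\<^esub> \<zero>\<^bsub>M\<^esub> \<in> N" using submodule_carrier[OF N x] f by (simp add: M.minus_eq minus_zero_M)
  then show "x \<in> add_multiples N f" using add_multiples_iff[OF N f submodule_carrier[OF N x]] by blast
qed

lemma smult_in_add_multiples:
  "submodule N R M \<Longrightarrow> f \<in> carrier R \<Longrightarrow> x \<in> carrier M \<Longrightarrow> f \<odot>\<^bsub>M\<^esub> x \<in> add_multiples N f"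
  by (auto simp: add_multiples_iff module_simps submodule_zero intro!: bexI[of _ x])

lemma add_multiples_minimal:
  assumes N: "submodule N R M" and K: "submodule K R M" and "N \<subseteq> K"
    and "\<And>x. x \<in> carrier M \<Longrightarrow> f \<odot>\<^bsub>M\<^esub> x \<in> K"
  shows "add_multiples N f \<subseteq> K"
  unfolding add_multiples_def using assms submoduleE(5)[OF K] by auto

lemma add_multiples_mono: "N \<subseteq> K \<Longrightarrow> add_multiples N f \<subseteq> add_multiples K f"
  unfolding add_multiples_def by blast

lemma add_multiples_commute:
  assumes N: "submodule N R M" and f: "f \<in> carrier R" and g: "g \<in> carrier R"
  shows "add_multiples (add_multiples N f) g = add_multiples (add_multiples N g) f"
proof -
  have "add_multiples (add_multiples N f) g \<subseteq> add_multiples (add_multiples N g) f" if f: "f \<in> carrier R" and g: "g \<in> carrier R" for f g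
  proof -
    note sm = add_multiples_submodule[OF N f] add_multiples_submodule[OF N g]
    show ?thesis
      using add_multiples_superset[OF sm(2) f] smult_in_add_multiples[OF N g] add_multiples_submodule[OF sm(2) f]
        add_multiples_mono[OF add_multiples_superset[OF N g], of f]
      by (intro add_multiples_minimal[OF sm(1)]) blast+
  qed
  then show ?thesis using f g by blast
qed

lemma sat_add_multiples_iff:
  assumes S: "mult_set S" and N: "submodule N R M" and f: "f \<in> carrier R" and z: "z \<in> carrier M"
  shows "z \<in> saturation S (add_multiples N f) \<longleftrightarrow> (\<exists>u\<in>S. \<exists>x\<in>carrier M. u \<odot>\<^bsub>M\<^esub> z \<ominus>\<^bsub>M\<^esub> f \<odot>\<^bsub>M\<^esub> x \<in> N)"
  using assms by (auto simp: saturation_def add_multiples_iff mult_setD)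

text \<open>The relation between \<open>z\<close> and \<open>x\<close> is required only up to
  saturation, because that is all that remains after a nonzerodivisor on the localization has been
  cancelled.\<close>

lemma sat_add_multiples_satI:
  assumes S: "mult_set S" and N: "submodule N R M" and f: "f \<in> carrier R" and z: "z \<in> carrier M"
    and "u \<in> S" "x \<in> carrier M" "u \<odot>\<^bsub>M\<^esub> z \<ominus>\<^bsub>M\<^esub> f \<odot>\<^bsub>M\<^esub> x \<in> saturation S N"
  shows "z \<in> saturation S (add_multiples N f)"
proof -
  have u: "u \<in> carrier R" using S assms(5) mult_setD by auto
  have "saturation S N \<subseteq> saturation S (add_multiples N f)" using sat_mono[OF add_multiples_superset[OF N f]] by blast
  moreover have "f \<odot>\<^bsub>M\<^esub> x \<in> saturation S (add_multiples N f)"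
    using smult_in_add_multiples[OF N f] sat_superset[OF S add_multiples_submodule[OF N f]] assms by auto
  ultimately have "u \<odot>\<^bsub>M\<^esub> z \<in> saturation S (add_multiples N f)"
    using diff_cancel_right[OF sat_submodule[OF S add_multiples_submodule[OF N f]]] assms(7) u z by blast
  then show ?thesis using sat_cancel[OF S z] assms by blast
qed

lemma nonzerodivisorD: "nonzerodivisor S N f \<Longrightarrow> x \<in> carrier M \<Longrightarrow> f \<odot>\<^bsub>M\<^esub> x \<in> saturation S N \<Longrightarrow> x \<in> saturation S N"
  unfolding nonzerodivisor_def by blast

text \<open>Localizing at \<open>T\<close> factors through localizing at \<open>S\<close>. The
  denominator \<open>u\<close> from \<open>T\<close> is moved inside, so that regularity at
  \<open>S\<close> is tested on \<open>u x\<close>.\<close>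

lemma nonzerodivisor_mono:
  assumes "mult_set S" "mult_set T" "S \<subseteq> T" "f \<in> carrier R" "nonzerodivisor S N f" "submodule N R M"
  shows "nonzerodivisor T N f"
  unfolding nonzerodivisor_def
proof (intro ballI impI)
  fix x assume x: "x \<in> carrier M" "f \<odot>\<^bsub>M\<^esub> x \<in> saturation T N"
  then obtain u where u: "u \<in> T" "u \<odot>\<^bsub>M\<^esub> (f \<odot>\<^bsub>M\<^esub> x) \<in> N" by (auto elim: satE)
  then have "f \<odot>\<^bsub>M\<^esub> (u \<odot>\<^bsub>M\<^esub> x) \<in> saturation S N"
    using x assms sat_superset[of S N] smult_lcomm[of f u x] by (auto simp: mult_setD)
  then have "u \<odot>\<^bsub>M\<^esub> x \<in> saturation S N" using nonzerodivisorD[OF assms(5)] u x assms mult_setD by auto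
  then have "u \<odot>\<^bsub>M\<^esub> x \<in> saturation T N" using sat_mono assms by blast
  then show "x \<in> saturation T N" using sat_cancel assms u x by blast
qed

lemma regular_at_mono:
  assumes "mult_set S" "mult_set T" "S \<subseteq> T" "set fs \<subseteq> carrier R" "regular_at S N fs" "submodule N R M"
  shows "regular_at T N fs"
  using assms(4-6)
  by (induction fs arbitrary: N) (auto intro: nonzerodivisor_mono[OF assms(1-3)] add_multiples_submodule)

lemma add_multiples_list_append: "add_multiples_list N (fs @ gs) = add_multiples_list (add_multiples_list N fs) gs"
  by (induction fs arbitrary: N) auto

lemma regular_at_append: "regular_at S N (fs @ gs) \<longleftrightarrow> regular_at S N fs \<and> regular_at S (add_multiples_list N fs) gs"
  by (induction fs arbitrary: N) auto

lemma add_multiples_list_submodule: "submodule N R M \<Longrightarrow> set fs \<subseteq> carrier R \<Longrightarrow> submodule (add_multiples_list N fs) R M"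
  by (induction fs arbitrary: N) (auto intro: add_multiples_submodule)

lemma add_multiples_list_superset: "submodule N R M \<Longrightarrow> set fs \<subseteq> carrier R \<Longrightarrow> N \<subseteq> add_multiples_list N fs"
proof (induction fs arbitrary: N)
  case (Cons g fs)
  then show ?case using add_multiples_superset[of N g] add_multiples_submodule[of N g] by fastforce
qed auto

lemma smult_in_add_multiples_list: "submodule N R M \<Longrightarrow> set fs \<subseteq> carrier R \<Longrightarrow> f \<in> set fs \<Longrightarrow> x \<in> carrier M \<Longrightarrow>
    f \<odot>\<^bsub>M\<^esub> x \<in> add_multiples_list N fs"
proof (induction fs arbitrary: N)
  case (Cons g fs)
  then show ?case
    using add_multiples_list_superset[OF add_multiples_submodule[of N g], of fs] smult_in_add_multiples[of N f x]
    by (auto simp: add_multiples_submodule)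
qed auto

lemma add_multiples_list_minimal:
  "submodule N R M \<Longrightarrow> submodule K R M \<Longrightarrow> N \<subseteq> K \<Longrightarrow> set fs \<subseteq> carrier R \<Longrightarrow>
    (\<And>f x. f \<in> set fs \<Longrightarrow> x \<in> carrier M \<Longrightarrow> f \<odot>\<^bsub>M\<^esub> x \<in> K) \<Longrightarrow> add_multiples_list N fs \<subseteq> K"
proof (induction fs arbitrary: N)
  case (Cons g fs)
  then show ?case using add_multiples_minimal[of N K g] add_multiples_submodule[of N g] by auto
qed auto

text \<open>If \<open>a x = b y\<close> modulo \<open>N\<close>, regularity of \<open>b\<close>
  modulo \<open>a\<close> gives \<open>y = a z\<close>, and cancelling \<open>a\<close> gives
  \<open>x = b z\<close>, all up to denominators. This is the formal half of exchanging
  \<open>a\<close> and \<open>b\<close>; the other half, that \<open>b\<close> is regular on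
  \<open>M/N\<close> itself, is \<open>nonzerodivisor_of_successive\<close> and rests on
  Nakayama.\<close>

lemma nonzerodivisor_swap:
  assumes S: "mult_set S" and N: "submodule N R M" and a: "a \<in> carrier R" and b: "b \<in> carrier R"
    and ra: "nonzerodivisor S N a" and rb: "nonzerodivisor S (add_multiples N a) b"
  shows "nonzerodivisor S (add_multiples N b) a"
  unfolding nonzerodivisor_def
proof (intro ballI impI)
  fix x assume x: "x \<in> carrier M" and ax: "a \<odot>\<^bsub>M\<^esub> x \<in> saturation S (add_multiples N b)"
  note sN = sat_submodule[OF S N]
  obtain u y where u: "u \<in> S" and y: "y \<in> carrier M" and 1: "u \<odot>\<^bsub>M\<^esub> (a \<odot>\<^bsub>M\<^esub> x) \<ominus>\<^bsub>M\<^esub> b \<odot>\<^bsub>M\<^esub> y \<in> N"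
    using ax a b x sat_add_multiples_iff[OF S N b] by auto
  have uR: "u \<in> carrier R" using u S mult_setD by auto
  have "b \<odot>\<^bsub>M\<^esub> y \<ominus>\<^bsub>M\<^esub> a \<odot>\<^bsub>M\<^esub> (u \<odot>\<^bsub>M\<^esub> x) \<in> N"
    using diff_sym[OF N _ _ 1] uR x y a b by (simp add: smult_lcomm[of u a])
  then have "b \<odot>\<^bsub>M\<^esub> y \<in> add_multiples N a" using x y uR a b by (subst add_multiples_iff[OF N a]) auto
  then have "y \<in> saturation S (add_multiples N a)"
    using nonzerodivisorD[OF rb y] sat_superset[OF S add_multiples_submodule[OF N a]] by auto
  then obtain v z where v: "v \<in> S" and z: "z \<in> carrier M" and 2: "v \<odot>\<^bsub>M\<^esub> y \<ominus>\<^bsub>M\<^esub> a \<odot>\<^bsub>M\<^esub> z \<in> N"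
    using sat_add_multiples_iff[OF S N a y] by auto
  have vR: "v \<in> carrier R" using v S mult_setD by auto
  \<comment> \<open>Multiplied by \<open>v\<close> and by \<open>b\<close>, both relations contain
    \<open>v b y\<close>. Eliminating it leaves a multiple of \<open>a\<close>, which can be
    cancelled.\<close>
  have 3: "v \<odot>\<^bsub>M\<^esub> (u \<odot>\<^bsub>M\<^esub> (a \<odot>\<^bsub>M\<^esub> x)) \<ominus>\<^bsub>M\<^esub> v \<odot>\<^bsub>M\<^esub> (b \<odot>\<^bsub>M\<^esub> y) \<in> N"
    by (rule diff_smult[OF N _ _ _ 1]) (use x y a b uR vR in auto)
  have 4: "b \<odot>\<^bsub>M\<^esub> (v \<odot>\<^bsub>M\<^esub> y) \<ominus>\<^bsub>M\<^esub> b \<odot>\<^bsub>M\<^esub> (a \<odot>\<^bsub>M\<^esub> z) \<in> N"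
    by (rule diff_smult[OF N _ _ _ 2]) (use z y a b uR vR in auto)
  have "v \<odot>\<^bsub>M\<^esub> (u \<odot>\<^bsub>M\<^esub> (a \<odot>\<^bsub>M\<^esub> x)) \<ominus>\<^bsub>M\<^esub> b \<odot>\<^bsub>M\<^esub> (a \<odot>\<^bsub>M\<^esub> z) \<in> N"
    by (rule diff_trans[OF N _ _ _ _ 4]) (use 3 x y z a b uR vR smult_lcomm[of v b y] in auto)
  moreover have "v \<odot>\<^bsub>M\<^esub> (u \<odot>\<^bsub>M\<^esub> (a \<odot>\<^bsub>M\<^esub> x)) \<ominus>\<^bsub>M\<^esub> b \<odot>\<^bsub>M\<^esub> (a \<odot>\<^bsub>M\<^esub> z) = a \<odot>\<^bsub>M\<^esub> ((v \<otimes> u) \<odot>\<^bsub>M\<^esub> x \<ominus>\<^bsub>M\<^esub> b \<odot>\<^bsub>M\<^esub> z)"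
    using x z a b uR vR by (simp add: module_simps)
  ultimately have "(v \<otimes> u) \<odot>\<^bsub>M\<^esub> x \<ominus>\<^bsub>M\<^esub> b \<odot>\<^bsub>M\<^esub> z \<in> saturation S N"
    using nonzerodivisorD[OF ra, of "(v \<otimes> u) \<odot>\<^bsub>M\<^esub> x \<ominus>\<^bsub>M\<^esub> b \<odot>\<^bsub>M\<^esub> z"] x z a b uR vR sat_superset[OF S N] by auto
  then show "x \<in> saturation S (add_multiples N b)"
    using sat_add_multiples_satI[OF S N b x mult_setD(3)[OF S v u] z] by blast
qed

definition noetherian_module :: bool
  where "noetherian_module \<longleftrightarrow> (\<forall>F. F \<noteq> {} \<and> (\<forall>N\<in>F. submodule N R M) \<longrightarrow> (\<exists>N\<in>F. \<forall>K\<in>F. N \<subseteq> K \<longrightarrow> K = N))"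

section \<open>Associated primes and prime avoidance\<close>

text \<open>The annihilator of the class of \<open>x\<close> in \<open>M/N\<close>. Accordingly
  \<open>assoc_primes N\<close> is \<open>Ass (M/N)\<close>, and \<open>adjoin N x\<close> is the
  preimage of the cyclic submodule generated by that class.\<close>

definition colon :: "'c set \<Rightarrow> 'c \<Rightarrow> 'a set"
  where "colon N x = {r \<in> carrier R. r \<odot>\<^bsub>M\<^esub> x \<in> N}"

definition assoc_primes :: "'c set \<Rightarrow> 'a set set"
  where "assoc_primes N = {q. primeideal q R \<and> (\<exists>x\<in>carrier M. q = colon N x)}"

definition adjoin :: "'c set \<Rightarrow> 'c \<Rightarrow> 'c set"
  where "adjoin N x = {y \<in> carrier M. \<exists>r\<in>carrier R. y \<ominus>\<^bsub>M\<^esub> r \<odot>\<^bsub>M\<^esub> x \<in> N}"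

lemma noetherian_moduleE:
  assumes noetherian_module "N \<in> F" "\<And>N. N \<in> F \<Longrightarrow> submodule N R M"
  obtains N where "N \<in> F" "\<And>K. K \<in> F \<Longrightarrow> N \<subseteq> K \<Longrightarrow> K = N"
proof -
  have "\<exists>N\<in>F. \<forall>K\<in>F. N \<subseteq> K \<longrightarrow> K = N" using assms unfolding noetherian_module_def by blast
  then show ?thesis using that by blast
qed

lemma adjoin_submodule:
  assumes N: "submodule N R M" and x: "x \<in> carrier M"
  shows "submodule (adjoin N x) R M"
proof (rule submoduleI)
  show "adjoin N x \<subseteq> carrier M" unfolding adjoin_def by auto
  show "\<zero>\<^bsub>M\<^esub> \<in> adjoin N x" unfolding adjoin_def using x submodule_zero[OF N]
    by (auto simp: M.minus_eq minus_zero_M intro!: bexI[of _ \<zero>])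
  show "\<ominus>\<^bsub>M\<^esub> y \<in> adjoin N x" if y: "y \<in> adjoin N x" for y
  proof -
    obtain r where r: "r \<in> carrier R" "y \<in> carrier M" "y \<ominus>\<^bsub>M\<^esub> r \<odot>\<^bsub>M\<^esub> x \<in> N" using y unfolding adjoin_def by blast
    have "\<ominus>\<^bsub>M\<^esub> y \<ominus>\<^bsub>M\<^esub> (\<ominus> r) \<odot>\<^bsub>M\<^esub> x = \<ominus>\<^bsub>M\<^esub> (y \<ominus>\<^bsub>M\<^esub> r \<odot>\<^bsub>M\<^esub> x)"
      using r x by (simp add: module_simps)
    also have "\<dots> \<in> N" using r N by (simp add: submoduleE)
    finally show ?thesis using r unfolding adjoin_def by (auto intro!: bexI[of _ "\<ominus> r"])
  qed
  show "y \<oplus>\<^bsub>M\<^esub> z \<in> adjoin N x" if y: "y \<in> adjoin N x" and z: "z \<in> adjoin N x" for y z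
  proof -
    obtain r where r: "r \<in> carrier R" "y \<in> carrier M" "y \<ominus>\<^bsub>M\<^esub> r \<odot>\<^bsub>M\<^esub> x \<in> N" using y unfolding adjoin_def by blast
    obtain s where s: "s \<in> carrier R" "z \<in> carrier M" "z \<ominus>\<^bsub>M\<^esub> s \<odot>\<^bsub>M\<^esub> x \<in> N" using z unfolding adjoin_def by blast
    have "y \<oplus>\<^bsub>M\<^esub> z \<ominus>\<^bsub>M\<^esub> (r \<oplus> s) \<odot>\<^bsub>M\<^esub> x = (y \<ominus>\<^bsub>M\<^esub> r \<odot>\<^bsub>M\<^esub> x) \<oplus>\<^bsub>M\<^esub> (z \<ominus>\<^bsub>M\<^esub> s \<odot>\<^bsub>M\<^esub> x)"
      using r s x by (simp add: module_simps)
    also have "\<dots> \<in> N" using r s N by (simp add: submoduleE)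
    finally show ?thesis using r s unfolding adjoin_def by (auto intro!: bexI[of _ "r \<oplus> s"])
  qed
  show "a \<odot>\<^bsub>M\<^esub> y \<in> adjoin N x" if a: "a \<in> carrier R" and y: "y \<in> adjoin N x" for a y
  proof -
    obtain r where r: "r \<in> carrier R" "y \<in> carrier M" "y \<ominus>\<^bsub>M\<^esub> r \<odot>\<^bsub>M\<^esub> x \<in> N" using y unfolding adjoin_def by blast
    then have "a \<odot>\<^bsub>M\<^esub> y \<ominus>\<^bsub>M\<^esub> a \<odot>\<^bsub>M\<^esub> (r \<odot>\<^bsub>M\<^esub> x) \<in> N" using diff_smult[OF N] a x by auto
    then show ?thesis using r a x unfolding adjoin_def by (auto simp: smult_assoc1 intro!: bexI[of _ "a \<otimes> r"])
  qed
qed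

lemma adjoin_superset: "submodule N R M \<Longrightarrow> x \<in> carrier M \<Longrightarrow> N \<subseteq> adjoin N x"
  unfolding adjoin_def by (auto simp: M.minus_eq minus_zero_M submodule_carrier intro!: bexI[of _ \<zero>])

lemma in_adjoin_self: "submodule N R M \<Longrightarrow> x \<in> carrier M \<Longrightarrow> x \<in> adjoin N x"
  unfolding adjoin_def using submodule_zero by (auto simp: M.minus_eq M.r_neg intro!: bexI[of _ \<one>])

lemma adjoin_minimal:
  assumes N: "submodule N R M" and K: "submodule K R M" "N \<subseteq> K" "x \<in> K"
  shows "adjoin N x \<subseteq> K"
proof
  fix y assume "y \<in> adjoin N x"
  then obtain r where r: "y \<in> carrier M" "r \<in> carrier R" "y \<ominus>\<^bsub>M\<^esub> r \<odot>\<^bsub>M\<^esub> x \<in> N" unfolding adjoin_def by blast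
  then have "r \<odot>\<^bsub>M\<^esub> x \<in> K" using submoduleE(4)[OF K(1)] K(3) by blast
  then show "y \<in> K" using diff_cancel_right[OF K(1)] r K(2) by blast
qed

section \<open>Nakayama's lemma at a prime\<close>

lemma one_diff_notin_prime:
  assumes p: "primeideal p R" and "u \<in> carrier R - p" "a \<in> p" shows "u \<ominus> a \<in> carrier R - p"
proof -
  interpret p: primeideal p R by fact
  have a: "a \<in> carrier R" using assms p.Icarr by blast
  have "u \<ominus> a \<oplus> a = u" using a assms by (simp add: R.minus_eq R.a_assoc R.l_neg)
  then show ?thesis using a assms p.a_closed[of "u \<ominus> a" a] by auto
qed

text \<open>No determinant is used. Among the \<open>x\<close> in \<open>K\<close> that do not
  vanish at \<open>p\<close>, choose one whose localized cyclic module \<open>W x\<close> is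
  maximal, and write \<open>x = a x'\<close> locally. Then \<open>W x\<close> is contained in
  \<open>W x'\<close>, so both agree and \<open>x' = r x\<close> locally. Hence
  \<open>1 - a r\<close>, a unit at \<open>p\<close>, kills \<open>x\<close>. Since \<open>K\<close>
  is just a set closed under such division, it can be a kernel or a socle without further
  structure.\<close>

lemma nakayama:
  assumes noetherian_module and p: "primeideal p R" and a: "a \<in> p" and N: "submodule N R M" and K: "K \<subseteq> carrier M"
    and div: "\<And>x. x \<in> K \<Longrightarrow> \<exists>x'\<in>K. \<exists>u\<in>carrier R - p. u \<odot>\<^bsub>M\<^esub> x \<ominus>\<^bsub>M\<^esub> a \<odot>\<^bsub>M\<^esub> x' \<in> N"
  shows "K \<subseteq> saturation (carrier R - p) N"
proof (rule ccontr)
  interpret p: primeideal p R by fact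
  let ?S = "carrier R - p"
  note S = mult_set_prime[OF p]
  have aR: "a \<in> carrier R" using a p.Icarr by blast
  define W where "W x = saturation ?S (adjoin N x)" for x
  have W: "submodule (W x) R M" if "x \<in> carrier M" for x
    unfolding W_def by (intro sat_submodule S adjoin_submodule N that)
  have NW: "saturation ?S N \<subseteq> W x" if "x \<in> carrier M" for x
    unfolding W_def by (intro sat_mono adjoin_superset N that) auto
  assume "\<not> K \<subseteq> saturation ?S N"
  then obtain y where y: "y \<in> K - saturation ?S N" by blast
  obtain X where X: "X \<in> W ` (K - saturation ?S N)" "\<And>X'. X' \<in> W ` (K - saturation ?S N) \<Longrightarrow> X \<subseteq> X' \<Longrightarrow> X' = X"
  proof (rule noetherian_moduleE[OF \<open>noetherian_module\<close>, of "W y" "W ` (K - saturation ?S N)"])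
    show "W y \<in> W ` (K - saturation ?S N)" using y by blast
    show "\<And>N'. N' \<in> W ` (K - saturation ?S N) \<Longrightarrow> submodule N' R M" using W K by blast
  qed blast
  then obtain x where x: "x \<in> K" "x \<notin> saturation ?S N" "X = W x" by blast
  obtain x' u where x': "x' \<in> K" and u: "u \<in> ?S" and 1: "u \<odot>\<^bsub>M\<^esub> x \<ominus>\<^bsub>M\<^esub> a \<odot>\<^bsub>M\<^esub> x' \<in> N"
    using div[OF x(1)] by blast
  have xM: "x \<in> carrier M" "x' \<in> carrier M" using x x' K by auto
  have uR: "u \<in> carrier R" using u by blast
  have x'N: "x' \<notin> saturation ?S N"
  proof
    assume "x' \<in> saturation ?S N"
    then have "a \<odot>\<^bsub>M\<^esub> x' \<in> saturation ?S N" using submoduleE(4)[OF sat_submodule[OF S N] aR] by blast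
    moreover have "u \<odot>\<^bsub>M\<^esub> x \<ominus>\<^bsub>M\<^esub> a \<odot>\<^bsub>M\<^esub> x' \<in> saturation ?S N" using 1 sat_superset[OF S N] by blast
    ultimately have "u \<odot>\<^bsub>M\<^esub> x \<in> saturation ?S N"
      using diff_cancel_right[OF sat_submodule[OF S N]] uR xM by blast
    then show False using sat_cancel[OF S xM(1) u] x by blast
  qed
  have "u \<odot>\<^bsub>M\<^esub> x \<in> adjoin N x'" unfolding adjoin_def using 1 uR xM aR by auto
  then have "x \<in> W x'" unfolding W_def by (rule satI[OF xM(1) u])
  moreover have "N \<subseteq> W x'" using sat_superset[OF S N] NW[OF xM(2)] by blast
  ultimately have "adjoin N x \<subseteq> W x'" using adjoin_minimal[OF N W[OF xM(2)]] by blast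
  then have "W x \<subseteq> W x'"
    using sat_mono[of "adjoin N x" "W x'" ?S ?S] sat_sat[OF S adjoin_submodule[OF N xM(2)]] unfolding W_def by blast
  then have "W x' = W x" using X(2)[of "W x'"] x x' x'N by blast
  then have "x' \<in> saturation ?S (adjoin N x)"
    using sat_superset[OF S adjoin_submodule[OF N xM(2)]] in_adjoin_self[OF N xM(2)] unfolding W_def by blast
  then obtain v where v: "v \<in> ?S" "v \<odot>\<^bsub>M\<^esub> x' \<in> adjoin N x" by (auto elim: satE)
  then obtain r where r: "r \<in> carrier R" "v \<odot>\<^bsub>M\<^esub> x' \<ominus>\<^bsub>M\<^esub> r \<odot>\<^bsub>M\<^esub> x \<in> N" unfolding adjoin_def by blast
  have vR: "v \<in> carrier R" using v by blast
  \<comment> \<open>Eliminating \<open>a v x'\<close> between the two relations for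
    \<open>x'\<close> leaves a multiple of \<open>x\<close> with coefficient
    \<open>v u - a r\<close>, which lies outside \<open>p\<close>.\<close>
  have 2: "a \<odot>\<^bsub>M\<^esub> (v \<odot>\<^bsub>M\<^esub> x') \<ominus>\<^bsub>M\<^esub> a \<odot>\<^bsub>M\<^esub> (r \<odot>\<^bsub>M\<^esub> x) \<in> N"
    by (rule diff_smult[OF N _ _ aR r(2)]) (use vR r xM in auto)
  have 3: "v \<odot>\<^bsub>M\<^esub> (u \<odot>\<^bsub>M\<^esub> x) \<ominus>\<^bsub>M\<^esub> v \<odot>\<^bsub>M\<^esub> (a \<odot>\<^bsub>M\<^esub> x') \<in> N"
    by (rule diff_smult[OF N _ _ vR 1]) (use uR aR xM in auto)
  have "v \<odot>\<^bsub>M\<^esub> (u \<odot>\<^bsub>M\<^esub> x) \<ominus>\<^bsub>M\<^esub> a \<odot>\<^bsub>M\<^esub> (r \<odot>\<^bsub>M\<^esub> x) \<in> N"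
    by (rule diff_trans[OF N _ _ _ _ 2]) (use 3 uR aR vR r xM smult_lcomm[of v a x'] in auto)
  moreover have "v \<odot>\<^bsub>M\<^esub> (u \<odot>\<^bsub>M\<^esub> x) \<ominus>\<^bsub>M\<^esub> a \<odot>\<^bsub>M\<^esub> (r \<odot>\<^bsub>M\<^esub> x) = (v \<otimes> u \<ominus> a \<otimes> r) \<odot>\<^bsub>M\<^esub> x"
    using uR aR vR r xM by (simp add: module_simps)
  moreover have "v \<otimes> u \<ominus> a \<otimes> r \<in> ?S"
    using one_diff_notin_prime[OF p mult_setD(3)[OF S v(1) u]] p.I_r_closed[OF a r(1)] by blast
  ultimately show False using x xM satI[of x _ ?S N] by metis
qed

section \<open>Annihilators and associated primes\<close>

lemma in_colon_iff: "r \<in> colon N x \<longleftrightarrow> r \<in> carrier R \<and> r \<odot>\<^bsub>M\<^esub> x \<in> N"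
  unfolding colon_def by simp

lemma colon_ideal:
  assumes N: "submodule N R M" and x: "x \<in> carrier M" shows "ideal (colon N x) R"
proof (rule idealI)
  show "ring R" by (rule R.ring_axioms)
  show "subgroup (colon N x) (add_monoid R)"
  proof (rule R.add.subgroupI)
    show "colon N x \<subseteq> carrier R" unfolding colon_def by auto
    show "colon N x \<noteq> {}" unfolding colon_def using submodule_zero[OF N] x by (auto intro!: exI[of _ \<zero>])
    show "\<ominus> a \<in> colon N x" if "a \<in> colon N x" for a
      using that x N unfolding colon_def by (auto simp: smult_l_minus submoduleE)
    show "a \<oplus> b \<in> colon N x" if "a \<in> colon N x" "b \<in> colon N x" for a b
      using that x N unfolding colon_def by (auto simp: smult_l_distr submoduleE)
  qed
  show "y \<otimes> a \<in> colon N x" "a \<otimes> y \<in> colon N x" if "a \<in> colon N x" "y \<in> carrier R" for a y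
    using that x N unfolding colon_def by (auto simp: smult_assoc1 submoduleE smult_lcomm[of a y x])
qed

lemma colon_mono: "submodule N R M \<Longrightarrow> x \<in> carrier M \<Longrightarrow> a \<in> carrier R \<Longrightarrow> colon N x \<subseteq> colon N (a \<odot>\<^bsub>M\<^esub> x)"
  unfolding colon_def by (auto simp: smult_lcomm[of _ a x] submoduleE)

text \<open>The union of a nonempty chain of ideals belongs to the chain by
  \<open>ideal_chain_is_trivial\<close>; this is the upper bound that Zorn's lemma asks for.\<close>

lemma noetherian_ideals:
  assumes nr: "noetherian_ring R" and F: "F \<noteq> {}" "\<And>I. I \<in> F \<Longrightarrow> ideal I R"
  obtains I where "I \<in> F" "\<And>J. J \<in> F \<Longrightarrow> I \<subseteq> J \<Longrightarrow> J = I"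
proof -
  have "\<exists>I\<in>F. \<forall>J\<in>F. I \<subseteq> J \<longrightarrow> J = I"
  proof (rule subset_Zorn)
    fix C assume C: "subset.chain F C"
    show "\<exists>U\<in>F. \<forall>X\<in>C. X \<subseteq> U"
    proof (cases "C = {}")
      case False
      have "subset.chain {I. ideal I R} C" using C F(2) unfolding subset.chain_def by auto
      then have "\<Union>C \<in> C" using noetherian_ring.ideal_chain_is_trivial[OF nr False] by blast
      moreover have "C \<subseteq> F" using C unfolding subset.chain_def by simp
      ultimately show ?thesis by blast
    qed (use F in blast)
  qed
  then obtain I where "I \<in> F" "\<forall>J\<in>F. I \<subseteq> J \<longrightarrow> J = I" ..
  then show ?thesis by (intro that[of I]) auto
qed

text \<open>A maximal annihilator is prime. Only those multiples of \<open>y\<close> compete that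
  survive at \<open>p\<close>; this forces their annihilators, and so the prime found, into
  \<open>p\<close>.\<close>

lemma exists_assoc_prime:
  assumes nr: "noetherian_ring R" and p: "primeideal p R" and N: "submodule N R M"
    and y: "y \<in> carrier M" "y \<notin> saturation (carrier R - p) N"
  obtains a where "a \<in> carrier R" "colon N (a \<odot>\<^bsub>M\<^esub> y) \<in> assoc_primes N" "colon N (a \<odot>\<^bsub>M\<^esub> y) \<subseteq> p"
proof -
  interpret p: primeideal p R by fact
  let ?S = "carrier R - p"
  note S = mult_set_prime[OF p]
  define F where "F = {colon N (a \<odot>\<^bsub>M\<^esub> y) | a. a \<in> carrier R \<and> a \<odot>\<^bsub>M\<^esub> y \<notin> saturation ?S N}"
  have "colon N (\<one> \<odot>\<^bsub>M\<^esub> y) \<in> F" unfolding F_def using y by force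
  then have "F \<noteq> {}" by blast
  moreover have "ideal I R" if "I \<in> F" for I using that colon_ideal[OF N] y unfolding F_def by auto
  ultimately obtain c where c: "c \<in> F" "\<And>J. J \<in> F \<Longrightarrow> c \<subseteq> J \<Longrightarrow> J = c"
    by (rule noetherian_ideals[OF nr]) blast+
  then obtain a where a: "a \<in> carrier R" "a \<odot>\<^bsub>M\<^esub> y \<notin> saturation ?S N" "c = colon N (a \<odot>\<^bsub>M\<^esub> y)" unfolding F_def by blast
  define z where "z = a \<odot>\<^bsub>M\<^esub> y"
  have z: "z \<in> carrier M" "z \<notin> saturation ?S N" "c = colon N z" using a y z_def by auto
  have max: "colon N (s \<odot>\<^bsub>M\<^esub> z) = c" if s: "s \<in> carrier R" "s \<odot>\<^bsub>M\<^esub> z \<notin> saturation ?S N" for s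
  proof (rule c(2))
    show "colon N (s \<odot>\<^bsub>M\<^esub> z) \<in> F" unfolding F_def z_def using s a y
      by (auto simp: z_def smult_assoc1 intro!: exI[of _ "s \<otimes> a"])
    show "c \<subseteq> colon N (s \<odot>\<^bsub>M\<^esub> z)" using colon_mono[OF N] z s by auto
  qed
  have cp: "c \<subseteq> p" using z satI[OF z(1), of _ ?S N] unfolding colon_def by auto
  have "primeideal c R"
  proof (rule primeidealI)
    show "ideal c R" using colon_ideal[OF N] z by auto
    show "cring R" by (rule R.is_cring)
    show "carrier R \<noteq> c" using cp p.I_notcarr p.a_subset by blast
    fix r s assume rs: "r \<in> carrier R" "s \<in> carrier R" "r \<otimes> s \<in> c"
    show "r \<in> c \<or> s \<in> c"
    proof (cases "s \<odot>\<^bsub>M\<^esub> z \<in> saturation ?S N")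
      \<comment> \<open>Here \<open>s z\<close> dies at \<open>p\<close> but need not lie in
        \<open>N\<close>. Passing from \<open>z\<close> to \<open>u z\<close> makes \<open>s\<close>
        an honest annihilator, and by maximality the annihilator of \<open>u z\<close> is still
        \<open>c\<close>.\<close>
      case True
      then obtain u where u: "u \<in> ?S" "u \<odot>\<^bsub>M\<^esub> (s \<odot>\<^bsub>M\<^esub> z) \<in> N" by (auto elim: satE)
      then have "s \<in> colon N (u \<odot>\<^bsub>M\<^esub> z)" using rs z smult_lcomm[of u s z] unfolding colon_def by auto
      moreover have "u \<odot>\<^bsub>M\<^esub> z \<notin> saturation ?S N" using sat_cancel[OF S z(1) u(1)] z by blast
      ultimately show ?thesis using max[of u] u by blast
    next
      case False
      then have "r \<in> colon N (s \<odot>\<^bsub>M\<^esub> z)" using rs z unfolding colon_def by (auto simp: smult_assoc1)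
      then show ?thesis using max[OF rs(2) False] by blast
    qed
  qed
  then show ?thesis using that a z cp z_def unfolding assoc_primes_def by blast
qed

text \<open>Noetherian induction in place of a prime filtration: for \<open>q = colon K x\<close>,
  every associated prime of \<open>M/K\<close> other than \<open>q\<close> is also one of
  \<open>M/(K + R x)\<close>, which contradicts the choice of a maximal \<open>K\<close> with
  infinitely many.\<close>

lemma finite_assoc_primes:
  assumes noetherian_module and nr: "noetherian_ring R" and N: "submodule N R M"
  shows "finite (assoc_primes N)"
proof (rule ccontr)
  assume inf: "infinite (assoc_primes N)"
  obtain K where K: "K \<in> {K. submodule K R M \<and> infinite (assoc_primes K)}"
    and max: "\<And>L. L \<in> {K. submodule K R M \<and> infinite (assoc_primes K)} \<Longrightarrow> K \<subseteq> L \<Longrightarrow> L = K"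
    by (rule noetherian_moduleE[OF \<open>noetherian_module\<close>, of N "{K. submodule K R M \<and> infinite (assoc_primes K)}"])
      (use inf N in blast)+
  have KM: "submodule K R M" using K by blast
  obtain q where "q \<in> assoc_primes K" using K by fastforce
  then obtain x where q: "primeideal q R" "x \<in> carrier M" "q = colon K x" unfolding assoc_primes_def by blast
  interpret q: primeideal q R by fact
  have inq: "t \<in> q \<longleftrightarrow> t \<in> carrier R \<and> t \<odot>\<^bsub>M\<^esub> x \<in> K" for t using q(3) in_colon_iff by metis
  have "\<one> \<notin> q" using q.I_notcarr q.one_imp_carrier by metis
  then have "x \<notin> K" using inq[of \<one>] q(2) by simp
  then have "finite (assoc_primes (adjoin K x))"
    using max[of "adjoin K x"] adjoin_submodule[OF KM] adjoin_superset[OF KM] in_adjoin_self[OF KM] q(2) by blast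
  moreover have "assoc_primes K \<subseteq> insert q (assoc_primes (adjoin K x))"
  proof
    fix q' assume "q' \<in> assoc_primes K"
    then obtain z where q': "primeideal q' R" "z \<in> carrier M" "q' = colon K z" unfolding assoc_primes_def by blast
    interpret q': primeideal q' R by fact
    have inq': "t \<in> q' \<longleftrightarrow> t \<in> carrier R \<and> t \<odot>\<^bsub>M\<^esub> z \<in> K" for t using q'(3) in_colon_iff by metis
    show "q' \<in> insert q (assoc_primes (adjoin K x))"
    \<comment> \<open>The cyclic modules generated by \<open>z\<close> and \<open>x\<close> modulo
      \<open>K\<close> are \<open>R/q'\<close> and \<open>R/q\<close>. If they share a nonzero
      element \<open>r z = s x\<close>, its annihilator is both \<open>q'\<close> and
      \<open>q\<close>. Otherwise no element outside \<open>q'\<close> sends \<open>z\<close> into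
      \<open>adjoin K x\<close>, so \<open>z\<close> keeps its annihilator there.\<close>
    proof (cases "\<exists>r\<in>carrier R - q'. r \<odot>\<^bsub>M\<^esub> z \<in> adjoin K x")
      case True
      then obtain r s where r: "r \<in> carrier R" "r \<notin> q'" and s: "s \<in> carrier R"
        and 1: "r \<odot>\<^bsub>M\<^esub> z \<ominus>\<^bsub>M\<^esub> s \<odot>\<^bsub>M\<^esub> x \<in> K" unfolding adjoin_def by blast
      have "s \<odot>\<^bsub>M\<^esub> x \<notin> K"
        using diff_cancel_right[OF KM _ _ 1] r q'(2) inq'[of r] by blast
      then have sq: "s \<notin> q" using inq by blast
      have iff: "t \<odot>\<^bsub>M\<^esub> (r \<odot>\<^bsub>M\<^esub> z) \<in> K \<longleftrightarrow> t \<odot>\<^bsub>M\<^esub> (s \<odot>\<^bsub>M\<^esub> x) \<in> K" if t: "t \<in> carrier R" for t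
      proof -
        have "t \<odot>\<^bsub>M\<^esub> (r \<odot>\<^bsub>M\<^esub> z) \<ominus>\<^bsub>M\<^esub> t \<odot>\<^bsub>M\<^esub> (s \<odot>\<^bsub>M\<^esub> x) \<in> K"
          by (rule diff_smult[OF KM _ _ t 1]) (use r s q(2) q'(2) in auto)
        then show ?thesis
          using diff_cancel_right[OF KM] diff_cancel_left[OF KM] t r s q(2) q'(2) by (metis smult_closed)
      qed
      have 2: "t \<in> q' \<longleftrightarrow> t \<odot>\<^bsub>M\<^esub> (r \<odot>\<^bsub>M\<^esub> z) \<in> K" if t: "t \<in> carrier R" for t
      proof -
        have "t \<odot>\<^bsub>M\<^esub> (r \<odot>\<^bsub>M\<^esub> z) \<in> K \<longleftrightarrow> t \<otimes> r \<in> q'" using q'(2) t r inq'[of "t \<otimes> r"] by (simp add: smult_assoc1)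
        then show ?thesis using q'.I_prime[OF t r(1)] r q'.I_r_closed[OF _ r(1)] by blast
      qed
      have 3: "t \<in> q \<longleftrightarrow> t \<odot>\<^bsub>M\<^esub> (s \<odot>\<^bsub>M\<^esub> x) \<in> K" if t: "t \<in> carrier R" for t
      proof -
        have "t \<odot>\<^bsub>M\<^esub> (s \<odot>\<^bsub>M\<^esub> x) \<in> K \<longleftrightarrow> t \<otimes> s \<in> q" using q(2) t s inq[of "t \<otimes> s"] by (simp add: smult_assoc1)
        then show ?thesis using q.I_prime[OF t s] sq q.I_r_closed[OF _ s] by blast
      qed
      have "q' = q" using 2 3 iff q.Icarr q'.Icarr by blast
      then show ?thesis by blast
    next
      case False
      have "q' = colon (adjoin K x) z"
        using False inq' adjoin_superset[OF KM q(2)] q'.Icarr unfolding colon_def by blast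
      then show ?thesis using q' unfolding assoc_primes_def by blast
    qed
  qed
  ultimately show False using K finite_subset by auto
qed

section \<open>Prime avoidance for cosets of an ideal\<close>

lemma exists_in_all_ideals_outside_prime:
  assumes m: "primeideal m R" and "finite Q" "\<And>q. q \<in> Q \<Longrightarrow> ideal q R \<and> \<not> q \<subseteq> m"
  shows "\<exists>c\<in>carrier R - m. \<forall>q\<in>Q. c \<in> q"
  using assms(2,3)
proof (induction Q)
  case empty
  then show ?case using mult_setD(2)[OF mult_set_prime[OF m]] by blast
next
  case (insert q Q)
  obtain c where c: "c \<in> carrier R - m" "\<forall>q\<in>Q. c \<in> q" using insert by blast
  obtain d where d: "d \<in> q" "d \<notin> m" using insert by blast
  have dR: "d \<in> carrier R" using d insert ideal.Icarr by (metis insertI1)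
  have "c \<otimes> d \<in> carrier R - m" using mult_setD(3)[OF mult_set_prime[OF m]] c d dR by blast
  moreover have "\<forall>q'\<in>insert q Q. c \<otimes> d \<in> q'"
    using c d dR insert ideal.I_l_closed ideal.I_r_closed by (metis DiffD1 insert_iff)
  ultimately show ?case by blast
qed

text \<open>Induction removes a minimal member \<open>m\<close> of \<open>P\<close>. By minimality
  no other member is contained in \<open>m\<close>, so some \<open>c\<close> outside
  \<open>m\<close> lies in all the others. A correction by a multiple of \<open>c\<close> then
  repairs \<open>m\<close> without disturbing the rest.\<close>

lemma coset_prime_avoidance:
  assumes "finite P" "\<And>q. q \<in> P \<Longrightarrow> primeideal q R" and f: "f \<in> carrier R" and J: "ideal J R"
    and "\<And>q. q \<in> P \<Longrightarrow> \<not> (f \<in> q \<and> J \<subseteq> q)"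
  shows "\<exists>j\<in>J. \<forall>q\<in>P. f \<oplus> j \<notin> q"
  using assms(1,2,5)
proof (induction P rule: finite_psubset_induct)
  case (psubset P)
  interpret J: ideal J R by fact
  show ?case
  proof (cases "P = {}")
    case True
    then show ?thesis using J.zero_closed by blast
  next
    case False
    then obtain m where m: "m \<in> P" "\<And>q. q \<in> P \<Longrightarrow> q \<subseteq> m \<Longrightarrow> q = m"
      using finite_has_minimal[OF psubset(1)] by metis
    interpret m: primeideal m R using m psubset by blast
    have "\<exists>j\<in>J. \<forall>q\<in>P - {m}. f \<oplus> j \<notin> q"
      by (rule psubset.IH) (use m psubset.prems in auto)
    then obtain j where j: "j \<in> J" "\<forall>q\<in>P - {m}. f \<oplus> j \<notin> q" by blast
    have jR: "j \<in> carrier R" using j J.Icarr by blast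
    show ?thesis
    proof (cases "f \<oplus> j \<in> m")
      case False
      then show ?thesis using j by blast
    next
      case True
      have "\<not> J \<subseteq> m"
      proof
        assume "J \<subseteq> m"
        then have "f \<oplus> j \<oplus> \<ominus> j \<in> m" using True j m.a_closed m.a_inv_closed by blast
        moreover have "f \<oplus> j \<oplus> \<ominus> j = f" using f jR by (simp add: R.a_assoc R.r_neg)
        ultimately show False using psubset.prems(2)[OF m(1)] \<open>J \<subseteq> m\<close> by simp
      qed
      \<comment> \<open>The correction \<open>c y\<close> is in \<open>J\<close> and in every other
        member of \<open>P\<close>, but not in \<open>m\<close>.\<close>
      then obtain y where y: "y \<in> J" "y \<notin> m" by blast
      obtain c where c: "c \<in> carrier R - m" "\<forall>q\<in>P - {m}. c \<in> q"
        using exists_in_all_ideals_outside_prime[OF m.primeideal_axioms, of "P - {m}"] psubset m primeideal.axioms(1)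
        by (metis Diff_iff finite_Diff singletonI)
      have yR: "y \<in> carrier R" using y J.Icarr by blast
      have cy: "c \<otimes> y \<in> J" "c \<otimes> y \<notin> m" using y c yR J.I_l_closed m.I_prime by blast+
      have cyR: "c \<otimes> y \<in> carrier R" using cy J.Icarr by blast
      have add: "f \<oplus> (j \<oplus> c \<otimes> y) = f \<oplus> j \<oplus> c \<otimes> y" using f jR cyR by (simp add: R.a_assoc)
      have "f \<oplus> (j \<oplus> c \<otimes> y) \<notin> q" if q: "q \<in> P" for q
      proof
        assume "f \<oplus> (j \<oplus> c \<otimes> y) \<in> q"
        then have 1: "f \<oplus> j \<oplus> c \<otimes> y \<in> q" using add by simp
        interpret q: primeideal q R using psubset.prems(1)[OF q] .
        show False
        proof (cases "q = m")
          case True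
          have "(f \<oplus> j \<oplus> c \<otimes> y) \<oplus> \<ominus> (f \<oplus> j) \<in> m"
            using 1 True \<open>f \<oplus> j \<in> m\<close> m.a_closed m.a_inv_closed by blast
          moreover have "(f \<oplus> j \<oplus> c \<otimes> y) \<oplus> \<ominus> (f \<oplus> j) = c \<otimes> y"
            using f jR cyR R.a_comm[of "f \<oplus> j" "c \<otimes> y"] by (simp add: R.a_assoc[of "c \<otimes> y" "f \<oplus> j"] R.r_neg)
          ultimately show False using cy by simp
        next
          case False
          then have "c \<otimes> y \<in> q" using q c yR q.I_r_closed by blast
          then have "(f \<oplus> j \<oplus> c \<otimes> y) \<oplus> \<ominus> (c \<otimes> y) \<in> q" using 1 q.a_closed q.a_inv_closed by blast
          moreover have "(f \<oplus> j \<oplus> c \<otimes> y) \<oplus> \<ominus> (c \<otimes> y) = f \<oplus> j" using f jR cyR by (simp add: R.a_assoc R.r_neg)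
          ultimately show False using j q False by auto
        qed
      qed
      then show ?thesis using j cy J.a_closed by blast
    qed
  qed
qed

section \<open>Exchange of regular sequences\<close>

lemma prime_carrier: "primeideal p R \<Longrightarrow> a \<in> p \<Longrightarrow> a \<in> carrier R"
  using primeideal.axioms(1)[of p R] ideal.Icarr[of p R a] by blast

text \<open>A zero divisor on the localization of \<open>M/K\<close> at \<open>p\<close> lies in one
  of the finitely many associated primes inside \<open>p\<close>. Avoiding the union of these sets
  over all \<open>K\<close> gives one element for several quotients at once, as the exchange
  argument requires.\<close>

lemma common_nonzerodivisor_in_coset:
  assumes no: noetherian_module and nr: "noetherian_ring R" and p: "primeideal p R"
    and "finite Ks" and Ks: "\<And>K. K \<in> Ks \<Longrightarrow> submodule K R M"
    and f: "f \<in> carrier R" and J: "ideal J R"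
    and avoid: "\<And>K q. K \<in> Ks \<Longrightarrow> q \<in> assoc_primes K \<Longrightarrow> q \<subseteq> p \<Longrightarrow> \<not> (f \<in> q \<and> J \<subseteq> q)"
  shows "\<exists>j\<in>J. \<forall>K\<in>Ks. nonzerodivisor (carrier R - p) K (f \<oplus> j)"
proof -
  let ?P = "{q \<in> \<Union>(assoc_primes ` Ks). q \<subseteq> p}"
  have "finite (\<Union>(assoc_primes ` Ks))" using finite_assoc_primes[OF no nr Ks] \<open>finite Ks\<close> by blast
  then have fin: "finite ?P" by (rule rev_finite_subset) blast
  have prime: "primeideal q R" if "q \<in> ?P" for q using that unfolding assoc_primes_def by blast
  have "\<not> (f \<in> q \<and> J \<subseteq> q)" if "q \<in> ?P" for q using that avoid by blast
  then obtain j where j: "j \<in> J" "\<And>q. q \<in> ?P \<Longrightarrow> f \<oplus> j \<notin> q"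
    using coset_prime_avoidance[OF fin prime f J] by blast
  have jR: "j \<in> carrier R" using ideal.Icarr[OF J j(1)] .
  have "nonzerodivisor (carrier R - p) K (f \<oplus> j)" if K: "K \<in> Ks" for K
    unfolding nonzerodivisor_def
  proof (intro ballI impI, rule ccontr)
    fix x assume x: "x \<in> carrier M" and fx: "(f \<oplus> j) \<odot>\<^bsub>M\<^esub> x \<in> saturation (carrier R - p) K"
      and xn: "x \<notin> saturation (carrier R - p) K"
    obtain a where a: "a \<in> carrier R" and ass: "colon K (a \<odot>\<^bsub>M\<^esub> x) \<in> assoc_primes K" and sub: "colon K (a \<odot>\<^bsub>M\<^esub> x) \<subseteq> p"
      using exists_assoc_prime[OF nr p Ks[OF K] x xn] by blast
    obtain u where u: "u \<in> carrier R - p" "u \<odot>\<^bsub>M\<^esub> ((f \<oplus> j) \<odot>\<^bsub>M\<^esub> x) \<in> K" using fx by (rule satE)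
    have uR: "u \<in> carrier R" using u by blast
    have "(u \<otimes> (f \<oplus> j)) \<odot>\<^bsub>M\<^esub> (a \<odot>\<^bsub>M\<^esub> x) = a \<odot>\<^bsub>M\<^esub> (u \<odot>\<^bsub>M\<^esub> ((f \<oplus> j) \<odot>\<^bsub>M\<^esub> x))"
      using uR f jR a x by (simp add: smult_assoc1 smult_lcomm)
    also have "\<dots> \<in> K" using submoduleE(4)[OF Ks[OF K] a u(2)] .
    finally have "u \<otimes> (f \<oplus> j) \<in> colon K (a \<odot>\<^bsub>M\<^esub> x)" using uR f jR by (simp add: in_colon_iff)
    moreover have "primeideal (colon K (a \<odot>\<^bsub>M\<^esub> x)) R" using ass unfolding assoc_primes_def by blast
    moreover have "u \<notin> colon K (a \<odot>\<^bsub>M\<^esub> x)" using sub u by blast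
    ultimately have "f \<oplus> j \<in> colon K (a \<odot>\<^bsub>M\<^esub> x)"
      using primeideal.I_prime[of _ R u "f \<oplus> j"] uR f jR by blast
    then show False using j(2)[of "colon K (a \<odot>\<^bsub>M\<^esub> x)"] ass sub K by blast
  qed
  then show ?thesis using j by blast
qed

text \<open>
  \<open>socle_zero p K\<close>: no nonzero element of \<open>(M/K)\<^sub>p\<close> is killed by \<open>p\<close>. \<open>depth_ge p N n\<close>: some sequence
  of \<open>n\<close> elements of \<open>p\<close> is regular on \<open>(M/N)\<^sub>p\<close>.
\<close>

definition socle_zero :: "'a set \<Rightarrow> 'c set \<Rightarrow> bool"
  where "socle_zero p K \<longleftrightarrow> (\<forall>x\<in>carrier M. (\<forall>a\<in>p. a \<odot>\<^bsub>M\<^esub> x \<in> saturation (carrier R - p) K) \<longrightarrow> x \<in> saturation (carrier R - p) K)"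

primrec depth_ge :: "'a set \<Rightarrow> 'c set \<Rightarrow> nat \<Rightarrow> bool"
  where "depth_ge p N 0 \<longleftrightarrow> True"
  | "depth_ge p N (Suc n) \<longleftrightarrow> (\<exists>y\<in>p. nonzerodivisor (carrier R - p) N y \<and> depth_ge p (add_multiples N y) n)"

lemma socle_zeroD: "socle_zero p K \<Longrightarrow> x \<in> carrier M \<Longrightarrow> (\<And>a. a \<in> p \<Longrightarrow> a \<odot>\<^bsub>M\<^esub> x \<in> saturation (carrier R - p) K) \<Longrightarrow> x \<in> saturation (carrier R - p) K"
  unfolding socle_zero_def by blast

lemma nonzerodivisor_imp_socle_zero: "nonzerodivisor (carrier R - p) N y \<Longrightarrow> y \<in> p \<Longrightarrow> socle_zero p N"
  unfolding socle_zero_def nonzerodivisor_def by blast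

text \<open>An element with annihilator \<open>p\<close> is killed by \<open>p\<close> but by
  nothing outside \<open>p\<close>, so its image is a nonzero socle element of the
  localization.\<close>

lemma socle_zero_imp_not_assoc:
  assumes p: "primeideal p R" and K: "submodule K R M" and ns: "socle_zero p K"
  shows "p \<notin> assoc_primes K"
proof
  assume "p \<in> assoc_primes K"
  then obtain x where x: "x \<in> carrier M" "p = colon K x" unfolding assoc_primes_def by blast
  have inp: "t \<in> p \<longleftrightarrow> t \<in> carrier R \<and> t \<odot>\<^bsub>M\<^esub> x \<in> K" for t using x(2) in_colon_iff by metis
  have "x \<in> saturation (carrier R - p) K"
    using socle_zeroD[OF ns x(1)] inp sat_superset[OF mult_set_prime[OF p] K] by blast
  then show False using inp unfolding saturation_def by blast
qed

text \<open>Avoidance in the coset \<open>0 + p\<close>: an associated prime inside \<open>p\<close>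
  that contains \<open>p\<close> equals \<open>p\<close>, which a vanishing socle excludes.\<close>

lemma common_nonzerodivisor:
  assumes no: noetherian_module and nr: "noetherian_ring R" and p: "primeideal p R"
    and "finite Ks" and Ks: "\<And>K. K \<in> Ks \<Longrightarrow> submodule K R M \<and> socle_zero p K"
  shows "\<exists>z\<in>p. \<forall>K\<in>Ks. nonzerodivisor (carrier R - p) K z"
proof -
  have "\<exists>j\<in>p. \<forall>K\<in>Ks. nonzerodivisor (carrier R - p) K (\<zero> \<oplus> j)"
  proof (rule common_nonzerodivisor_in_coset[OF no nr p \<open>finite Ks\<close>])
    show "\<And>K. K \<in> Ks \<Longrightarrow> submodule K R M" using Ks by blast
    show "ideal p R" using p primeideal.axioms(1) by blast
    show "\<not> (\<zero> \<in> q \<and> p \<subseteq> q)" if "K \<in> Ks" "q \<in> assoc_primes K" "q \<subseteq> p" for K q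
    proof -
      have "p \<notin> assoc_primes K" using socle_zero_imp_not_assoc[OF p] Ks[OF that(1)] by simp
      then show ?thesis using subset_antisym[OF that(3)] that(2) by auto
    qed
  qed auto
  moreover have "\<And>j. j \<in> p \<Longrightarrow> j \<in> carrier R" using prime_carrier[OF p] by blast
  ultimately show ?thesis by auto
qed

text \<open>
  If \<open>z\<close> is a socle element modulo \<open>x\<close>, then \<open>y z = x w\<close> for some \<open>w\<close>, and \<open>w\<close> is a socle element modulo \<open>y\<close>.
\<close>

lemma socle_zero_exchange:
  assumes p: "primeideal p R" and N: "submodule N R M" and x: "x \<in> p" and y: "y \<in> p"
    and rx: "nonzerodivisor (carrier R - p) N x" and ry: "nonzerodivisor (carrier R - p) N y" and ns: "socle_zero p (add_multiples N y)"
  shows "socle_zero p (add_multiples N x)"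
  unfolding socle_zero_def
proof (intro ballI impI)
  let ?S = "carrier R - p"
  note S = mult_set_prime[OF p]
  note sN = sat_submodule[OF S N]
  have pR: "\<And>j. j \<in> p \<Longrightarrow> j \<in> carrier R" using prime_carrier[OF p] by blast
  have R: "x \<in> carrier R" "y \<in> carrier R" using pR x y by auto
  fix z assume z: "z \<in> carrier M" and pz: "\<forall>a\<in>p. a \<odot>\<^bsub>M\<^esub> z \<in> saturation ?S (add_multiples N x)"
  have "y \<odot>\<^bsub>M\<^esub> z \<in> saturation ?S (add_multiples N x)" using pz y by blast
  then obtain v w where v: "v \<in> ?S" and w: "w \<in> carrier M" and 1: "v \<odot>\<^bsub>M\<^esub> (y \<odot>\<^bsub>M\<^esub> z) \<ominus>\<^bsub>M\<^esub> x \<odot>\<^bsub>M\<^esub> w \<in> N"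
    using sat_add_multiples_iff[OF S N R(1), of "y \<odot>\<^bsub>M\<^esub> z"] R z by auto
  have vR: "v \<in> carrier R" using v by blast
  have "i \<odot>\<^bsub>M\<^esub> w \<in> saturation ?S (add_multiples N y)" if i: "i \<in> p" for i
  proof -
    have iR: "i \<in> carrier R" using pR i by blast
    have "i \<odot>\<^bsub>M\<^esub> z \<in> saturation ?S (add_multiples N x)" using pz i by blast
    then obtain t b where t: "t \<in> ?S" and b: "b \<in> carrier M" and 2: "t \<odot>\<^bsub>M\<^esub> (i \<odot>\<^bsub>M\<^esub> z) \<ominus>\<^bsub>M\<^esub> x \<odot>\<^bsub>M\<^esub> b \<in> N"
      using sat_add_multiples_iff[OF S N R(1), of "i \<odot>\<^bsub>M\<^esub> z"] iR z by auto
    have tR: "t \<in> carrier R" using t by blast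
    \<comment> \<open>With \<open>y z = x w\<close> and \<open>i z = x b\<close> up to denominators,
      eliminating \<open>y i z\<close> gives \<open>x (i w - y b) = 0\<close>. Cancelling
      \<open>x\<close> shows that \<open>i w\<close> is a multiple of \<open>y\<close>.\<close>
    have 3: "(t \<otimes> i) \<odot>\<^bsub>M\<^esub> (v \<odot>\<^bsub>M\<^esub> (y \<odot>\<^bsub>M\<^esub> z)) \<ominus>\<^bsub>M\<^esub> (t \<otimes> i) \<odot>\<^bsub>M\<^esub> (x \<odot>\<^bsub>M\<^esub> w) \<in> N"
      by (rule diff_smult[OF N _ _ _ 1]) (use tR iR vR R z w in auto)
    have 4: "(v \<otimes> y) \<odot>\<^bsub>M\<^esub> (t \<odot>\<^bsub>M\<^esub> (i \<odot>\<^bsub>M\<^esub> z)) \<ominus>\<^bsub>M\<^esub> (v \<otimes> y) \<odot>\<^bsub>M\<^esub> (x \<odot>\<^bsub>M\<^esub> b) \<in> N"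
      by (rule diff_smult[OF N _ _ _ 2]) (use tR iR vR R z b in auto)
    have eq: "(v \<otimes> y) \<odot>\<^bsub>M\<^esub> (t \<odot>\<^bsub>M\<^esub> (i \<odot>\<^bsub>M\<^esub> z)) = (t \<otimes> i) \<odot>\<^bsub>M\<^esub> (v \<odot>\<^bsub>M\<^esub> (y \<odot>\<^bsub>M\<^esub> z))"
      using tR iR vR R z by (simp add: smult_assoc1 smult_lcomm)
    have "(t \<otimes> i) \<odot>\<^bsub>M\<^esub> (x \<odot>\<^bsub>M\<^esub> w) \<ominus>\<^bsub>M\<^esub> (v \<otimes> y) \<odot>\<^bsub>M\<^esub> (x \<odot>\<^bsub>M\<^esub> b) \<in> N"
      by (rule diff_trans[OF N _ _ _ diff_sym[OF N _ _ 3] 4[unfolded eq]]) (use tR iR vR R z b w in auto)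
    moreover have "(t \<otimes> i) \<odot>\<^bsub>M\<^esub> (x \<odot>\<^bsub>M\<^esub> w) \<ominus>\<^bsub>M\<^esub> (v \<otimes> y) \<odot>\<^bsub>M\<^esub> (x \<odot>\<^bsub>M\<^esub> b)
        = x \<odot>\<^bsub>M\<^esub> (t \<odot>\<^bsub>M\<^esub> (i \<odot>\<^bsub>M\<^esub> w) \<ominus>\<^bsub>M\<^esub> y \<odot>\<^bsub>M\<^esub> (v \<odot>\<^bsub>M\<^esub> b))"
      using tR iR vR R w b by (simp add: smult_assoc1 smult_lcomm smult_r_diff)
    ultimately have "t \<odot>\<^bsub>M\<^esub> (i \<odot>\<^bsub>M\<^esub> w) \<ominus>\<^bsub>M\<^esub> y \<odot>\<^bsub>M\<^esub> (v \<odot>\<^bsub>M\<^esub> b) \<in> saturation ?S N"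
      using nonzerodivisorD[OF rx, of "t \<odot>\<^bsub>M\<^esub> (i \<odot>\<^bsub>M\<^esub> w) \<ominus>\<^bsub>M\<^esub> y \<odot>\<^bsub>M\<^esub> (v \<odot>\<^bsub>M\<^esub> b)"] sat_superset[OF S N] tR iR vR R w b by auto
    then show ?thesis using sat_add_multiples_satI[OF S N R(2) _ t, of "i \<odot>\<^bsub>M\<^esub> w" "v \<odot>\<^bsub>M\<^esub> b"] vR b iR w by blast
  qed
  \<comment> \<open>Now \<open>w = y b\<close> locally, hence \<open>y z = x y b\<close>, and
    cancelling \<open>y\<close> gives \<open>z = x b\<close>.\<close>
  then have "w \<in> saturation ?S (add_multiples N y)" using socle_zeroD[OF ns w] by blast
  then obtain t b where t: "t \<in> ?S" and b: "b \<in> carrier M" and 2: "t \<odot>\<^bsub>M\<^esub> w \<ominus>\<^bsub>M\<^esub> y \<odot>\<^bsub>M\<^esub> b \<in> N"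
    using sat_add_multiples_iff[OF S N R(2) w] by auto
  have tR: "t \<in> carrier R" using t by blast
  have 3: "t \<odot>\<^bsub>M\<^esub> (v \<odot>\<^bsub>M\<^esub> (y \<odot>\<^bsub>M\<^esub> z)) \<ominus>\<^bsub>M\<^esub> t \<odot>\<^bsub>M\<^esub> (x \<odot>\<^bsub>M\<^esub> w) \<in> N"
    by (rule diff_smult[OF N _ _ _ 1]) (use tR vR R z w in auto)
  have 4: "x \<odot>\<^bsub>M\<^esub> (t \<odot>\<^bsub>M\<^esub> w) \<ominus>\<^bsub>M\<^esub> x \<odot>\<^bsub>M\<^esub> (y \<odot>\<^bsub>M\<^esub> b) \<in> N"
    by (rule diff_smult[OF N _ _ _ 2]) (use tR vR R b w in auto)
  have "t \<odot>\<^bsub>M\<^esub> (v \<odot>\<^bsub>M\<^esub> (y \<odot>\<^bsub>M\<^esub> z)) \<ominus>\<^bsub>M\<^esub> x \<odot>\<^bsub>M\<^esub> (y \<odot>\<^bsub>M\<^esub> b) \<in> N"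
    by (rule diff_trans[OF N _ _ _ _ 4]) (use 3 tR vR R z b w smult_lcomm[of t x w] in auto)
  moreover have "t \<odot>\<^bsub>M\<^esub> (v \<odot>\<^bsub>M\<^esub> (y \<odot>\<^bsub>M\<^esub> z)) \<ominus>\<^bsub>M\<^esub> x \<odot>\<^bsub>M\<^esub> (y \<odot>\<^bsub>M\<^esub> b) = y \<odot>\<^bsub>M\<^esub> ((t \<otimes> v) \<odot>\<^bsub>M\<^esub> z \<ominus>\<^bsub>M\<^esub> x \<odot>\<^bsub>M\<^esub> b)"
    using tR vR R z b by (simp add: smult_assoc1 smult_lcomm smult_r_diff)
  ultimately have "(t \<otimes> v) \<odot>\<^bsub>M\<^esub> z \<ominus>\<^bsub>M\<^esub> x \<odot>\<^bsub>M\<^esub> b \<in> saturation ?S N"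
    using nonzerodivisorD[OF ry, of "(t \<otimes> v) \<odot>\<^bsub>M\<^esub> z \<ominus>\<^bsub>M\<^esub> x \<odot>\<^bsub>M\<^esub> b"] sat_superset[OF S N] tR vR R z b by auto
  then show "z \<in> saturation ?S (add_multiples N x)" using sat_add_multiples_satI[OF S N R(1) z mult_setD(3)[OF S t v] b] by blast
qed

text \<open>
  Replaces the usual appeal to \<open>Ext\<close>: a \<open>z\<close> regular on \<open>M/N\<close> and modulo each of \<open>x\<close> and \<open>y\<close> can be moved
  to the front of both sequences, and induction applies modulo \<open>z\<close>.
\<close>

lemma depth_ge_add_multiples:
  assumes no: noetherian_module and nr: "noetherian_ring R" and p: "primeideal p R"
  shows "submodule N R M \<Longrightarrow> depth_ge p N (Suc m) \<Longrightarrow> x \<in> p \<Longrightarrow> nonzerodivisor (carrier R - p) N x \<Longrightarrow> depth_ge p (add_multiples N x) m"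
proof (induction m arbitrary: N x)
  case (Suc m)
  let ?S = "carrier R - p"
  note S = mult_set_prime[OF p]
  note N = \<open>submodule N R M\<close>
  obtain y where y: "y \<in> p" "nonzerodivisor ?S N y" "depth_ge p (add_multiples N y) (Suc m)" using Suc.prems(2) depth_ge.simps(2) by blast
  \<comment> \<open>The second element of the sequence serves to make the socle modulo
    \<open>y\<close> vanish. It exists because \<open>m\<close> has been replaced by a
    successor.\<close>
  then obtain y2 where y2: "y2 \<in> p" "nonzerodivisor ?S (add_multiples N y) y2" using depth_ge.simps(2) by blast
  have R: "x \<in> carrier R" "y \<in> carrier R" using prime_carrier[OF p] y Suc.prems by auto
  have ns: "socle_zero p N" "socle_zero p (add_multiples N y)" using nonzerodivisor_imp_socle_zero y y2 by blast+
  have "socle_zero p (add_multiples N x)"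
    using socle_zero_exchange[OF p N Suc.prems(3) y(1) Suc.prems(4) y(2) ns(2)] .
  then have "\<exists>z\<in>p. \<forall>K\<in>{N, add_multiples N y, add_multiples N x}. nonzerodivisor ?S K z"
    using ns N R by (intro common_nonzerodivisor[OF no nr p]) (auto intro: add_multiples_submodule)
  then obtain z where z: "z \<in> p" "nonzerodivisor ?S N z" "nonzerodivisor ?S (add_multiples N y) z" "nonzerodivisor ?S (add_multiples N x) z" by blast
  have zR: "z \<in> carrier R" using prime_carrier[OF p] z by auto
  \<comment> \<open>The induction hypothesis is used twice: modulo \<open>y\<close> with
    \<open>z\<close> as the new element, and then modulo \<open>z\<close> with \<open>x\<close> as
    the new element.\<close>
  have "depth_ge p (add_multiples (add_multiples N y) z) m" using Suc.IH[OF add_multiples_submodule[OF N R(2)] y(3) z(1,3)] .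
  then have "depth_ge p (add_multiples (add_multiples N z) y) m" using add_multiples_commute[OF N R(2) zR] by simp
  moreover have "nonzerodivisor ?S (add_multiples N z) y" using nonzerodivisor_swap[OF S N R(2) zR y(2) z(3)] .
  ultimately have "depth_ge p (add_multiples N z) (Suc m)" using y(1) by auto
  moreover have "nonzerodivisor ?S (add_multiples N z) x" using nonzerodivisor_swap[OF S N R(1) zR Suc.prems(4) z(4)] .
  ultimately have "depth_ge p (add_multiples (add_multiples N z) x) m"
    using Suc.IH[OF add_multiples_submodule[OF N zR]] Suc.prems(3) by blast
  then have "depth_ge p (add_multiples (add_multiples N x) z) m" using add_multiples_commute[OF N R(1) zR] by simp
  then show ?case using z by auto
qed simp

text \<open>With \<open>m = 1\<close> this prolongs any regular sequence in \<open>p\<close> as soon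
  as a longer one exists somewhere, so all maximal ones have equal length.\<close>

lemma depth_ge_add_multiples_list:
  assumes no: noetherian_module and nr: "noetherian_ring R" and p: "primeideal p R"
  shows "submodule N R M \<Longrightarrow> set fs \<subseteq> p \<Longrightarrow> regular_at (carrier R - p) N fs \<Longrightarrow> depth_ge p N (length fs + m) \<Longrightarrow> depth_ge p (add_multiples_list N fs) m"
proof (induction fs arbitrary: N)
  case (Cons f fs)
  have "depth_ge p (add_multiples N f) (length fs + m)"
    using depth_ge_add_multiples[OF no nr p Cons.prems(1), of "length fs + m" f] Cons.prems by auto
  moreover have "f \<in> carrier R" using Cons.prems(2) prime_carrier[OF p] by auto
  ultimately show ?case using Cons.IH[OF add_multiples_submodule[OF Cons.prems(1)]] Cons.prems by auto
qed auto

lemma depth_ge_iff_regular_at: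
  "depth_ge p N n \<longleftrightarrow> (\<exists>fs. set fs \<subseteq> p \<and> length fs = n \<and> regular_at (carrier R - p) N fs)"
proof (induction n arbitrary: N)
  case (Suc n)
  show ?case (is "_ = ?R")
  proof
    assume "depth_ge p N (Suc n)"
    then obtain y fs where "y \<in> p" "nonzerodivisor (carrier R - p) N y" "set fs \<subseteq> p" "length fs = n"
      "regular_at (carrier R - p) (add_multiples N y) fs" using Suc by auto
    then show ?R by (intro exI[of _ "y # fs"]) auto
  next
    assume ?R
    then obtain gs where gs: "set gs \<subseteq> p" "length gs = Suc n" "regular_at (carrier R - p) N gs" by blast
    then obtain y fs where "gs = y # fs" by (cases gs) auto
    then show "depth_ge p N (Suc n)" using gs Suc by auto
  qed
qed auto

lemma depth_ge_antimono: "depth_ge p N n \<Longrightarrow> m \<le> n \<Longrightarrow> depth_ge p N m"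
proof (induction n arbitrary: N m)
  case (Suc n)
  then show ?case by (cases m) auto
qed simp

section \<open>Regularity from depth at associated primes\<close>

text \<open>Used contrapositively: a module nonzero at \<open>p\<close> stays nonzero at
  \<open>p\<close> modulo elements of \<open>p\<close>, which places the maximal ideal in the
  support of the quotient.\<close>

lemma nakayama_list:
  assumes no: noetherian_module and p: "primeideal p R"
  shows "submodule N R M \<Longrightarrow> set fs \<subseteq> p \<Longrightarrow> carrier M \<subseteq> saturation (carrier R - p) (add_multiples_list N fs) \<Longrightarrow>
    carrier M \<subseteq> saturation (carrier R - p) N"
proof (induction fs arbitrary: N)
  case (Cons f fs)
  note N = Cons.prems(1)
  have f: "f \<in> p" "f \<in> carrier R" using Cons.prems(2) prime_carrier[OF p] by auto
  have "carrier M \<subseteq> saturation (carrier R - p) (add_multiples N f)"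
    using Cons.IH[OF add_multiples_submodule[OF N f(2)]] Cons.prems by simp
  then have "\<exists>x'\<in>carrier M. \<exists>u\<in>carrier R - p. u \<odot>\<^bsub>M\<^esub> x \<ominus>\<^bsub>M\<^esub> f \<odot>\<^bsub>M\<^esub> x' \<in> N" if "x \<in> carrier M" for x
    using sat_add_multiples_iff[OF mult_set_prime[OF p] N f(2) that] that by blast
  then show ?case using nakayama[OF no p f(1) N, of "carrier M"] by blast
qed simp

text \<open>Let \<open>K\<close> be the kernel of \<open>b\<close> on the localization of
  \<open>M/N\<close>. Regularity of \<open>b\<close> modulo \<open>a\<close> makes each
  \<open>x\<close> in \<open>K\<close> a multiple \<open>a x'\<close>, and regularity of
  \<open>a\<close> puts \<open>x'\<close> into \<open>K\<close> again. So \<open>K = a K\<close>,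
  and Nakayama applies.\<close>

lemma nonzerodivisor_of_successive:
  assumes no: noetherian_module and p: "primeideal p R" and N: "submodule N R M" and a: "a \<in> p" and b: "b \<in> p"
    and ra: "nonzerodivisor (carrier R - p) N a" and rb: "nonzerodivisor (carrier R - p) (add_multiples N a) b"
  shows "nonzerodivisor (carrier R - p) N b"
proof -
  let ?S = "carrier R - p"
  note S = mult_set_prime[OF p]
  note sN = sat_submodule[OF S N]
  have R: "a \<in> carrier R" "b \<in> carrier R" using prime_carrier[OF p] a b by auto
  let ?K = "{x \<in> carrier M. b \<odot>\<^bsub>M\<^esub> x \<in> saturation ?S N}"
  have "?K \<subseteq> saturation ?S N"
  proof (rule nakayama[OF no p a N])
    fix x assume "x \<in> ?K"
    then have x: "x \<in> carrier M" "b \<odot>\<^bsub>M\<^esub> x \<in> saturation ?S N" by auto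
    then have "b \<odot>\<^bsub>M\<^esub> x \<in> saturation ?S (add_multiples N a)" using sat_mono[OF add_multiples_superset[OF N R(1)] subset_refl] by blast
    then have "x \<in> saturation ?S (add_multiples N a)" using nonzerodivisorD[OF rb x(1)] by blast
    then obtain u x' where u: "u \<in> ?S" and x': "x' \<in> carrier M" and 1: "u \<odot>\<^bsub>M\<^esub> x \<ominus>\<^bsub>M\<^esub> a \<odot>\<^bsub>M\<^esub> x' \<in> N"
      using sat_add_multiples_iff[OF S N R(1) x(1)] by auto
    have uR: "u \<in> carrier R" using u by blast
    have "b \<odot>\<^bsub>M\<^esub> (u \<odot>\<^bsub>M\<^esub> x) \<ominus>\<^bsub>M\<^esub> b \<odot>\<^bsub>M\<^esub> (a \<odot>\<^bsub>M\<^esub> x') \<in> N"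
      by (rule diff_smult[OF N _ _ _ 1]) (use uR R x x' in auto)
    then have "u \<odot>\<^bsub>M\<^esub> (b \<odot>\<^bsub>M\<^esub> x) \<ominus>\<^bsub>M\<^esub> a \<odot>\<^bsub>M\<^esub> (b \<odot>\<^bsub>M\<^esub> x') \<in> saturation ?S N"
      using sat_superset[OF S N] smult_lcomm[OF R(2) uR x(1)] smult_lcomm[OF R(2,1) x'] by auto
    moreover have "u \<odot>\<^bsub>M\<^esub> (b \<odot>\<^bsub>M\<^esub> x) \<in> saturation ?S N" using submoduleE(4)[OF sN uR x(2)] .
    ultimately have "a \<odot>\<^bsub>M\<^esub> (b \<odot>\<^bsub>M\<^esub> x') \<in> saturation ?S N" using diff_cancel_left[OF sN] smult_closed R x' by blast
    then have "b \<odot>\<^bsub>M\<^esub> x' \<in> saturation ?S N" using nonzerodivisorD[OF ra] smult_closed[OF R(2) x'] by blast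
    then show "\<exists>x'\<in>?K. \<exists>u\<in>?S. u \<odot>\<^bsub>M\<^esub> x \<ominus>\<^bsub>M\<^esub> a \<odot>\<^bsub>M\<^esub> x' \<in> N" using x' u 1 by blast
  qed auto
  then show ?thesis unfolding nonzerodivisor_def by blast
qed

lemma regular_at_swap:
  assumes no: noetherian_module and p: "primeideal p R" and N: "submodule N R M" and a: "a \<in> p" and b: "b \<in> p"
  shows "regular_at (carrier R - p) N (a # b # fs) \<Longrightarrow> regular_at (carrier R - p) N (b # a # fs)"
  using nonzerodivisor_of_successive[OF assms] nonzerodivisor_swap[OF mult_set_prime[OF p] N prime_carrier[OF p a] prime_carrier[OF p b]]
  unfolding regular_at.simps add_multiples_commute[OF N prime_carrier[OF p a] prime_carrier[OF p b]] by blast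

text \<open>Adjacent transpositions carry \<open>f\<close> through the list. At the end of the list
  \<open>f\<close> acts on the quotient by all other elements, where adding a member of their ideal
  has no effect.\<close>

lemma regular_at_rotate:
  assumes no: noetherian_module and p: "primeideal p R" and f: "f \<in> p"
  shows "submodule N R M \<Longrightarrow> set gs \<subseteq> p \<Longrightarrow>
    regular_at (carrier R - p) N (f # gs) \<longleftrightarrow> regular_at (carrier R - p) N (gs @ [f])"
proof (induction gs arbitrary: N)
  case (Cons g gs)
  have g: "g \<in> p" "g \<in> carrier R" using Cons.prems(2) prime_carrier[OF p] by auto
  have "regular_at (carrier R - p) N (f # g # gs) \<longleftrightarrow> regular_at (carrier R - p) N (g # f # gs)"
    using regular_at_swap[OF no p Cons.prems(1)] f g by blast
  also have "\<dots> \<longleftrightarrow> nonzerodivisor (carrier R - p) N g \<and> regular_at (carrier R - p) (add_multiples N g) (f # gs)" by simp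
  also have "\<dots> \<longleftrightarrow> regular_at (carrier R - p) N ((g # gs) @ [f])"
    using Cons.IH[OF add_multiples_submodule[OF Cons.prems(1) g(2)]] Cons.prems(2) by simp
  finally show ?case .
qed simp

lemma genideal_smult_in_add_multiples_list:
  assumes N: "submodule N R M" and fs: "set fs \<subseteq> carrier R" and j: "j \<in> Idl (set fs)" and x: "x \<in> carrier M"
  shows "j \<odot>\<^bsub>M\<^esub> x \<in> add_multiples_list N fs"
proof -
  have "Idl (set fs) \<subseteq> colon (add_multiples_list N fs) x"
    using fs smult_in_add_multiples_list[OF N fs _ x] by (intro R.genideal_minimal colon_ideal add_multiples_list_submodule N x) (auto simp: in_colon_iff)
  then show ?thesis using j by (auto simp: in_colon_iff)
qed

lemma nonzerodivisor_if_add: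
  assumes S: "mult_set S" and N: "submodule N R M" and f: "f \<in> carrier R" and j: "j \<in> carrier R"
    and jN: "\<And>x. x \<in> carrier M \<Longrightarrow> j \<odot>\<^bsub>M\<^esub> x \<in> N" and r: "nonzerodivisor S N (f \<oplus> j)"
  shows "nonzerodivisor S N f"
  unfolding nonzerodivisor_def
proof (intro ballI impI)
  fix x assume x: "x \<in> carrier M" "f \<odot>\<^bsub>M\<^esub> x \<in> saturation S N"
  have "j \<odot>\<^bsub>M\<^esub> x \<in> saturation S N" using jN[OF x(1)] sat_superset[OF S N] by blast
  then have "(f \<oplus> j) \<odot>\<^bsub>M\<^esub> x \<in> saturation S N"
    using x f j submoduleE(5)[OF sat_submodule[OF S N]] by (simp add: smult_l_distr)
  then show "x \<in> saturation S N" using nonzerodivisorD[OF r x(1)] by blast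
qed

text \<open>On the zero module even \<open>0\<close> acts injectively, so zeros alone form a regular
  sequence of any length. This covers primes at which the element divided out is a unit.\<close>

lemma depth_ge_if_trivial:
  assumes q: "primeideal q R"
  shows "submodule N R M \<Longrightarrow> carrier M \<subseteq> saturation (carrier R - q) N \<Longrightarrow> depth_ge q N n"
proof (induction n arbitrary: N)
  case (Suc n)
  interpret q: primeideal q R by fact
  have "carrier M \<subseteq> saturation (carrier R - q) (add_multiples N \<zero>)"
    using sat_mono[OF add_multiples_superset[OF Suc.prems(1), of \<zero>] subset_refl, of "carrier R - q"] Suc.prems(2) by simp
  then have "depth_ge q (add_multiples N \<zero>) n" using Suc.IH[OF add_multiples_submodule[OF Suc.prems(1)]] by simp
  moreover have "nonzerodivisor (carrier R - q) N \<zero>" using Suc.prems(2) unfolding nonzerodivisor_def by blast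
  ultimately show ?case using q.zero_closed by auto
qed simp

text \<open>
  The first element is changed modulo the others to a nonzerodivisor \<open>f + j\<close>. Permuting the sequence
  lets \<open>j\<close> be removed afterwards.
\<close>

lemma regular_at_if_depth_ge_below:
  assumes no: noetherian_module and nr: "noetherian_ring R" and p: "primeideal p R"
  shows "submodule N R M \<Longrightarrow> set fs \<subseteq> p \<Longrightarrow>
    (\<And>q. primeideal q R \<Longrightarrow> q \<subseteq> p \<Longrightarrow> set fs \<subseteq> q \<Longrightarrow> depth_ge q N (length fs)) \<Longrightarrow> regular_at (carrier R - p) N fs"
proof (induction fs arbitrary: N)
  case (Cons f gs)
  interpret p: primeideal p R by fact
  note N = Cons.prems(1)
  have f: "f \<in> p" "f \<in> carrier R" and gs: "set gs \<subseteq> p" "set gs \<subseteq> carrier R"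
    using Cons.prems(2) prime_carrier[OF p] by auto
  let ?J = "Idl (set gs)"
  have J: "ideal ?J R" using R.genideal_ideal[OF gs(2)] .
  have gJ: "set gs \<subseteq> ?J" using R.genideal_self[OF gs(2)] .
  have "\<exists>j\<in>?J. \<forall>K\<in>{N}. nonzerodivisor (carrier R - p) K (f \<oplus> j)"
  proof (rule common_nonzerodivisor_in_coset[OF no nr p _ _ f(2) J])
    fix K q assume q: "K \<in> {N}" "q \<in> assoc_primes K" "q \<subseteq> p"
    have qp: "primeideal q R" using q unfolding assoc_primes_def by blast
    show "\<not> (f \<in> q \<and> ?J \<subseteq> q)"
    proof
      assume "f \<in> q \<and> ?J \<subseteq> q"
      then have "set (f # gs) \<subseteq> q" using gJ by auto
      then have "depth_ge q N (length (f # gs))" using Cons.prems(3) qp q by blast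
      then have "socle_zero q N" using nonzerodivisor_imp_socle_zero by auto
      \<comment> \<open>Positive depth at \<open>q\<close> excludes a nonzero socle, so
        \<open>q\<close> cannot be associated to \<open>M/N\<close>.\<close>
      then show False using socle_zero_imp_not_assoc[OF qp N] q by simp
    qed
  qed (use N in auto)
  then obtain j where j: "j \<in> ?J" and r: "nonzerodivisor (carrier R - p) N (f \<oplus> j)" by blast
  have jR: "j \<in> carrier R" using ideal.Icarr[OF J j] .
  have Jq: "?J \<subseteq> q" if "primeideal q R" "set gs \<subseteq> q" for q
    using R.genideal_minimal[OF primeideal.axioms(1)[OF that(1)] that(2)] .
  have f'p: "f \<oplus> j \<in> p" using f(1) j Jq[OF p gs(1)] p.a_closed by blast
  have f'R: "f \<oplus> j \<in> carrier R" using f jR by simp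
  note N' = add_multiples_submodule[OF N f'R]
  have "regular_at (carrier R - p) (add_multiples N (f \<oplus> j)) gs"
  proof (rule Cons.IH[OF N' gs(1)])
    fix q assume q: "primeideal q R" "q \<subseteq> p" "set gs \<subseteq> q"
    interpret q: primeideal q R using q(1) .
    have jq: "j \<in> q" using Jq[OF q(1,3)] j by blast
    show "depth_ge q (add_multiples N (f \<oplus> j)) (length gs)"
    \<comment> \<open>If \<open>f\<close> lies in \<open>q\<close>, so does \<open>f + j\<close>,
      and the exchange property lowers the depth by one. If not, \<open>f + j\<close> is a unit at
      \<open>q\<close> and the localized quotient vanishes.\<close>
    proof (cases "f \<in> q")
      case True
      then have "depth_ge q N (Suc (length gs))" using Cons.prems(3)[OF q(1,2)] q(3) by simp
      moreover have "f \<oplus> j \<in> q" using True jq q.a_closed by blast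
      moreover have "nonzerodivisor (carrier R - q) N (f \<oplus> j)"
        using nonzerodivisor_mono[OF mult_set_prime[OF p] mult_set_prime[OF q(1)] _ f'R r N] q(2) by blast
      ultimately show ?thesis using depth_ge_add_multiples[OF no nr q(1) N] by blast
    next
      case False
      have "f \<oplus> j \<notin> q"
      proof
        assume "f \<oplus> j \<in> q"
        then have "f \<oplus> j \<oplus> \<ominus> j \<in> q" using jq q.a_closed q.a_inv_closed by blast
        moreover have "f \<oplus> j \<oplus> \<ominus> j = f" using f jR by (simp add: R.a_assoc R.r_neg)
        ultimately show False using False by simp
      qed
      then have "f \<oplus> j \<in> carrier R - q" using f'R by blast
      then have "carrier M \<subseteq> saturation (carrier R - q) (add_multiples N (f \<oplus> j))"
        using smult_in_add_multiples[OF N f'R] satI by blast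
      then show ?thesis using depth_ge_if_trivial[OF q(1) N'] by blast
    qed
  qed
  then have "regular_at (carrier R - p) N ((f \<oplus> j) # gs)" using r by simp
  then have "regular_at (carrier R - p) N (gs @ [f \<oplus> j])" using regular_at_rotate[OF no p f'p N gs(1)] by blast
  then have "regular_at (carrier R - p) N gs" "nonzerodivisor (carrier R - p) (add_multiples_list N gs) (f \<oplus> j)" by (auto simp: regular_at_append)
  moreover have "nonzerodivisor (carrier R - p) (add_multiples_list N gs) f"
    using nonzerodivisor_if_add[OF mult_set_prime[OF p] add_multiples_list_submodule[OF N gs(2)] f(2) jR
        genideal_smult_in_add_multiples_list[OF N gs(2) j]] calculation(2) by blast
  ultimately have "regular_at (carrier R - p) N (gs @ [f])" by (simp add: regular_at_append)
  then show ?case using regular_at_rotate[OF no p f(1) N gs(1)] by blast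
qed simp

text \<open>
  If \<open>f x = 0\<close>, then \<open>x\<close> lies in \<open>f\<^sup>n (M/J)\<^sub>q\<close> for all \<open>n\<close>: from \<open>x = f\<^sup>n y\<close> one gets \<open>f\<^sup>n\<^sup>+\<^sup>1 y = 0\<close>, so \<open>y\<close>
  vanishes at every associated prime of \<open>M/(J + f M)\<close>, whence \<open>y\<close> lies in \<open>f (M/J)\<^sub>q\<close>. The chain of kernels of
  \<open>f\<^sup>n\<close> is stationary, so \<open>x = 0\<close>.
\<close>

lemma nonzerodivisor_if_at_assoc:
  assumes no: noetherian_module and nr: "noetherian_ring R" and q: "primeideal q R" and J: "submodule J R M"
    and f: "f \<in> carrier R"
    and ass: "\<And>p. p \<in> assoc_primes (add_multiples J f) \<Longrightarrow> p \<subseteq> q \<Longrightarrow> nonzerodivisor (carrier R - p) J f"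
  shows "nonzerodivisor (carrier R - q) J f"
  unfolding nonzerodivisor_def
proof (intro ballI impI)
  let ?S = "carrier R - q"
  note S = mult_set_prime[OF q]
  note sJ = sat_submodule[OF S J]
  note fJ = add_multiples_submodule[OF J f]
  have pw: "f [^] n \<in> carrier R" for n :: nat using f by simp
  define K where "K n = {y \<in> carrier M. (f [^] n) \<odot>\<^bsub>M\<^esub> y \<in> saturation ?S J}" for n :: nat
  have K: "submodule (K n) R M" for n
  proof (rule submoduleI)
    show "K n \<subseteq> carrier M" unfolding K_def by blast
    show "\<zero>\<^bsub>M\<^esub> \<in> K n" unfolding K_def using pw submodule_zero[OF sJ] by simp
    show "\<ominus>\<^bsub>M\<^esub> a \<in> K n" if "a \<in> K n" for a
      using that pw submoduleE(3)[OF sJ] unfolding K_def by (simp add: smult_r_minus)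
    show "a \<oplus>\<^bsub>M\<^esub> b \<in> K n" if "a \<in> K n" "b \<in> K n" for a b
      using that pw submoduleE(5)[OF sJ] unfolding K_def by (simp add: smult_r_distr)
    show "a \<odot>\<^bsub>M\<^esub> x \<in> K n" if "a \<in> carrier R" "x \<in> K n" for a x
      using that pw submoduleE(4)[OF sJ] smult_lcomm[of "f [^] n" a x] unfolding K_def by simp
  qed
  have step: "(f [^] Suc n) \<odot>\<^bsub>M\<^esub> y = f \<odot>\<^bsub>M\<^esub> ((f [^] n) \<odot>\<^bsub>M\<^esub> y)" if "y \<in> carrier M" for n :: nat and y
    using that f pw smult_lcomm by (simp add: smult_assoc1)
  have inc: "K n \<subseteq> K (Suc n)" for n
    using step submoduleE(4)[OF sJ f] unfolding K_def by auto
  obtain X where X: "X \<in> range K" "\<And>L. L \<in> range K \<Longrightarrow> X \<subseteq> L \<Longrightarrow> L = X"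
    by (rule noetherian_moduleE[OF no, of "K 0" "range K"]) (use K in auto)
  then obtain s where Xs: "X = K s" by blast
  have s: "K (Suc s) = K s" using X(2)[of "K (Suc s)"] inc[of s] unfolding Xs by simp
  fix x assume x: "x \<in> carrier M" and fx: "f \<odot>\<^bsub>M\<^esub> x \<in> saturation ?S J"
  have key: "y \<in> K (Suc n)" if u: "u \<in> ?S" and y: "y \<in> carrier M" and 1: "u \<odot>\<^bsub>M\<^esub> x \<ominus>\<^bsub>M\<^esub> (f [^] n) \<odot>\<^bsub>M\<^esub> y \<in> J" for u y n
  proof -
    have uR: "u \<in> carrier R" using u by blast
    have "f \<odot>\<^bsub>M\<^esub> (u \<odot>\<^bsub>M\<^esub> x) \<ominus>\<^bsub>M\<^esub> f \<odot>\<^bsub>M\<^esub> ((f [^] n) \<odot>\<^bsub>M\<^esub> y) \<in> J"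
      by (rule diff_smult[OF J _ _ f 1]) (use uR x y pw in auto)
    then have "f \<odot>\<^bsub>M\<^esub> (u \<odot>\<^bsub>M\<^esub> x) \<ominus>\<^bsub>M\<^esub> (f [^] Suc n) \<odot>\<^bsub>M\<^esub> y \<in> saturation ?S J"
      using sat_superset[OF S J] step[OF y] by auto
    moreover have "f \<odot>\<^bsub>M\<^esub> (u \<odot>\<^bsub>M\<^esub> x) \<in> saturation ?S J"
      using submoduleE(4)[OF sJ uR fx] smult_lcomm[OF f uR x] by simp
    ultimately have "(f [^] Suc n) \<odot>\<^bsub>M\<^esub> y \<in> saturation ?S J" using diff_cancel_left[OF sJ] smult_closed[OF pw y] by blast
    then show ?thesis using y unfolding K_def by blast
  qed
  have inside: "\<exists>u\<in>?S. \<exists>y\<in>carrier M. u \<odot>\<^bsub>M\<^esub> x \<ominus>\<^bsub>M\<^esub> (f [^] n) \<odot>\<^bsub>M\<^esub> y \<in> J" for n :: nat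
  proof (induction n)
    case 0
    show ?case using x mult_setD(2)[OF S] submodule_zero[OF J]
      by (intro bexI[of _ \<one>] bexI[of _ x]) (auto simp: M.minus_eq M.r_neg)
  next
    case (Suc n)
    then obtain u y where u: "u \<in> ?S" and y: "y \<in> carrier M" and 1: "u \<odot>\<^bsub>M\<^esub> x \<ominus>\<^bsub>M\<^esub> (f [^] n) \<odot>\<^bsub>M\<^esub> y \<in> J" by blast
    have yK: "y \<in> K (Suc n)" using key[OF u y 1] .
    have "y \<in> saturation ?S (add_multiples J f)"
    proof (rule ccontr)
      assume "y \<notin> saturation ?S (add_multiples J f)"
      then obtain a where a: "a \<in> carrier R" and pa: "colon (add_multiples J f) (a \<odot>\<^bsub>M\<^esub> y) \<in> assoc_primes (add_multiples J f)"
        and pq: "colon (add_multiples J f) (a \<odot>\<^bsub>M\<^esub> y) \<subseteq> q"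
        using exists_assoc_prime[OF nr q fJ y] by blast
      define p where "p = colon (add_multiples J f) (a \<odot>\<^bsub>M\<^esub> y)"
      have pp: "primeideal p R" using pa unfolding p_def assoc_primes_def by blast
      have r: "nonzerodivisor (carrier R - p) J f" using ass pa pq p_def by blast
      have "saturation ?S J \<subseteq> saturation (carrier R - p) J" using pq p_def by (intro sat_mono) auto
      then have "(f [^] Suc n) \<odot>\<^bsub>M\<^esub> y \<in> saturation (carrier R - p) J" using yK unfolding K_def by blast
      \<comment> \<open>Regularity of \<open>f\<close> at the associated prime strips the powers of
        \<open>f\<close> one at a time.\<close>
      moreover have "(f [^] k) \<odot>\<^bsub>M\<^esub> y \<in> saturation (carrier R - p) J \<Longrightarrow> y \<in> saturation (carrier R - p) J" for k :: nat
      proof (induction k)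
        case (Suc k)
        then show ?case using nonzerodivisorD[OF r, of "(f [^] k) \<odot>\<^bsub>M\<^esub> y"] step[OF y, of k] pw y by simp
      qed (use y in simp)
      ultimately have "y \<in> saturation (carrier R - p) J" by blast
      then obtain v where v: "v \<in> carrier R - p" "v \<odot>\<^bsub>M\<^esub> y \<in> J" by (rule satE)
      then have "v \<odot>\<^bsub>M\<^esub> (a \<odot>\<^bsub>M\<^esub> y) \<in> add_multiples J f"
        using submoduleE(4)[OF J a v(2)] add_multiples_superset[OF J f] smult_lcomm[of v a y] a y by auto
      then show False using v(1) unfolding p_def by (auto simp: in_colon_iff)
    qed
    then obtain v z where v: "v \<in> ?S" and z: "z \<in> carrier M" and 2: "v \<odot>\<^bsub>M\<^esub> y \<ominus>\<^bsub>M\<^esub> f \<odot>\<^bsub>M\<^esub> z \<in> J"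
      using sat_add_multiples_iff[OF S J f y] by auto
    have R: "u \<in> carrier R" "v \<in> carrier R" using u v by auto
    have 3: "v \<odot>\<^bsub>M\<^esub> (u \<odot>\<^bsub>M\<^esub> x) \<ominus>\<^bsub>M\<^esub> v \<odot>\<^bsub>M\<^esub> ((f [^] n) \<odot>\<^bsub>M\<^esub> y) \<in> J"
      by (rule diff_smult[OF J _ _ _ 1]) (use R x y pw in auto)
    have 4: "(f [^] n) \<odot>\<^bsub>M\<^esub> (v \<odot>\<^bsub>M\<^esub> y) \<ominus>\<^bsub>M\<^esub> (f [^] n) \<odot>\<^bsub>M\<^esub> (f \<odot>\<^bsub>M\<^esub> z) \<in> J"
      by (rule diff_smult[OF J _ _ _ 2]) (use R z y pw f in auto)
    have "v \<odot>\<^bsub>M\<^esub> (u \<odot>\<^bsub>M\<^esub> x) \<ominus>\<^bsub>M\<^esub> (f [^] n) \<odot>\<^bsub>M\<^esub> (f \<odot>\<^bsub>M\<^esub> z) \<in> J"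
      by (rule diff_trans[OF J _ _ _ _ 4]) (use 3 R x y z pw f smult_lcomm[OF R(2) pw y] in auto)
    then have "(v \<otimes> u) \<odot>\<^bsub>M\<^esub> x \<ominus>\<^bsub>M\<^esub> (f [^] Suc n) \<odot>\<^bsub>M\<^esub> z \<in> J"
      using R x z pw f by (simp add: smult_assoc1)
    then show ?case using mult_setD(3)[OF S v u] z by blast
  qed
  \<comment> \<open>At the stationary index \<open>s\<close>, \<open>y\<close> is killed already by
    the \<open>s\<close>-th power of \<open>f\<close>, and that product is
    \<open>u x\<close>.\<close>
  obtain u y where u: "u \<in> ?S" and y: "y \<in> carrier M" and 1: "u \<odot>\<^bsub>M\<^esub> x \<ominus>\<^bsub>M\<^esub> (f [^] s) \<odot>\<^bsub>M\<^esub> y \<in> J"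
    using inside[of s] by blast
  have "y \<in> K s" using key[OF u y 1] s by blast
  then have "(f [^] s) \<odot>\<^bsub>M\<^esub> y \<in> saturation ?S J" unfolding K_def by blast
  moreover have "u \<odot>\<^bsub>M\<^esub> x \<ominus>\<^bsub>M\<^esub> (f [^] s) \<odot>\<^bsub>M\<^esub> y \<in> saturation ?S J" using 1 sat_superset[OF S J] by blast
  ultimately have "u \<odot>\<^bsub>M\<^esub> x \<in> saturation ?S J" using diff_cancel_right[OF sJ] u x by blast
  then show "x \<in> saturation ?S J" using sat_cancel[OF S x u] by blast
qed

text \<open>
  By Nakayama, the submodule of \<open>M/J\<close> killed by \<open>p\<close> has nonzero image in \<open>M/(J + f M)\<close>; any associated prime
  of that image contains \<open>p\<close>.
\<close>

lemma assoc_prime_add_multiples: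
  assumes no: noetherian_module and nr: "noetherian_ring R" and q: "primeideal q R" and J: "submodule J R M"
    and f: "f \<in> q" and r: "nonzerodivisor (carrier R - q) J f" and p: "p \<in> assoc_primes J" "p \<subseteq> q"
  shows "\<exists>p'\<in>assoc_primes (add_multiples J f). p \<subseteq> p' \<and> p' \<subseteq> q"
proof -
  let ?S = "carrier R - q"
  note S = mult_set_prime[OF q]
  note sJ = sat_submodule[OF S J]
  have fR: "f \<in> carrier R" using prime_carrier[OF q f] .
  note fJ = add_multiples_submodule[OF J fR]
  obtain x where x: "x \<in> carrier M" "p = colon J x" and pp: "primeideal p R" using p(1) unfolding assoc_primes_def by blast
  have inp: "t \<in> p \<longleftrightarrow> t \<in> carrier R \<and> t \<odot>\<^bsub>M\<^esub> x \<in> J" for t using x(2) in_colon_iff by metis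
  let ?K = "{z \<in> carrier M. \<forall>a\<in>p. a \<odot>\<^bsub>M\<^esub> z \<in> saturation ?S J}"
  have "\<not> ?K \<subseteq> saturation ?S (add_multiples J f)"
  proof
    assume *: "?K \<subseteq> saturation ?S (add_multiples J f)"
    have "?K \<subseteq> saturation ?S J"
    proof (rule nakayama[OF no q f J])
      fix z assume z: "z \<in> ?K"
      then obtain u z' where u: "u \<in> ?S" and z': "z' \<in> carrier M" and 1: "u \<odot>\<^bsub>M\<^esub> z \<ominus>\<^bsub>M\<^esub> f \<odot>\<^bsub>M\<^esub> z' \<in> J"
        using sat_add_multiples_iff[OF S J fR, of z] * by auto
      have zM: "z \<in> carrier M" using z by blast
      have "a \<odot>\<^bsub>M\<^esub> z' \<in> saturation ?S J" if a: "a \<in> p" for a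
      proof -
        have aR: "a \<in> carrier R" and uR: "u \<in> carrier R" using inp a u by auto
        have "a \<odot>\<^bsub>M\<^esub> (u \<odot>\<^bsub>M\<^esub> z) \<ominus>\<^bsub>M\<^esub> a \<odot>\<^bsub>M\<^esub> (f \<odot>\<^bsub>M\<^esub> z') \<in> J"
          by (rule diff_smult[OF J _ _ aR 1]) (use uR zM z' fR in auto)
        then have "u \<odot>\<^bsub>M\<^esub> (a \<odot>\<^bsub>M\<^esub> z) \<ominus>\<^bsub>M\<^esub> f \<odot>\<^bsub>M\<^esub> (a \<odot>\<^bsub>M\<^esub> z') \<in> saturation ?S J"
          using sat_superset[OF S J] smult_lcomm[OF aR uR zM] smult_lcomm[OF aR fR z'] by auto
        moreover have "u \<odot>\<^bsub>M\<^esub> (a \<odot>\<^bsub>M\<^esub> z) \<in> saturation ?S J" using z a submoduleE(4)[OF sJ uR] by blast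
        ultimately have "f \<odot>\<^bsub>M\<^esub> (a \<odot>\<^bsub>M\<^esub> z') \<in> saturation ?S J" using diff_cancel_left[OF sJ] smult_closed fR aR z' by blast
        then show ?thesis using nonzerodivisorD[OF r] smult_closed[OF aR z'] by blast
      qed
      then show "\<exists>z'\<in>?K. \<exists>u\<in>?S. u \<odot>\<^bsub>M\<^esub> z \<ominus>\<^bsub>M\<^esub> f \<odot>\<^bsub>M\<^esub> z' \<in> J" using z' u 1 by blast
    qed auto
    \<comment> \<open>The element with annihilator \<open>p\<close> belongs to \<open>?K\<close>,
      yet it survives at \<open>q\<close> because \<open>p\<close> is contained in
      \<open>q\<close>.\<close>
    moreover have "x \<in> ?K" using x(1) inp sat_superset[OF S J] by blast
    ultimately have "x \<in> saturation ?S J" by blast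
    then show False using inp p(2) unfolding saturation_def by blast
  qed
  then obtain z where z: "z \<in> ?K" "z \<notin> saturation ?S (add_multiples J f)" by blast
  then have zM: "z \<in> carrier M" by blast
  obtain a where a: "a \<in> carrier R" and pa: "colon (add_multiples J f) (a \<odot>\<^bsub>M\<^esub> z) \<in> assoc_primes (add_multiples J f)"
    and pq: "colon (add_multiples J f) (a \<odot>\<^bsub>M\<^esub> z) \<subseteq> q"
    using exists_assoc_prime[OF nr q fJ zM z(2)] by blast
  define p' where "p' = colon (add_multiples J f) (a \<odot>\<^bsub>M\<^esub> z)"
  have pp': "primeideal p' R" using pa unfolding p'_def assoc_primes_def by blast
  have "i \<in> p'" if i: "i \<in> p" for i
  proof -
    have iR: "i \<in> carrier R" using inp i by blast
    have "i \<odot>\<^bsub>M\<^esub> z \<in> saturation ?S J" using z(1) i by blast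
    then obtain u where u: "u \<in> ?S" "u \<odot>\<^bsub>M\<^esub> (i \<odot>\<^bsub>M\<^esub> z) \<in> J" by (rule satE)
    have uR: "u \<in> carrier R" using u by blast
    have "(u \<otimes> i) \<odot>\<^bsub>M\<^esub> (a \<odot>\<^bsub>M\<^esub> z) = a \<odot>\<^bsub>M\<^esub> (u \<odot>\<^bsub>M\<^esub> (i \<odot>\<^bsub>M\<^esub> z))"
      using uR iR a zM by (simp add: smult_assoc1 smult_lcomm)
    also have "\<dots> \<in> add_multiples J f" using submoduleE(4)[OF J a u(2)] add_multiples_superset[OF J fR] by blast
    finally have "u \<otimes> i \<in> p'" using uR iR unfolding p'_def by (simp add: in_colon_iff)
    moreover have "u \<notin> p'" using u pq p'_def by blast
    ultimately show ?thesis using primeideal.I_prime[OF pp' uR iR] by blast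
  qed
  then show ?thesis using pa pq unfolding p'_def by blast
qed

text \<open>The last element is handled by \<open>nonzerodivisor_if_at_assoc\<close>. To drop it,
  every associated prime \<open>p\<close> of the shorter quotient inside \<open>q\<close> is
  enlarged to an associated prime \<open>p'\<close> of the full quotient, still inside
  \<open>q\<close>. Regularity is given at \<open>p'\<close> and descends to \<open>p\<close> by
  further localization.\<close>

lemma regular_at_if_regular_at_assoc:
  assumes no: noetherian_module and nr: "noetherian_ring R" and q: "primeideal q R" and N: "submodule N R M"
  shows "set fs \<subseteq> q \<Longrightarrow>
    (\<And>p. p \<in> assoc_primes (add_multiples_list N fs) \<Longrightarrow> p \<subseteq> q \<Longrightarrow> regular_at (carrier R - p) N fs) \<Longrightarrow> regular_at (carrier R - q) N fs"
proof (induction fs rule: rev_induct)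
  case (snoc f fs)
  let ?J = "add_multiples_list N fs"
  have fs: "set fs \<subseteq> q" "set fs \<subseteq> carrier R" and f: "f \<in> q" "f \<in> carrier R"
    using snoc.prems(1) prime_carrier[OF q] by auto
  have J: "submodule ?J R M" using add_multiples_list_submodule[OF N fs(2)] .
  have ass: "regular_at (carrier R - p) N fs \<and> nonzerodivisor (carrier R - p) ?J f" if "p \<in> assoc_primes (add_multiples ?J f)" "p \<subseteq> q" for p
    using snoc.prems(2)[of p] that by (simp add: add_multiples_list_append regular_at_append)
  have r: "nonzerodivisor (carrier R - q) ?J f"
    using nonzerodivisor_if_at_assoc[OF no nr q J f(2)] ass by blast
  have "regular_at (carrier R - q) N fs"
  proof (rule snoc.IH[OF fs(1)])
    fix p assume p: "p \<in> assoc_primes ?J" "p \<subseteq> q"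
    obtain p' where p': "p' \<in> assoc_primes (add_multiples ?J f)" "p \<subseteq> p'" "p' \<subseteq> q"
      using assoc_prime_add_multiples[OF no nr q J f(1) r p] by blast
    have "primeideal p R" "primeideal p' R" using p p' unfolding assoc_primes_def by auto
    then show "regular_at (carrier R - p) N fs"
      using regular_at_mono[OF mult_set_prime mult_set_prime _ fs(2) _ N, of p' p] ass[OF p'(1,3)] p'(2) by blast
  qed
  then show ?case using r by (simp add: regular_at_append)
qed simp

lemma regular_at_if_depth_ge_at_assoc:
  assumes no: noetherian_module and nr: "noetherian_ring R" and N: "submodule N R M" and fs: "set fs \<subseteq> carrier R"
    and dp: "\<And>p. p \<in> assoc_primes (add_multiples_list N fs) \<Longrightarrow> depth_ge p N (length fs)"
    and q: "primeideal q R" "set fs \<subseteq> q"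
  shows "regular_at (carrier R - q) N fs"
proof -
  let ?A = "assoc_primes (add_multiples_list N fs)"
  have J: "submodule (add_multiples_list N fs) R M" using add_multiples_list_submodule[OF N fs] .
  have Aprime: "primeideal p R" if "p \<in> ?A" for p using that unfolding assoc_primes_def by blast
  \<comment> \<open>The sequence kills \<open>M/IM\<close>, so it lies in every annihilator.\<close>
  have Afs: "set fs \<subseteq> p" if pA: "p \<in> ?A" for p
  proof -
    obtain x where "x \<in> carrier M" "p = colon (add_multiples_list N fs) x" using pA unfolding assoc_primes_def by blast
    then show ?thesis using smult_in_add_multiples_list[OF N fs] fs by (auto simp: in_colon_iff)
  qed
  have good: "regular_at (carrier R - p) N fs" if p: "p \<in> ?A" for p
  proof (rule ccontr)
    assume "\<not> regular_at (carrier R - p) N fs"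
    then have "{p \<in> ?A. \<not> regular_at (carrier R - p) N fs} \<noteq> {}" using p by blast
    moreover have "finite {p \<in> ?A. \<not> regular_at (carrier R - p) N fs}"
      using finite_assoc_primes[OF no nr J] by (rule rev_finite_subset) blast
    ultimately obtain m where m: "m \<in> ?A" "\<not> regular_at (carrier R - m) N fs"
      and min: "\<And>p. p \<in> ?A \<Longrightarrow> \<not> regular_at (carrier R - p) N fs \<Longrightarrow> p \<subseteq> m \<Longrightarrow> m = p"
      using finite_has_minimal[of "{p \<in> ?A. \<not> regular_at (carrier R - p) N fs}"] by blast
    have "regular_at (carrier R - m) N fs"
    proof (rule regular_at_if_depth_ge_below[OF no nr Aprime[OF m(1)] N Afs[OF m(1)]])
      fix q assume q: "primeideal q R" "q \<subseteq> m" "set fs \<subseteq> q"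
      show "depth_ge q N (length fs)"
      proof (cases "q = m")
        case True
        then show ?thesis using dp m(1) by blast
      next
        \<comment> \<open>An associated prime inside \<open>q\<close> is strictly smaller than
          \<open>m\<close>, so the sequence is regular there by the choice of \<open>m\<close>.
          Regularity passes to \<open>q\<close>, and the sequence itself witnesses the
          depth.\<close>
        case False
        have "regular_at (carrier R - q) N fs"
          by (rule regular_at_if_regular_at_assoc[OF no nr q(1) N q(3)]) (use min q(2) False in blast)
        then show ?thesis using depth_ge_iff_regular_at q(3) by blast
      qed
    qed
    then show False using m(2) by blast
  qed
  then show ?thesis using regular_at_if_regular_at_assoc[OF no nr q(1) N q(2)] by blast
qed

section \<open>Finitely generated modules over noetherian rings\<close>

text \<open>Noetherianity of the submodule \<open>T\<close>, expressed through submodules of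
  \<open>M\<close> so that \<open>T\<close> need not become a module of its own.\<close>

definition noetherian_below :: "'c set \<Rightarrow> bool"
  where "noetherian_below T \<longleftrightarrow> (\<forall>F. F \<noteq> {} \<and> (\<forall>N\<in>F. submodule N R M \<and> N \<subseteq> T) \<longrightarrow>
    (\<exists>N\<in>F. \<forall>K\<in>F. N \<subseteq> K \<longrightarrow> K = N))"

lemma submodule_Int: "submodule N R M \<Longrightarrow> submodule K R M \<Longrightarrow> submodule (N \<inter> K) R M"
  by (rule submoduleI) (auto simp: submodule_closed)

text \<open>The extension argument for \<open>T\<close> inside \<open>T + R a\<close>:
  \<open>I K\<close> is the ideal of coefficients \<open>r\<close> with \<open>r a\<close> in
  \<open>K + T\<close>, and nested submodules with the same \<open>I K\<close> and the same
  intersection with \<open>T\<close> coincide.\<close>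

lemma noetherian_below_adjoin:
  assumes nr: "noetherian_ring R" and T: "submodule T R M" "noetherian_below T" and a: "a \<in> carrier M"
  shows "noetherian_below (adjoin T a)"
  unfolding noetherian_below_def
proof (intro allI impI)
  fix F assume F: "F \<noteq> {} \<and> (\<forall>N\<in>F. submodule N R M \<and> N \<subseteq> adjoin T a)"
  have Fs: "submodule K R M" "K \<subseteq> adjoin T a" if "K \<in> F" for K using F that by auto
  define I where "I K = {r \<in> carrier R. \<exists>t\<in>T. r \<odot>\<^bsub>M\<^esub> a \<ominus>\<^bsub>M\<^esub> t \<in> K}" for K
  have TM: "\<And>t. t \<in> T \<Longrightarrow> t \<in> carrier M" using submodule_carrier[OF T(1)] .
  have ideal: "ideal (I K) R" if K: "submodule K R M" for K
  proof (rule idealI)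
    show "ring R" by (rule R.ring_axioms)
    show "subgroup (I K) (add_monoid R)"
    proof (rule R.add.subgroupI)
      show "I K \<subseteq> carrier R" unfolding I_def by auto
      have "\<zero> \<in> I K" unfolding I_def using submodule_zero[OF K] submodule_zero[OF T(1)] a
        by (auto simp: M.minus_eq minus_zero_M intro!: bexI[of _ "\<zero>\<^bsub>M\<^esub>"])
      then show "I K \<noteq> {}" by blast
      show "\<ominus> r \<in> I K" if "r \<in> I K" for r
      proof -
        obtain t where r: "r \<in> carrier R" and t: "t \<in> T" "r \<odot>\<^bsub>M\<^esub> a \<ominus>\<^bsub>M\<^esub> t \<in> K"
          using \<open>r \<in> I K\<close> unfolding I_def by blast
        have "(\<ominus> r) \<odot>\<^bsub>M\<^esub> a \<ominus>\<^bsub>M\<^esub> (\<ominus>\<^bsub>M\<^esub> t) = \<ominus>\<^bsub>M\<^esub> (r \<odot>\<^bsub>M\<^esub> a \<ominus>\<^bsub>M\<^esub> t)"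
          using r t a TM by (simp add: smult_l_minus M.minus_eq M.minus_add)
        also have "\<dots> \<in> K" using submoduleE(3)[OF K t(2)] .
        finally show ?thesis unfolding I_def using r submoduleE(3)[OF T(1) t(1)] by auto
      qed
      show "r \<oplus> s \<in> I K" if rs: "r \<in> I K" "s \<in> I K" for r s
      proof -
        obtain t where r: "r \<in> carrier R" and t: "t \<in> T" "r \<odot>\<^bsub>M\<^esub> a \<ominus>\<^bsub>M\<^esub> t \<in> K"
          using rs(1) unfolding I_def by blast
        obtain t' where s: "s \<in> carrier R" and t': "t' \<in> T" "s \<odot>\<^bsub>M\<^esub> a \<ominus>\<^bsub>M\<^esub> t' \<in> K"
          using rs(2) unfolding I_def by blast
        have "(r \<oplus> s) \<odot>\<^bsub>M\<^esub> a \<ominus>\<^bsub>M\<^esub> (t \<oplus>\<^bsub>M\<^esub> t') = (r \<odot>\<^bsub>M\<^esub> a \<ominus>\<^bsub>M\<^esub> t) \<oplus>\<^bsub>M\<^esub> (s \<odot>\<^bsub>M\<^esub> a \<ominus>\<^bsub>M\<^esub> t')"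
          using r s t t' a TM by (simp add: smult_l_distr M.minus_eq M.minus_add M.a_ac)
        also have "\<dots> \<in> K" using submoduleE(5)[OF K t(2) t'(2)] .
        finally show ?thesis unfolding I_def using r s submoduleE(5)[OF T(1) t(1) t'(1)] by auto
      qed
    qed
    have l: "y \<otimes> r \<in> I K" if "r \<in> I K" and y: "y \<in> carrier R" for r y
    proof -
      obtain t where r: "r \<in> carrier R" and t: "t \<in> T" "r \<odot>\<^bsub>M\<^esub> a \<ominus>\<^bsub>M\<^esub> t \<in> K"
        using \<open>r \<in> I K\<close> unfolding I_def by blast
      have "(y \<otimes> r) \<odot>\<^bsub>M\<^esub> a \<ominus>\<^bsub>M\<^esub> y \<odot>\<^bsub>M\<^esub> t = y \<odot>\<^bsub>M\<^esub> (r \<odot>\<^bsub>M\<^esub> a \<ominus>\<^bsub>M\<^esub> t)"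
        using r y t a TM by (simp add: smult_assoc1 smult_r_diff)
      also have "\<dots> \<in> K" using submoduleE(4)[OF K y t(2)] .
      finally show ?thesis unfolding I_def using r y submoduleE(4)[OF T(1) y t(1)] by auto
    qed
    show "y \<otimes> r \<in> I K" "r \<otimes> y \<in> I K" if "r \<in> I K" "y \<in> carrier R" for r y
    proof -
      have "r \<in> carrier R" using that(1) unfolding I_def by blast
      then show "y \<otimes> r \<in> I K" "r \<otimes> y \<in> I K" using l[OF that] R.m_comm[OF _ that(2)] by auto
    qed
  qed
  obtain J where J: "J \<in> I ` F" "\<And>J'. J' \<in> I ` F \<Longrightarrow> J \<subseteq> J' \<Longrightarrow> J' = J"
    by (rule noetherian_ideals[OF nr, of "I ` F"]) (use F ideal in auto)
  \<comment> \<open>The two maximal choices are nested: the intersection with \<open>T\<close> is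
    maximized only among members whose coefficient ideal is already the maximal
    \<open>J\<close>.\<close>
  let ?G = "{K \<inter> T | K. K \<in> F \<and> I K = J}"
  have "?G \<noteq> {} \<and> (\<forall>N\<in>?G. submodule N R M \<and> N \<subseteq> T)"
    using J(1) Fs(1) submodule_Int[OF _ T(1)] by auto
  from T(2)[unfolded noetherian_below_def, rule_format, OF this]
  obtain G where G: "G \<in> ?G" "\<forall>G'\<in>?G. G \<subseteq> G' \<longrightarrow> G' = G" ..
  then obtain K where K: "K \<in> F" "I K = J" "G = K \<inter> T" by blast
  have "L = K" if L: "L \<in> F" "K \<subseteq> L" for L
  proof -
    have "I K \<subseteq> I L" unfolding I_def using L(2) by blast
    then have IL: "I L = I K" using J(2)[of "I L"] K(2) L(1) by blast
    have "L \<inter> T \<in> ?G" using L(1) IL K(2) by blast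
    then have LT: "L \<inter> T = K \<inter> T" using G(2) K(3) L(2) by blast
    have "y \<in> K" if y: "y \<in> L" for y
    proof -
      have yM: "y \<in> carrier M" using submodule_carrier[OF Fs(1)[OF L(1)] y] .
      \<comment> \<open>The coefficient \<open>r\<close> of \<open>y\<close> also occurs for some
        \<open>k\<close> in \<open>K\<close>. Then \<open>y - k\<close> lies in \<open>L\<close> and
        in \<open>T\<close>, hence in \<open>K\<close>.\<close>
      obtain r where r: "r \<in> carrier R" "y \<ominus>\<^bsub>M\<^esub> r \<odot>\<^bsub>M\<^esub> a \<in> T" using Fs(2)[OF L(1)] y unfolding adjoin_def by blast
      have raM: "r \<odot>\<^bsub>M\<^esub> a \<in> carrier M" using r a by simp
      have t1: "r \<odot>\<^bsub>M\<^esub> a \<ominus>\<^bsub>M\<^esub> y \<in> T" using diff_sym[OF T(1) yM raM r(2)] .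
      have "r \<odot>\<^bsub>M\<^esub> a \<ominus>\<^bsub>M\<^esub> (r \<odot>\<^bsub>M\<^esub> a \<ominus>\<^bsub>M\<^esub> y) = y"
        using raM yM by (simp add: M.minus_eq M.minus_add M.a_ac minus_add_cancel M.r_neg)
      then have "r \<in> I L" unfolding I_def using r(1) t1 y
        by (intro CollectI conjI bexI[of _ "r \<odot>\<^bsub>M\<^esub> a \<ominus>\<^bsub>M\<^esub> y"]) simp_all
      then have "r \<in> I K" using IL by simp
      then obtain t where t: "t \<in> T" "r \<odot>\<^bsub>M\<^esub> a \<ominus>\<^bsub>M\<^esub> t \<in> K" unfolding I_def by blast
      have tM: "t \<in> carrier M" using TM t by blast
      define k where "k = r \<odot>\<^bsub>M\<^esub> a \<ominus>\<^bsub>M\<^esub> t"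
      have kK: "k \<in> K" using t k_def by simp
      have kM: "k \<in> carrier M" using submodule_carrier[OF Fs(1)[OF K(1)] kK] .
      have "y \<ominus>\<^bsub>M\<^esub> k = (y \<ominus>\<^bsub>M\<^esub> r \<odot>\<^bsub>M\<^esub> a) \<oplus>\<^bsub>M\<^esub> t"
        unfolding k_def using raM yM tM by (simp add: M.minus_eq M.minus_add M.a_ac)
      then have "y \<ominus>\<^bsub>M\<^esub> k \<in> T" using submoduleE(5)[OF T(1) r(2) t(1)] by simp
      moreover have "y \<ominus>\<^bsub>M\<^esub> k \<in> L" using submodule_diff[OF Fs(1)[OF L(1)] y] kK L(2) by blast
      ultimately have "y \<ominus>\<^bsub>M\<^esub> k \<in> K" using LT by blast
      then show ?thesis using diff_cancel_right[OF Fs(1)[OF K(1)] yM kK] by blast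
    qed
    then show ?thesis using L(2) by blast
  qed
  then show "\<exists>N\<in>F. \<forall>K\<in>F. N \<subseteq> K \<longrightarrow> K = N" using K(1) by blast
qed

text \<open>Generators are adjoined one at a time, starting from zero. It is enough that some
  noetherian submodule contains them, since the span lies in every such submodule.\<close>

lemma noetherian_module_if_fin_gen:
  assumes nr: "noetherian_ring R" and fg: "fin_gen_module R M"
  shows noetherian_module
proof -
  obtain A where A: "A \<subseteq> carrier M" "finite A" "carrier M = submodule_span R M A"
    using fg unfolding fin_gen_module_def by blast
  have "\<exists>T. submodule T R M \<and> A \<subseteq> T \<and> noetherian_below T"
    using A(2,1)
  proof (induction A)
    case empty
    have "noetherian_below {\<zero>\<^bsub>M\<^esub>}"
      unfolding noetherian_below_def
    proof (intro allI impI)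
      fix F assume F: "F \<noteq> {} \<and> (\<forall>N\<in>F. submodule N R M \<and> N \<subseteq> {\<zero>\<^bsub>M\<^esub>})"
      then have "N = {\<zero>\<^bsub>M\<^esub>}" if "N \<in> F" for N using submodule_zero that by blast
      then show "\<exists>N\<in>F. \<forall>K\<in>F. N \<subseteq> K \<longrightarrow> K = N" using F by blast
    qed
    then show ?case using zero_submodule by blast
  next
    case (insert a A)
    then obtain T where T: "submodule T R M" "A \<subseteq> T" "noetherian_below T" by auto
    have a: "a \<in> carrier M" using insert by blast
    show ?case
      using adjoin_submodule[OF T(1) a] adjoin_superset[OF T(1) a] in_adjoin_self[OF T(1) a] noetherian_below_adjoin[OF nr T(1,3) a] T(2)
      by (intro exI[of _ "adjoin T a"]) blast
  qed
  then obtain T where T: "submodule T R M" "A \<subseteq> T" "noetherian_below T" by blast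
  have "submodule_span R M A \<subseteq> T" unfolding submodule_span_def using T by blast
  then have "carrier M \<subseteq> T" using A(3) by blast
  then show ?thesis
    using T(3) submoduleE(1) unfolding noetherian_below_def noetherian_module_def by (meson order_trans)
qed

section \<open>Quotient modules\<close>

lemma submodule_abelian_subgroup: "submodule N R M \<Longrightarrow> abelian_subgroup N M"
  by (intro abelian_subgroupI3 additive_subgroup.intro submodule.axioms(1) M.abelian_group_axioms)

lemma coset_eq_iff:
  assumes N: "submodule N R M" and x: "x \<in> carrier M" and y: "y \<in> carrier M"
  shows "N +>\<^bsub>M\<^esub> x = N +>\<^bsub>M\<^esub> y \<longleftrightarrow> x \<ominus>\<^bsub>M\<^esub> y \<in> N"
proof -
  interpret N: abelian_subgroup N M using submodule_abelian_subgroup[OF N] .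
  have "x \<in> N +>\<^bsub>M\<^esub> y \<longleftrightarrow> x \<ominus>\<^bsub>M\<^esub> y \<in> N" using N.a_rcos_module[OF y x] by (simp add: M.minus_eq)
  moreover have "x \<in> N +>\<^bsub>M\<^esub> y \<longleftrightarrow> N +>\<^bsub>M\<^esub> x = N +>\<^bsub>M\<^esub> y"
    using N.a_rcos_self[OF x] M.a_repr_independence[OF _ y N.a_subgroup] by metis
  ultimately show ?thesis by simp
qed

lemma quot_carrier: "carrier (quot_module M N) = (\<lambda>x. N +>\<^bsub>M\<^esub> x) ` carrier M"
  unfolding quot_module_def A_RCOSETS_def' by auto

lemma quot_zero: "\<zero>\<^bsub>quot_module M N\<^esub> = N"
  unfolding quot_module_def by simp

lemma coset_zero_iff:
  assumes N: "submodule N R M" and x: "x \<in> carrier M"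
  shows "N +>\<^bsub>M\<^esub> x = \<zero>\<^bsub>quot_module M N\<^esub> \<longleftrightarrow> x \<in> N"
proof -
  interpret N: abelian_subgroup N M using submodule_abelian_subgroup[OF N] .
  show ?thesis
    using coset_eq_iff[OF N x, of "\<zero>\<^bsub>M\<^esub>"] N.a_rcos_const[OF submodule_zero[OF N]] x
    by (simp add: quot_zero M.minus_eq minus_zero_M)
qed

lemma quot_add:
  assumes N: "submodule N R M" and x: "x \<in> carrier M" and y: "y \<in> carrier M"
  shows "(N +>\<^bsub>M\<^esub> x) \<oplus>\<^bsub>quot_module M N\<^esub> (N +>\<^bsub>M\<^esub> y) = N +>\<^bsub>M\<^esub> (x \<oplus>\<^bsub>M\<^esub> y)"
  using abelian_subgroup.a_rcos_sum[OF submodule_abelian_subgroup[OF N] x y]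
  unfolding quot_module_def by simp

lemma quot_smult:
  assumes N: "submodule N R M" and a: "a \<in> carrier R" and x: "x \<in> carrier M"
  shows "a \<odot>\<^bsub>quot_module M N\<^esub> (N +>\<^bsub>M\<^esub> x) = N +>\<^bsub>M\<^esub> (a \<odot>\<^bsub>M\<^esub> x)"
proof -
  interpret N: abelian_subgroup N M using submodule_abelian_subgroup[OF N] .
  have "N +>\<^bsub>M\<^esub> (a \<odot>\<^bsub>M\<^esub> m) = N +>\<^bsub>M\<^esub> (a \<odot>\<^bsub>M\<^esub> x)" if m: "m \<in> N +>\<^bsub>M\<^esub> x" for m
  proof -
    have mM: "m \<in> carrier M" using N.a_elemrcos_carrier[OF x m] .
    have "m \<ominus>\<^bsub>M\<^esub> x \<in> N" using N.a_rcos_module[OF x mM] m by (simp add: M.minus_eq)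
    then show ?thesis using coset_eq_iff[OF N] diff_smult[OF N mM x a] a x mM by simp
  qed
  then have "(\<Union>m\<in>N +>\<^bsub>M\<^esub> x. N +>\<^bsub>M\<^esub> (a \<odot>\<^bsub>M\<^esub> m)) = N +>\<^bsub>M\<^esub> (a \<odot>\<^bsub>M\<^esub> x)"
    using N.a_rcos_self[OF x] by blast
  then show ?thesis unfolding quot_module_def by simp
qed

lemma quot_module_module:
  assumes N: "submodule N R M" shows "module R (quot_module M N)"
proof (rule moduleI)
  interpret N: abelian_subgroup N M using submodule_abelian_subgroup[OF N] .
  show "cring R" by (rule R.is_cring)
  have z: "\<zero>\<^bsub>quot_module M N\<^esub> = N +>\<^bsub>M\<^esub> \<zero>\<^bsub>M\<^esub>"
    using coset_zero_iff[OF N M.zero_closed] submodule_zero[OF N] by simp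
  have inv: "\<exists>Y\<in>carrier (quot_module M N). Y \<oplus>\<^bsub>quot_module M N\<^esub> X = \<zero>\<^bsub>quot_module M N\<^esub>"
    if X: "X \<in> carrier (quot_module M N)" for X
  proof -
    obtain x where x: "x \<in> carrier M" "X = N +>\<^bsub>M\<^esub> x" using X unfolding quot_carrier by blast
    then have "(N +>\<^bsub>M\<^esub> (\<ominus>\<^bsub>M\<^esub> x)) \<oplus>\<^bsub>quot_module M N\<^esub> X = \<zero>\<^bsub>quot_module M N\<^esub>"
      by (simp add: quot_add[OF N] M.l_neg z)
    then show ?thesis using x(1) unfolding quot_carrier by (intro bexI[of _ "N +>\<^bsub>M\<^esub> (\<ominus>\<^bsub>M\<^esub> x)"]) auto
  qed
  show "abelian_group (quot_module M N)"
  proof (rule abelian_groupI, goal_cases)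
    case (6 X)
    then show ?case using inv by blast
  qed (auto simp: quot_carrier quot_add[OF N] z M.a_ac)
qed (auto simp: quot_carrier quot_smult[OF N] quot_add[OF N] smult_l_distr smult_r_distr smult_assoc1)

lemma ideal_smult_eq_add_multiples_list:
  assumes fs: "set fs \<subseteq> carrier R"
  shows "ideal_smult R (Idl (set fs)) M = add_multiples_list {\<zero>\<^bsub>M\<^esub>} fs"
proof
  let ?P = "{a \<odot>\<^bsub>M\<^esub> m |a m. a \<in> Idl (set fs) \<and> m \<in> carrier M}"
  have "?P \<subseteq> add_multiples_list {\<zero>\<^bsub>M\<^esub>} fs" using genideal_smult_in_add_multiples_list[OF zero_submodule fs] by blast
  then show "ideal_smult R (Idl (set fs)) M \<subseteq> add_multiples_list {\<zero>\<^bsub>M\<^esub>} fs"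
    unfolding ideal_smult_def submodule_span_def using add_multiples_list_submodule[OF zero_submodule fs] by blast
  have "add_multiples_list {\<zero>\<^bsub>M\<^esub>} fs \<subseteq> K" if K: "submodule K R M" "?P \<subseteq> K" for K
  proof (rule add_multiples_list_minimal[OF zero_submodule K(1) _ fs])
    show "{\<zero>\<^bsub>M\<^esub>} \<subseteq> K" using submodule_zero[OF K(1)] by blast
    show "f \<odot>\<^bsub>M\<^esub> x \<in> K" if "f \<in> set fs" "x \<in> carrier M" for f x
      using K(2) that R.genideal_self[OF fs] by blast
  qed
  then show "add_multiples_list {\<zero>\<^bsub>M\<^esub>} fs \<subseteq> ideal_smult R (Idl (set fs)) M"
    unfolding ideal_smult_def submodule_span_def by blast
qed

lemma quot_seq_eq: "set fs \<subseteq> carrier R \<Longrightarrow> quot_seq R M fs = quot_module M (add_multiples_list {\<zero>\<^bsub>M\<^esub>} fs)"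
  unfolding quot_seq_def by (simp add: ideal_smult_eq_add_multiples_list)

text \<open>For \<open>S = {1}\<close> saturation does nothing, so the localized notions also
  describe regularity over the given ring. The same results can therefore be applied to the module
  over \<open>R_p\<close>.\<close>

lemma inj_on_quot_iff:
  assumes N: "submodule N R M" and f: "f \<in> carrier R"
  shows "inj_on (\<lambda>x. f \<odot>\<^bsub>quot_module M N\<^esub> x) (carrier (quot_module M N)) \<longleftrightarrow> nonzerodivisor {\<one>} N f"
    (is "?I \<longleftrightarrow> _")
proof -
  have "?I \<longleftrightarrow> (\<forall>x\<in>carrier M. \<forall>y\<in>carrier M. f \<odot>\<^bsub>M\<^esub> (x \<ominus>\<^bsub>M\<^esub> y) \<in> N \<longrightarrow> x \<ominus>\<^bsub>M\<^esub> y \<in> N)"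
    using f by (auto simp: inj_on_def quot_carrier quot_smult[OF N] coset_eq_iff[OF N] smult_r_diff)
  also have "\<dots> \<longleftrightarrow> (\<forall>x\<in>carrier M. f \<odot>\<^bsub>M\<^esub> x \<in> N \<longrightarrow> x \<in> N)"
  proof
    assume *: "\<forall>x\<in>carrier M. \<forall>y\<in>carrier M. f \<odot>\<^bsub>M\<^esub> (x \<ominus>\<^bsub>M\<^esub> y) \<in> N \<longrightarrow> x \<ominus>\<^bsub>M\<^esub> y \<in> N"
    show "\<forall>x\<in>carrier M. f \<odot>\<^bsub>M\<^esub> x \<in> N \<longrightarrow> x \<in> N"
    proof (intro ballI impI)
      fix x assume x: "x \<in> carrier M" "f \<odot>\<^bsub>M\<^esub> x \<in> N"
      have "x \<ominus>\<^bsub>M\<^esub> \<zero>\<^bsub>M\<^esub> = x" using x by (simp add: M.minus_eq minus_zero_M)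
      then show "x \<in> N" using *[rule_format, of x "\<zero>\<^bsub>M\<^esub>"] x by simp
    qed
  qed auto
  also have "\<dots> \<longleftrightarrow> nonzerodivisor {\<one>} N f" by (simp add: nonzerodivisor_def sat_one[OF N])
  finally show ?thesis .
qed

lemma regular_at_iff_nth: "regular_at S N fs \<longleftrightarrow> (\<forall>i < length fs. nonzerodivisor S (add_multiples_list N (take i fs)) (fs ! i))"
proof (induction fs arbitrary: N)
  case (Cons f fs)
  show ?case unfolding regular_at.simps Cons.IH by (auto simp: less_Suc_eq_0_disj nth_Cons split: nat.splits)
qed simp

lemma strongly_regular_seq_iff:
  assumes "set fs \<subseteq> carrier R"
  shows "strongly_regular_seq R M fs \<longleftrightarrow> regular_at {\<one>} {\<zero>\<^bsub>M\<^esub>} fs"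
proof -
  have "inj_on (\<lambda>x. (fs ! i) \<odot>\<^bsub>quot_seq R M (take i fs)\<^esub> x) (carrier (quot_seq R M (take i fs)))
      \<longleftrightarrow> nonzerodivisor {\<one>} (add_multiples_list {\<zero>\<^bsub>M\<^esub>} (take i fs)) (fs ! i)" if i: "i < length fs" for i
  proof -
    have t: "set (take i fs) \<subseteq> carrier R" by (rule order_trans[OF set_take_subset assms])
    have "fs ! i \<in> carrier R" using assms nth_mem[OF i] by (rule subsetD)
    then show ?thesis
      unfolding quot_seq_eq[OF t] by (rule inj_on_quot_iff[OF add_multiples_list_submodule[OF zero_submodule t]])
  qed
  then show ?thesis unfolding strongly_regular_seq_def regular_at_iff_nth using assms by simp
qed

lemma Ass_quot_module:
  assumes N: "submodule N R M" shows "Ass R (quot_module M N) = assoc_primes N"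
proof -
  have "annihilator R (quot_module M N) (N +>\<^bsub>M\<^esub> x) = colon N x" if x: "x \<in> carrier M" for x
    unfolding annihilator_def colon_def
    by (rule Collect_cong) (use x in \<open>simp add: quot_smult[OF N] coset_zero_iff[OF N] cong: conj_cong\<close>)
  then show ?thesis unfolding Ass_def assoc_primes_def by (auto simp: quot_carrier)
qed

section \<open>Localization\<close>

lemma mod_loc_rel_iff:
  "((m, s), (n, t)) \<in> mod_loc_rel R S M \<longleftrightarrow> m \<in> carrier M \<and> n \<in> carrier M \<and> s \<in> S \<and> t \<in> S \<and>
    (\<exists>u\<in>S. u \<odot>\<^bsub>M\<^esub> (t \<odot>\<^bsub>M\<^esub> m) = u \<odot>\<^bsub>M\<^esub> (s \<odot>\<^bsub>M\<^esub> n))"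
  unfolding mod_loc_rel_def by simp

lemma mod_loc_rel_equiv:
  assumes S: "mult_set S"
  shows "equiv (carrier M \<times> S) (mod_loc_rel R S M)"
proof (rule equivI)
  show "mod_loc_rel R S M \<subseteq> (carrier M \<times> S) \<times> carrier M \<times> S" unfolding mod_loc_rel_def by auto
  show "refl_on (carrier M \<times> S) (mod_loc_rel R S M)"
    by (rule refl_onI) (use mult_setD(2)[OF S] in \<open>auto simp: mod_loc_rel_iff\<close>)
  show "sym (mod_loc_rel R S M)"
    by (rule symI) (auto simp: mod_loc_rel_def intro: sym)
  show "trans (mod_loc_rel R S M)"
  proof (rule transI)
    fix X Y Z assume "(X, Y) \<in> mod_loc_rel R S M" "(Y, Z) \<in> mod_loc_rel R S M"
    moreover obtain m s n t k w where XYZ: "X = (m, s)" "Y = (n, t)" "Z = (k, w)" by (cases X, cases Y, cases Z)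
    ultimately have c: "m \<in> carrier M" "n \<in> carrier M" "k \<in> carrier M" "s \<in> S" "t \<in> S" "w \<in> S"
      and "\<exists>u\<in>S. u \<odot>\<^bsub>M\<^esub> (t \<odot>\<^bsub>M\<^esub> m) = u \<odot>\<^bsub>M\<^esub> (s \<odot>\<^bsub>M\<^esub> n)"
      and "\<exists>v\<in>S. v \<odot>\<^bsub>M\<^esub> (w \<odot>\<^bsub>M\<^esub> n) = v \<odot>\<^bsub>M\<^esub> (t \<odot>\<^bsub>M\<^esub> k)"
      by (auto simp: mod_loc_rel_iff)
    then obtain u v where u: "u \<in> S" "u \<odot>\<^bsub>M\<^esub> (t \<odot>\<^bsub>M\<^esub> m) = u \<odot>\<^bsub>M\<^esub> (s \<odot>\<^bsub>M\<^esub> n)"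
      and v: "v \<in> S" "v \<odot>\<^bsub>M\<^esub> (w \<odot>\<^bsub>M\<^esub> n) = v \<odot>\<^bsub>M\<^esub> (t \<odot>\<^bsub>M\<^esub> k)" by blast
    have R: "s \<in> carrier R" "t \<in> carrier R" "w \<in> carrier R" "u \<in> carrier R" "v \<in> carrier R"
      using mult_setD(1)[OF S] c u v by auto
    \<comment> \<open>The common witness contains the middle denominator \<open>t\<close>, which is
      needed to eliminate the middle numerator \<open>n\<close>.\<close>
    have "(u \<otimes> v \<otimes> t) \<odot>\<^bsub>M\<^esub> (w \<odot>\<^bsub>M\<^esub> m) = (v \<otimes> w) \<odot>\<^bsub>M\<^esub> (u \<odot>\<^bsub>M\<^esub> (t \<odot>\<^bsub>M\<^esub> m))"
      using R c by (simp add: smult_assoc1 smult_lcomm)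
    also have "\<dots> = (u \<otimes> s) \<odot>\<^bsub>M\<^esub> (v \<odot>\<^bsub>M\<^esub> (w \<odot>\<^bsub>M\<^esub> n))"
      unfolding u(2) using R c by (simp add: smult_assoc1 smult_lcomm)
    also have "\<dots> = (u \<otimes> v \<otimes> t) \<odot>\<^bsub>M\<^esub> (s \<odot>\<^bsub>M\<^esub> k)"
      unfolding v(2) using R c by (simp add: smult_assoc1 smult_lcomm)
    finally show "(X, Z) \<in> mod_loc_rel R S M"
      unfolding XYZ mod_loc_rel_iff using c mult_setD(3)[OF S] u v by blast
  qed
qed

lemma mod_frac_eq_iff:
  assumes S: "mult_set S" and "m \<in> carrier M" "s \<in> S" "n \<in> carrier M" "t \<in> S"
  shows "mod_frac R S M m s = mod_frac R S M n t \<longleftrightarrow>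
    (\<exists>u\<in>S. u \<odot>\<^bsub>M\<^esub> (t \<odot>\<^bsub>M\<^esub> m) = u \<odot>\<^bsub>M\<^esub> (s \<odot>\<^bsub>M\<^esub> n))"
  unfolding mod_frac_def using assms
  by (subst eq_equiv_class_iff[OF mod_loc_rel_equiv[OF S]]) (auto simp: mod_loc_rel_iff)

lemma mod_frac_eqI:
  assumes S: "mult_set S" and "m \<in> carrier M" "s \<in> S" "n \<in> carrier M" "t \<in> S"
    and "t \<odot>\<^bsub>M\<^esub> m = s \<odot>\<^bsub>M\<^esub> n"
  shows "mod_frac R S M m s = mod_frac R S M n t"
  using assms mult_setD(2)[OF S] by (subst mod_frac_eq_iff[OF S]) auto

lemma mod_loc_carrier: "carrier (mod_loc R S M) = {mod_frac R S M m s | m s. m \<in> carrier M \<and> s \<in> S}"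
  unfolding mod_loc_def mod_frac_def quotient_def by auto

lemma in_mod_frac:
  assumes S: "mult_set S" and "m \<in> carrier M" "s \<in> S"
  shows "(n, t) \<in> mod_frac R S M m s \<longleftrightarrow> n \<in> carrier M \<and> t \<in> S \<and> mod_frac R S M n t = mod_frac R S M m s"
proof -
  have "(n, t) \<in> mod_frac R S M m s \<longleftrightarrow> n \<in> carrier M \<and> t \<in> S \<and> mod_frac R S M m s = mod_frac R S M n t"
    using mod_frac_eq_iff[OF assms] assms unfolding mod_frac_def by (auto simp: mod_loc_rel_iff)
  then show ?thesis by metis
qed

text \<open>Operations on fractions are unions over all representatives; such a union collapses once
  the value does not depend on the representative.\<close>

lemma UN_frac_eq:
  assumes "(m, s) \<in> X" "\<And>n t. (n, t) \<in> X \<Longrightarrow> f n t = f m s"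
  shows "(\<Union>(n, t)\<in>X. f n t) = f m s"
  using assms by fast

lemma mod_loc_add:
  assumes S: "mult_set S" and m: "m \<in> carrier M" and s: "s \<in> S" and n: "n \<in> carrier M" and t: "t \<in> S"
  shows "mod_frac R S M m s \<oplus>\<^bsub>mod_loc R S M\<^esub> mod_frac R S M n t
    = mod_frac R S M (t \<odot>\<^bsub>M\<^esub> m \<oplus>\<^bsub>M\<^esub> s \<odot>\<^bsub>M\<^esub> n) (s \<otimes> t)"
proof -
  let ?f = "\<lambda>m s n t. mod_frac R S M (t \<odot>\<^bsub>M\<^esub> m \<oplus>\<^bsub>M\<^esub> s \<odot>\<^bsub>M\<^esub> n) (s \<otimes> t)"
  have SR: "\<And>u. u \<in> S \<Longrightarrow> u \<in> carrier R" using mult_setD(1)[OF S] .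
  have cong: "?f m' s' n' t' = ?f m s n t"
    if mm: "(m', s') \<in> mod_frac R S M m s" and nn: "(n', t') \<in> mod_frac R S M n t" for m' s' n' t'
  proof -
    have m': "m' \<in> carrier M" "s' \<in> S" and n': "n' \<in> carrier M" "t' \<in> S"
      and em: "mod_frac R S M m' s' = mod_frac R S M m s" and en: "mod_frac R S M n' t' = mod_frac R S M n t"
      using mm nn in_mod_frac[OF S] m s n t by auto
    obtain u where u: "u \<in> S" "u \<odot>\<^bsub>M\<^esub> (s \<odot>\<^bsub>M\<^esub> m') = u \<odot>\<^bsub>M\<^esub> (s' \<odot>\<^bsub>M\<^esub> m)"
      using em mod_frac_eq_iff[OF S m' m s] by blast
    obtain v where v: "v \<in> S" "v \<odot>\<^bsub>M\<^esub> (t \<odot>\<^bsub>M\<^esub> n') = v \<odot>\<^bsub>M\<^esub> (t' \<odot>\<^bsub>M\<^esub> n)"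
      using en mod_frac_eq_iff[OF S n' n t] by blast
    note R = SR[OF s] SR[OF t] SR[OF m'(2)] SR[OF n'(2)] SR[OF u(1)] SR[OF v(1)]
    have "(u \<otimes> v) \<odot>\<^bsub>M\<^esub> ((s \<otimes> t) \<odot>\<^bsub>M\<^esub> (t' \<odot>\<^bsub>M\<^esub> m' \<oplus>\<^bsub>M\<^esub> s' \<odot>\<^bsub>M\<^esub> n'))
       = (v \<otimes> t \<otimes> t') \<odot>\<^bsub>M\<^esub> (u \<odot>\<^bsub>M\<^esub> (s \<odot>\<^bsub>M\<^esub> m')) \<oplus>\<^bsub>M\<^esub> (u \<otimes> s \<otimes> s') \<odot>\<^bsub>M\<^esub> (v \<odot>\<^bsub>M\<^esub> (t \<odot>\<^bsub>M\<^esub> n'))"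
      using R m' n' by (simp add: smult_assoc1 smult_lcomm smult_r_distr)
    also have "\<dots> = (v \<otimes> t \<otimes> t') \<odot>\<^bsub>M\<^esub> (u \<odot>\<^bsub>M\<^esub> (s' \<odot>\<^bsub>M\<^esub> m)) \<oplus>\<^bsub>M\<^esub> (u \<otimes> s \<otimes> s') \<odot>\<^bsub>M\<^esub> (v \<odot>\<^bsub>M\<^esub> (t' \<odot>\<^bsub>M\<^esub> n))"
      by (simp only: u(2) v(2))
    also have "\<dots> = (u \<otimes> v) \<odot>\<^bsub>M\<^esub> ((s' \<otimes> t') \<odot>\<^bsub>M\<^esub> (t \<odot>\<^bsub>M\<^esub> m \<oplus>\<^bsub>M\<^esub> s \<odot>\<^bsub>M\<^esub> n))"
      using R m n by (simp add: smult_assoc1 smult_lcomm smult_r_distr)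
    finally show ?thesis
      using m' n' m n s t R mult_setD(3)[OF S] u(1) v(1)
      by (subst mod_frac_eq_iff[OF S]) auto
  qed
  have self: "(m, s) \<in> mod_frac R S M m s" "(n, t) \<in> mod_frac R S M n t"
    using in_mod_frac[OF S] m s n t by auto
  have "(\<Union>(n', t')\<in>mod_frac R S M n t. ?f m' s' n' t') = ?f m s n t" if "(m', s') \<in> mod_frac R S M m s" for m' s'
    using UN_frac_eq[OF self(2), of "?f m' s'"] cong[OF that] self(2) by simp
  then have "(\<Union>(m', s')\<in>mod_frac R S M m s. \<Union>(n', t')\<in>mod_frac R S M n t. ?f m' s' n' t') = ?f m s n t"
    using UN_frac_eq[OF self(1), of "\<lambda>m' s'. \<Union>(n', t')\<in>mod_frac R S M n t. ?f m' s' n' t'"] self(1) by simp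
  then show ?thesis unfolding mod_loc_def by simp
qed

lemma mod_loc_abelian_group:
  assumes S: "mult_set S"
  shows "abelian_group (mod_loc R S M)"
proof -
  note SR = mult_setD(1)[OF S] and Sm = mult_setD(3)[OF S] and S1 = mult_setD(2)[OF S]
  note add = mod_loc_add[OF S]
  have z: "\<zero>\<^bsub>mod_loc R S M\<^esub> = mod_frac R S M \<zero>\<^bsub>M\<^esub> \<one>" unfolding mod_loc_def by simp
  show ?thesis
  proof (rule abelian_groupI)
    fix X Y assume X: "X \<in> carrier (mod_loc R S M)" and Y: "Y \<in> carrier (mod_loc R S M)"
    obtain m s where m: "m \<in> carrier M" "s \<in> S" "X = mod_frac R S M m s" using X unfolding mod_loc_carrier by blast
    obtain n t where n: "n \<in> carrier M" "t \<in> S" "Y = mod_frac R S M n t" using Y unfolding mod_loc_carrier by blast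
    have R: "s \<in> carrier R" "t \<in> carrier R" using SR m n by auto
    have "t \<odot>\<^bsub>M\<^esub> m \<oplus>\<^bsub>M\<^esub> s \<odot>\<^bsub>M\<^esub> n \<in> carrier M" using m n R by simp
    then show "X \<oplus>\<^bsub>mod_loc R S M\<^esub> Y \<in> carrier (mod_loc R S M)"
      unfolding m(3) n(3) add[OF m(1,2) n(1,2)] mod_loc_carrier using Sm[OF m(2) n(2)] by blast
    show "X \<oplus>\<^bsub>mod_loc R S M\<^esub> Y = Y \<oplus>\<^bsub>mod_loc R S M\<^esub> X"
      unfolding m(3) n(3) add[OF m(1,2) n(1,2)] add[OF n(1,2) m(1,2)] using R m n
      by (simp add: M.a_comm R.m_comm)
    fix Z assume Z: "Z \<in> carrier (mod_loc R S M)"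
    obtain k w where k: "k \<in> carrier M" "w \<in> S" "Z = mod_frac R S M k w" using Z unfolding mod_loc_carrier by blast
    have w: "w \<in> carrier R" using SR k by auto
    show "X \<oplus>\<^bsub>mod_loc R S M\<^esub> Y \<oplus>\<^bsub>mod_loc R S M\<^esub> Z = X \<oplus>\<^bsub>mod_loc R S M\<^esub> (Y \<oplus>\<^bsub>mod_loc R S M\<^esub> Z)"
      unfolding m(3) n(3) k(3) using m(1,2) n(1,2) k(1,2) R w Sm
      by (simp add: add smult_assoc1 smult_lcomm smult_r_distr M.a_assoc R.m_assoc)
  next
    show "\<zero>\<^bsub>mod_loc R S M\<^esub> \<in> carrier (mod_loc R S M)" unfolding z mod_loc_carrier using S1 by blast
  next
    fix X assume X: "X \<in> carrier (mod_loc R S M)"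
    obtain m s where m: "m \<in> carrier M" "s \<in> S" "X = mod_frac R S M m s" using X unfolding mod_loc_carrier by blast
    have R: "s \<in> carrier R" using SR m by auto
    show "\<zero>\<^bsub>mod_loc R S M\<^esub> \<oplus>\<^bsub>mod_loc R S M\<^esub> X = X"
      unfolding z m(3) using m(1,2) R S1 by (simp add: add)
    have "mod_frac R S M (\<ominus>\<^bsub>M\<^esub> m) s \<oplus>\<^bsub>mod_loc R S M\<^esub> X = mod_frac R S M (s \<odot>\<^bsub>M\<^esub> (\<ominus>\<^bsub>M\<^esub> m) \<oplus>\<^bsub>M\<^esub> s \<odot>\<^bsub>M\<^esub> m) (s \<otimes> s)"
      unfolding m(3) using m(1,2) by (simp add: add)
    also have "\<dots> = \<zero>\<^bsub>mod_loc R S M\<^esub>"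
      unfolding z using m(1,2) R S1 Sm
      by (intro mod_frac_eqI[OF S]) (auto simp: smult_r_minus M.l_neg)
    finally have *: "mod_frac R S M (\<ominus>\<^bsub>M\<^esub> m) s \<oplus>\<^bsub>mod_loc R S M\<^esub> X = \<zero>\<^bsub>mod_loc R S M\<^esub>" .
    have "mod_frac R S M (\<ominus>\<^bsub>M\<^esub> m) s \<in> carrier (mod_loc R S M)"
      unfolding mod_loc_carrier using m(1,2) by auto
    then show "\<exists>Y\<in>carrier (mod_loc R S M). Y \<oplus>\<^bsub>mod_loc R S M\<^esub> X = \<zero>\<^bsub>mod_loc R S M\<^esub>" using * by blast
  qed
qed

lemma mod_loc_smult:
  assumes S: "mult_set S" and a: "a \<in> carrier R" and s: "s \<in> S" and m: "m \<in> carrier M" and t: "t \<in> S"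
  shows "ring_frac R S a s \<odot>\<^bsub>mod_loc R S M\<^esub> mod_frac R S M m t = mod_frac R S M (a \<odot>\<^bsub>M\<^esub> m) (s \<otimes> t)"
proof -
  let ?f = "\<lambda>a s m t. mod_frac R S M (a \<odot>\<^bsub>M\<^esub> m) (s \<otimes> t)"
  have SR: "\<And>u. u \<in> S \<Longrightarrow> u \<in> carrier R" using mult_setD(1)[OF S] .
  have cong: "?f a' s' m' t' = ?f a s m t"
    if aa: "(a', s') \<in> ring_frac R S a s" and mm: "(m', t') \<in> mod_frac R S M m t" for a' s' m' t'
  proof -
    obtain u where a': "a' \<in> carrier R" "s' \<in> S" and u: "u \<in> S" "u \<otimes> (s' \<otimes> a) = u \<otimes> (s \<otimes> a')"
      using aa unfolding ring_frac_def ring_loc_rel_def by auto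
    obtain v where m': "m' \<in> carrier M" "t' \<in> S" and v: "v \<in> S" "v \<odot>\<^bsub>M\<^esub> (t' \<odot>\<^bsub>M\<^esub> m) = v \<odot>\<^bsub>M\<^esub> (t \<odot>\<^bsub>M\<^esub> m')"
      using mm unfolding mod_frac_def mod_loc_rel_def by auto
    note R = SR[OF s] SR[OF t] SR[OF a'(2)] SR[OF m'(2)] SR[OF u(1)] SR[OF v(1)]
    have "(u \<otimes> v) \<odot>\<^bsub>M\<^esub> ((s \<otimes> t) \<odot>\<^bsub>M\<^esub> (a' \<odot>\<^bsub>M\<^esub> m')) = (u \<otimes> (s \<otimes> a')) \<odot>\<^bsub>M\<^esub> (v \<odot>\<^bsub>M\<^esub> (t \<odot>\<^bsub>M\<^esub> m'))"
      using R a' m' by (simp add: smult_assoc1 smult_lcomm)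
    also have "\<dots> = (u \<otimes> (s' \<otimes> a)) \<odot>\<^bsub>M\<^esub> (v \<odot>\<^bsub>M\<^esub> (t' \<odot>\<^bsub>M\<^esub> m))"
      by (simp only: u(2) v(2))
    also have "\<dots> = (u \<otimes> v) \<odot>\<^bsub>M\<^esub> ((s' \<otimes> t') \<odot>\<^bsub>M\<^esub> (a \<odot>\<^bsub>M\<^esub> m))"
      using R a m by (simp add: smult_assoc1 smult_lcomm)
    finally show ?thesis
      using a' m' a m s t R mult_setD(3)[OF S] u(1) v(1)
      by (subst mod_frac_eq_iff[OF S]) auto
  qed
  have self: "(a, s) \<in> ring_frac R S a s" "(m, t) \<in> mod_frac R S M m t"
    using in_mod_frac[OF S] m s a t mult_setD(2)[OF S] by (auto simp: ring_frac_def ring_loc_rel_def)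
  have "(\<Union>(m', t')\<in>mod_frac R S M m t. ?f a' s' m' t') = ?f a s m t" if "(a', s') \<in> ring_frac R S a s" for a' s'
    using UN_frac_eq[OF self(2), of "?f a' s'"] cong[OF that] self(2) by simp
  then have "(\<Union>(a', s')\<in>ring_frac R S a s. \<Union>(m', t')\<in>mod_frac R S M m t. ?f a' s' m' t') = ?f a s m t"
    using UN_frac_eq[OF self(1), of "\<lambda>a' s'. \<Union>(m', t')\<in>mod_frac R S M m t. ?f a' s' m' t'"] self(1) by simp
  then show ?thesis unfolding mod_loc_def by simp
qed

end

text \<open>
  \<open>ring_loc\<close> is \<open>mod_loc\<close> of \<open>R\<close> as a module over itself, with scalar multiplication as ring multiplication.
\<close>

definition self_module :: "('a, 'c) ring_scheme \<Rightarrow> ('a, 'a) module"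
  where "self_module R = \<lparr>carrier = carrier R, mult = mult R, one = one R, zero = zero R, add = add R, smult = mult R\<rparr>"

lemma self_module_simps [simp]:
  "carrier (self_module R) = carrier R" "zero (self_module R) = zero R" "add (self_module R) = add R"
  "smult (self_module R) = mult R"
  unfolding self_module_def by simp_all

lemma (in cring) self_module: "module R (self_module R)"
proof (rule moduleI)
  show "abelian_group (self_module R)"
  proof (rule abelian_groupI, goal_cases)
    case (6 x)
    then show ?case by (intro bexI[of _ "\<ominus> x"]) (simp_all add: l_neg)
  qed (simp_all add: a_ac)
qed (auto simp: is_cring l_distr r_distr m_assoc)

lemma ring_frac_eq_mod_frac: "ring_frac R S = mod_frac R S (self_module R)"
  by (intro ext) (simp add: ring_frac_def mod_frac_def ring_loc_rel_def mod_loc_rel_def)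

lemma ring_loc_mod_loc:
  "carrier (ring_loc R S) = carrier (mod_loc R S (self_module R))"
  "zero (ring_loc R S) = zero (mod_loc R S (self_module R))"
  "add (ring_loc R S) = add (mod_loc R S (self_module R))"
  "mult (ring_loc R S) = smult (mod_loc R S (self_module R))"
  by (simp_all add: ring_loc_def mod_loc_def ring_frac_eq_mod_frac ring_loc_rel_def mod_loc_rel_def)

context module begin

section \<open>The localized ring and its action\<close>

lemma ring_frac_eq_iff:
  assumes "mult_set S" "a \<in> carrier R" "s \<in> S" "b \<in> carrier R" "t \<in> S"
  shows "ring_frac R S a s = ring_frac R S b t \<longleftrightarrow> (\<exists>u\<in>S. u \<otimes> (t \<otimes> a) = u \<otimes> (s \<otimes> b))"
proof -
  interpret self: module R "self_module R" by (rule R.self_module)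
  show ?thesis unfolding ring_frac_eq_mod_frac using self.mod_frac_eq_iff[of S a s b t] assms
    by (simp add: self.mult_set_def mult_set_def)
qed

lemma ring_frac_eqI:
  assumes "mult_set S" "a \<in> carrier R" "s \<in> S" "b \<in> carrier R" "t \<in> S" "t \<otimes> a = s \<otimes> b"
  shows "ring_frac R S a s = ring_frac R S b t"
  using assms mult_setD(2)[OF assms(1)] by (subst ring_frac_eq_iff) auto

lemma ring_loc_carrier: "carrier (ring_loc R S) = {ring_frac R S a s | a s. a \<in> carrier R \<and> s \<in> S}"
proof -
  interpret self: module R "self_module R" by (rule R.self_module)
  show ?thesis unfolding ring_loc_mod_loc ring_frac_eq_mod_frac self.mod_loc_carrier by simp
qed

lemma ring_loc_ops:
  assumes S: "mult_set S" and a: "a \<in> carrier R" and s: "s \<in> S" and b: "b \<in> carrier R" and t: "t \<in> S"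
  shows "ring_frac R S a s \<oplus>\<^bsub>ring_loc R S\<^esub> ring_frac R S b t = ring_frac R S (t \<otimes> a \<oplus> s \<otimes> b) (s \<otimes> t)"
    and "ring_frac R S a s \<otimes>\<^bsub>ring_loc R S\<^esub> ring_frac R S b t = ring_frac R S (a \<otimes> b) (s \<otimes> t)"
proof -
  interpret self: module R "self_module R" by (rule R.self_module)
  have S': "self.mult_set S" using S by (simp add: self.mult_set_def mult_set_def)
  show "ring_frac R S a s \<oplus>\<^bsub>ring_loc R S\<^esub> ring_frac R S b t = ring_frac R S (t \<otimes> a \<oplus> s \<otimes> b) (s \<otimes> t)"
    using self.mod_loc_add[OF S', of a s b t] a s b t unfolding ring_loc_mod_loc ring_frac_eq_mod_frac by simp
  show "ring_frac R S a s \<otimes>\<^bsub>ring_loc R S\<^esub> ring_frac R S b t = ring_frac R S (a \<otimes> b) (s \<otimes> t)"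
    using self.mod_loc_smult[OF S', of a s b t] a s b t unfolding ring_loc_mod_loc ring_frac_eq_mod_frac by simp
qed

lemma ring_loc_one: "\<one>\<^bsub>ring_loc R S\<^esub> = ring_frac R S \<one> \<one>"
  unfolding ring_loc_def by simp

lemma ring_loc_cring:
  assumes S: "mult_set S" shows "cring (ring_loc R S)"
proof (rule cringI)
  interpret self: module R "self_module R" by (rule R.self_module)
  have S': "self.mult_set S" using S by (simp add: self.mult_set_def mult_set_def)
  note SR = mult_setD(1)[OF S] and Sm = mult_setD(3)[OF S] and S1 = mult_setD(2)[OF S]
  note ops = ring_loc_ops[OF S]
  interpret L: abelian_group "mod_loc R S (self_module R)" by (rule self.mod_loc_abelian_group[OF S'])
  show "abelian_group (ring_loc R S)"
  proof (rule abelian_groupI, goal_cases)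
    case (6 X)
    then show ?case unfolding ring_loc_mod_loc using L.l_neg L.a_inv_closed by blast
  qed (simp_all add: ring_loc_mod_loc L.a_ac)
  show "Group.comm_monoid (ring_loc R S)"
  proof (rule comm_monoidI)
    fix X Y assume X: "X \<in> carrier (ring_loc R S)" and Y: "Y \<in> carrier (ring_loc R S)"
    obtain a s where a: "a \<in> carrier R" "s \<in> S" "X = ring_frac R S a s" using X unfolding ring_loc_carrier by blast
    obtain b t where b: "b \<in> carrier R" "t \<in> S" "Y = ring_frac R S b t" using Y unfolding ring_loc_carrier by blast
    have R: "s \<in> carrier R" "t \<in> carrier R" using SR a b by auto
    have "a \<otimes> b \<in> carrier R" using a b by simp
    then show "X \<otimes>\<^bsub>ring_loc R S\<^esub> Y \<in> carrier (ring_loc R S)"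
      unfolding a(3) b(3) ops(2)[OF a(1,2) b(1,2)] ring_loc_carrier using Sm[OF a(2) b(2)] by blast
    show "X \<otimes>\<^bsub>ring_loc R S\<^esub> Y = Y \<otimes>\<^bsub>ring_loc R S\<^esub> X"
      unfolding a(3) b(3) ops(2)[OF a(1,2) b(1,2)] ops(2)[OF b(1,2) a(1,2)] using R a(1) b(1) by (simp add: R.m_comm)
    fix Z assume Z: "Z \<in> carrier (ring_loc R S)"
    obtain c w where c: "c \<in> carrier R" "w \<in> S" "Z = ring_frac R S c w" using Z unfolding ring_loc_carrier by blast
    have w: "w \<in> carrier R" using SR c by auto
    show "X \<otimes>\<^bsub>ring_loc R S\<^esub> Y \<otimes>\<^bsub>ring_loc R S\<^esub> Z = X \<otimes>\<^bsub>ring_loc R S\<^esub> (Y \<otimes>\<^bsub>ring_loc R S\<^esub> Z)"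
      unfolding a(3) b(3) c(3) using a(1,2) b(1,2) c(1,2) R w Sm by (simp add: ops R.m_assoc)
  next
    show "\<one>\<^bsub>ring_loc R S\<^esub> \<in> carrier (ring_loc R S)" unfolding ring_loc_one ring_loc_carrier using S1 by blast
  next
    fix X assume X: "X \<in> carrier (ring_loc R S)"
    obtain a s where a: "a \<in> carrier R" "s \<in> S" "X = ring_frac R S a s" using X unfolding ring_loc_carrier by blast
    show "\<one>\<^bsub>ring_loc R S\<^esub> \<otimes>\<^bsub>ring_loc R S\<^esub> X = X"
      unfolding a(3) ring_loc_one using a(1,2) SR S1 by (simp add: ops)
  qed
  fix X Y Z assume X: "X \<in> carrier (ring_loc R S)" and Y: "Y \<in> carrier (ring_loc R S)" and Z: "Z \<in> carrier (ring_loc R S)"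
  obtain a s where a: "a \<in> carrier R" "s \<in> S" "X = ring_frac R S a s" using X unfolding ring_loc_carrier by blast
  obtain b t where b: "b \<in> carrier R" "t \<in> S" "Y = ring_frac R S b t" using Y unfolding ring_loc_carrier by blast
  obtain c w where c: "c \<in> carrier R" "w \<in> S" "Z = ring_frac R S c w" using Z unfolding ring_loc_carrier by blast
  have R: "s \<in> carrier R" "t \<in> carrier R" "w \<in> carrier R" using SR a b c by auto
  show "(X \<oplus>\<^bsub>ring_loc R S\<^esub> Y) \<otimes>\<^bsub>ring_loc R S\<^esub> Z = X \<otimes>\<^bsub>ring_loc R S\<^esub> Z \<oplus>\<^bsub>ring_loc R S\<^esub> Y \<otimes>\<^bsub>ring_loc R S\<^esub> Z"
    unfolding a(3) b(3) c(3) using a(1,2) b(1,2) c(1,2) R Sm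
    by (simp add: ops) (rule ring_frac_eqI[OF S]; simp add: R.m_ac R.l_distr R.r_distr)
qed

lemma mod_loc_module:
  assumes S: "mult_set S" shows "module (ring_loc R S) (mod_loc R S M)"
proof (rule moduleI)
  note SR = mult_setD(1)[OF S] and Sm = mult_setD(3)[OF S] and S1 = mult_setD(2)[OF S]
  note ops = ring_loc_ops[OF S] mod_loc_add[OF S] mod_loc_smult[OF S]
  show "cring (ring_loc R S)" by (rule ring_loc_cring[OF S])
  show "abelian_group (mod_loc R S M)" by (rule mod_loc_abelian_group[OF S])
  fix A X assume A: "A \<in> carrier (ring_loc R S)" and X: "X \<in> carrier (mod_loc R S M)"
  obtain a s where a: "a \<in> carrier R" "s \<in> S" "A = ring_frac R S a s" using A unfolding ring_loc_carrier by blast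
  obtain m t where m: "m \<in> carrier M" "t \<in> S" "X = mod_frac R S M m t" using X unfolding mod_loc_carrier by blast
  have R: "s \<in> carrier R" "t \<in> carrier R" using SR a m by auto
  have "a \<odot>\<^bsub>M\<^esub> m \<in> carrier M" using a m by simp
  then show "A \<odot>\<^bsub>mod_loc R S M\<^esub> X \<in> carrier (mod_loc R S M)"
    unfolding a(3) m(3) mod_loc_smult[OF S a(1,2) m(1,2)] mod_loc_carrier using Sm[OF a(2) m(2)] by blast
  {
    fix B assume B: "B \<in> carrier (ring_loc R S)"
    obtain b w where b: "b \<in> carrier R" "w \<in> S" "B = ring_frac R S b w" using B unfolding ring_loc_carrier by blast
    have w: "w \<in> carrier R" using SR b by auto
    show "(A \<oplus>\<^bsub>ring_loc R S\<^esub> B) \<odot>\<^bsub>mod_loc R S M\<^esub> X = A \<odot>\<^bsub>mod_loc R S M\<^esub> X \<oplus>\<^bsub>mod_loc R S M\<^esub> B \<odot>\<^bsub>mod_loc R S M\<^esub> X"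
      unfolding a(3) b(3) m(3) using a(1,2) b(1,2) m(1,2) R w Sm
      by (simp add: ops) (rule mod_frac_eqI[OF S]; simp add: smult_assoc1 smult_lcomm smult_l_distr smult_r_distr)
    show "(A \<otimes>\<^bsub>ring_loc R S\<^esub> B) \<odot>\<^bsub>mod_loc R S M\<^esub> X = A \<odot>\<^bsub>mod_loc R S M\<^esub> (B \<odot>\<^bsub>mod_loc R S M\<^esub> X)"
      unfolding a(3) b(3) m(3) using a(1,2) b(1,2) m(1,2) R w Sm
      by (simp add: ops smult_assoc1 R.m_assoc)
  next
    fix Y assume Y: "Y \<in> carrier (mod_loc R S M)"
    obtain n w where n: "n \<in> carrier M" "w \<in> S" "Y = mod_frac R S M n w" using Y unfolding mod_loc_carrier by blast
    have w: "w \<in> carrier R" using SR n by auto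
    show "A \<odot>\<^bsub>mod_loc R S M\<^esub> (X \<oplus>\<^bsub>mod_loc R S M\<^esub> Y) = A \<odot>\<^bsub>mod_loc R S M\<^esub> X \<oplus>\<^bsub>mod_loc R S M\<^esub> A \<odot>\<^bsub>mod_loc R S M\<^esub> Y"
      unfolding a(3) n(3) m(3) using a(1,2) n(1,2) m(1,2) R w Sm
      by (simp add: ops) (rule mod_frac_eqI[OF S]; simp add: smult_assoc1 smult_lcomm smult_l_distr smult_r_distr)
  }
next
  note SR = mult_setD(1)[OF S] and S1 = mult_setD(2)[OF S]
  fix X assume X: "X \<in> carrier (mod_loc R S M)"
  obtain m t where m: "m \<in> carrier M" "t \<in> S" "X = mod_frac R S M m t" using X unfolding mod_loc_carrier by blast
  show "\<one>\<^bsub>ring_loc R S\<^esub> \<odot>\<^bsub>mod_loc R S M\<^esub> X = X"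
    unfolding m(3) ring_loc_one using m(1,2) SR S1 by (simp add: mod_loc_smult[OF S])
qed

section \<open>Transfer of submodules and regularity to the localization\<close>

definition loc_sub :: "'a set \<Rightarrow> 'c set \<Rightarrow> ('c \<times> 'a) set set"
  where "loc_sub S K = {mod_frac R S M m s | m s. m \<in> K \<and> s \<in> S}"

text \<open>Denominators are invertible, so only the numerator matters: the saturation is the
  preimage in \<open>M\<close> of the localized submodule.\<close>

lemma mod_frac_in_loc_iff:
  assumes S: "mult_set S" and K: "submodule K R M" and m: "m \<in> carrier M" and s: "s \<in> S"
  shows "mod_frac R S M m s \<in> loc_sub S K \<longleftrightarrow> m \<in> saturation S K"
proof
  assume "mod_frac R S M m s \<in> loc_sub S K"
  then obtain k t where k: "k \<in> K" "t \<in> S" "mod_frac R S M m s = mod_frac R S M k t" unfolding loc_sub_def by blast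
  have kM: "k \<in> carrier M" using submodule_carrier[OF K k(1)] .
  obtain u where u: "u \<in> S" "u \<odot>\<^bsub>M\<^esub> (t \<odot>\<^bsub>M\<^esub> m) = u \<odot>\<^bsub>M\<^esub> (s \<odot>\<^bsub>M\<^esub> k)"
    using mod_frac_eq_iff[OF S m s kM k(2)] k(3) by blast
  have R: "u \<in> carrier R" "t \<in> carrier R" "s \<in> carrier R" using mult_setD(1)[OF S] u k s by auto
  have "(u \<otimes> t) \<odot>\<^bsub>M\<^esub> m = u \<odot>\<^bsub>M\<^esub> (s \<odot>\<^bsub>M\<^esub> k)" using u(2) R m by (simp add: smult_assoc1)
  also have "\<dots> \<in> K" using submoduleE(4)[OF K] R k by blast
  finally show "m \<in> saturation S K" by (rule satI[OF m mult_setD(3)[OF S u(1) k(2)]])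
next
  assume "m \<in> saturation S K"
  then obtain u where u: "u \<in> S" "u \<odot>\<^bsub>M\<^esub> m \<in> K" by (rule satE)
  have R: "u \<in> carrier R" "s \<in> carrier R" using mult_setD(1)[OF S] u s by auto
  have us: "u \<otimes> s \<in> S" using mult_setD(3)[OF S u(1) s] .
  have "mod_frac R S M m s = mod_frac R S M (u \<odot>\<^bsub>M\<^esub> m) (u \<otimes> s)"
    using R m s us by (intro mod_frac_eqI[OF S]) (auto simp: smult_assoc1 smult_lcomm)
  then show "mod_frac R S M m s \<in> loc_sub S K" unfolding loc_sub_def using u us by blast
qed

lemma mod_frac_add_same:
  assumes S: "mult_set S" and m: "m \<in> carrier M" and n: "n \<in> carrier M" and s: "s \<in> S"
  shows "mod_frac R S M m s \<oplus>\<^bsub>mod_loc R S M\<^esub> mod_frac R S M n s = mod_frac R S M (m \<oplus>\<^bsub>M\<^esub> n) s"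
proof -
  have sR: "s \<in> carrier R" using mult_setD(1)[OF S s] .
  show ?thesis unfolding mod_loc_add[OF S m s n s]
    using m n s sR mult_setD(3)[OF S s s]
    by (intro mod_frac_eqI[OF S]) (auto simp: smult_assoc1 smult_r_distr)
qed

lemma mod_loc_zero: "\<zero>\<^bsub>mod_loc R S M\<^esub> = mod_frac R S M \<zero>\<^bsub>M\<^esub> \<one>"
  unfolding mod_loc_def by simp

lemma loc_zero: assumes S: "mult_set S" shows "loc_sub S {\<zero>\<^bsub>M\<^esub>} = {\<zero>\<^bsub>mod_loc R S M\<^esub>}"
proof -
  have "mod_frac R S M \<zero>\<^bsub>M\<^esub> s = mod_frac R S M \<zero>\<^bsub>M\<^esub> \<one>" if "s \<in> S" for s
    using that mult_setD(1,2)[OF S] by (intro mod_frac_eqI[OF S]) auto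
  then show ?thesis unfolding loc_sub_def mod_loc_zero using mult_setD(2)[OF S] by blast
qed

lemma loc_submodule:
  assumes S: "mult_set S" and K: "submodule K R M"
  shows "submodule (loc_sub S K) (ring_loc R S) (mod_loc R S M)"
proof -
  interpret L: module "ring_loc R S" "mod_loc R S M" by (rule mod_loc_module[OF S])
  note SR = mult_setD(1)[OF S] and Sm = mult_setD(3)[OF S] and KM = submodule_carrier[OF K]
  have smult: "A \<odot>\<^bsub>mod_loc R S M\<^esub> X \<in> loc_sub S K" if A: "A \<in> carrier (ring_loc R S)" and X: "X \<in> loc_sub S K" for A X
  proof -
    obtain a s where a: "a \<in> carrier R" "s \<in> S" "A = ring_frac R S a s" using A unfolding ring_loc_carrier by blast
    obtain m t where m: "m \<in> K" "t \<in> S" "X = mod_frac R S M m t" using X unfolding loc_sub_def by blast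
    show ?thesis unfolding a(3) m(3) mod_loc_smult[OF S a(1,2) KM[OF m(1)] m(2)]
      unfolding loc_sub_def using submoduleE(4)[OF K a(1) m(1)] Sm[OF a(2) m(2)] by blast
  qed
  have sub: "loc_sub S K \<subseteq> carrier (mod_loc R S M)" unfolding loc_sub_def mod_loc_carrier using KM by blast
  show ?thesis
  proof (rule L.submoduleI[OF sub])
    show "\<zero>\<^bsub>mod_loc R S M\<^esub> \<in> loc_sub S K"
      unfolding mod_loc_zero loc_sub_def using submodule_zero[OF K] mult_setD(2)[OF S] by blast
    show "X \<oplus>\<^bsub>mod_loc R S M\<^esub> Y \<in> loc_sub S K" if X: "X \<in> loc_sub S K" and Y: "Y \<in> loc_sub S K" for X Y
    proof -
      obtain m s where m: "m \<in> K" "s \<in> S" "X = mod_frac R S M m s" using X unfolding loc_sub_def by blast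
      obtain n t where n: "n \<in> K" "t \<in> S" "Y = mod_frac R S M n t" using Y unfolding loc_sub_def by blast
      have "t \<odot>\<^bsub>M\<^esub> m \<oplus>\<^bsub>M\<^esub> s \<odot>\<^bsub>M\<^esub> n \<in> K"
        using submoduleE(4,5)[OF K] SR m(1,2) n(1,2) by blast
      then show ?thesis unfolding m(3) n(3) mod_loc_add[OF S KM[OF m(1)] m(2) KM[OF n(1)] n(2)]
        unfolding loc_sub_def using Sm[OF m(2) n(2)] by blast
    qed
    show "\<ominus>\<^bsub>mod_loc R S M\<^esub> X \<in> loc_sub S K" if X: "X \<in> loc_sub S K" for X
    proof -
      have "\<ominus>\<^bsub>mod_loc R S M\<^esub> X = (\<ominus>\<^bsub>ring_loc R S\<^esub> \<one>\<^bsub>ring_loc R S\<^esub>) \<odot>\<^bsub>mod_loc R S M\<^esub> X"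
        using X sub by (subst L.smult_l_minus) auto
      then show ?thesis using smult[OF _ X] by simp
    qed
  qed (rule smult)
qed

text \<open>As \<open>s\<close> is invertible in the localization, \<open>a/s\<close> and
  \<open>a\<close> have the same multiples: \<open>(a x)/t\<close> equals \<open>a/s\<close> times
  \<open>(s x)/t\<close>.\<close>

lemma loc_add_multiples:
  assumes S: "mult_set S" and K: "submodule K R M" and a: "a \<in> carrier R" and s: "s \<in> S"
  shows "module.add_multiples (mod_loc R S M) (loc_sub S K) (ring_frac R S a s) = loc_sub S (add_multiples K a)"
proof -
  interpret L: module "ring_loc R S" "mod_loc R S M" by (rule mod_loc_module[OF S])
  note SR = mult_setD(1)[OF S] and Sm = mult_setD(3)[OF S] and KM = submodule_carrier[OF K]
  have A: "ring_frac R S a s \<in> carrier (ring_loc R S)" unfolding ring_loc_carrier using a s by blast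
  note lK = loc_submodule[OF S K]
  note lP = L.add_multiples_submodule[OF lK A]
  show ?thesis
  proof
    show "L.add_multiples (loc_sub S K) (ring_frac R S a s) \<subseteq> loc_sub S (add_multiples K a)"
    proof (rule L.add_multiples_minimal[OF lK loc_submodule[OF S add_multiples_submodule[OF K a]]])
      show "loc_sub S K \<subseteq> loc_sub S (add_multiples K a)" unfolding loc_sub_def using add_multiples_superset[OF K a] by blast
      fix X assume "X \<in> carrier (mod_loc R S M)"
      then obtain m t where m: "m \<in> carrier M" "t \<in> S" "X = mod_frac R S M m t" unfolding mod_loc_carrier by blast
      show "ring_frac R S a s \<odot>\<^bsub>mod_loc R S M\<^esub> X \<in> loc_sub S (add_multiples K a)"
        unfolding m(3) mod_loc_smult[OF S a s m(1,2)] unfolding loc_sub_def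
        using smult_in_add_multiples[OF K a m(1)] Sm[OF s m(2)] by blast
    qed
    show "loc_sub S (add_multiples K a) \<subseteq> L.add_multiples (loc_sub S K) (ring_frac R S a s)"
    proof
      fix X assume "X \<in> loc_sub S (add_multiples K a)"
      then obtain n x t where n: "n \<in> K" and x: "x \<in> carrier M" and t: "t \<in> S"
        and X: "X = mod_frac R S M (n \<oplus>\<^bsub>M\<^esub> a \<odot>\<^bsub>M\<^esub> x) t" unfolding loc_sub_def add_multiples_def by blast
      have ax: "a \<odot>\<^bsub>M\<^esub> x \<in> carrier M" "s \<odot>\<^bsub>M\<^esub> x \<in> carrier M" using a x SR[OF s] by auto
      have "mod_frac R S M (a \<odot>\<^bsub>M\<^esub> x) t = mod_frac R S M (a \<odot>\<^bsub>M\<^esub> (s \<odot>\<^bsub>M\<^esub> x)) (s \<otimes> t)"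
        using a x SR s t Sm ax by (intro mod_frac_eqI[OF S]) (auto simp: smult_assoc1 smult_lcomm)
      also have "\<dots> = ring_frac R S a s \<odot>\<^bsub>mod_loc R S M\<^esub> mod_frac R S M (s \<odot>\<^bsub>M\<^esub> x) t"
        using mod_loc_smult[OF S a s ax(2) t] by simp
      finally have "X = mod_frac R S M n t \<oplus>\<^bsub>mod_loc R S M\<^esub> (ring_frac R S a s \<odot>\<^bsub>mod_loc R S M\<^esub> mod_frac R S M (s \<odot>\<^bsub>M\<^esub> x) t)"
        unfolding X using mod_frac_add_same[OF S KM[OF n] ax(1) t] by simp
      moreover have "mod_frac R S M n t \<in> loc_sub S K" unfolding loc_sub_def using n t by blast
      moreover have "mod_frac R S M (s \<odot>\<^bsub>M\<^esub> x) t \<in> carrier (mod_loc R S M)" unfolding mod_loc_carrier using ax t by blast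
      ultimately show "X \<in> L.add_multiples (loc_sub S K) (ring_frac R S a s)" unfolding L.add_multiples_def by blast
    qed
  qed
qed

text \<open>The condition on \<open>T\<close> says that a second localization leaves the localized
  submodule alone. It is used for \<open>T = {1}\<close> and for the complement of the maximal
  ideal, which makes both notions of regularity over \<open>R_p\<close> agree with the one over
  \<open>R\<close>.\<close>

lemma loc_nonzerodivisor_iff:
  assumes S: "mult_set S" and K: "submodule K R M" and a: "a \<in> carrier R" and s: "s \<in> S"
    and T: "module.saturation (mod_loc R S M) T (loc_sub S K) = loc_sub S K"
  shows "module.nonzerodivisor (mod_loc R S M) T (loc_sub S K) (ring_frac R S a s) \<longleftrightarrow> nonzerodivisor S K a"
proof -
  interpret L: module "ring_loc R S" "mod_loc R S M" by (rule mod_loc_module[OF S])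
  note Sm = mult_setD(3)[OF S]
  have "ring_frac R S a s \<odot>\<^bsub>mod_loc R S M\<^esub> mod_frac R S M m t \<in> loc_sub S K \<longleftrightarrow> a \<odot>\<^bsub>M\<^esub> m \<in> saturation S K"
    if "m \<in> carrier M" "t \<in> S" for m t
    using mod_loc_smult[OF S a s that] mod_frac_in_loc_iff[OF S K _ Sm[OF s that(2)]] a that(1) by simp
  moreover have "L.nonzerodivisor T (loc_sub S K) (ring_frac R S a s) \<longleftrightarrow> (\<forall>m\<in>carrier M. \<forall>t\<in>S.
      ring_frac R S a s \<odot>\<^bsub>mod_loc R S M\<^esub> mod_frac R S M m t \<in> loc_sub S K \<longrightarrow> mod_frac R S M m t \<in> loc_sub S K)"
    unfolding L.nonzerodivisor_def T mod_loc_carrier by blast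
  ultimately show ?thesis
    using mod_frac_in_loc_iff[OF S K] mult_setD(2)[OF S] unfolding nonzerodivisor_def by auto
qed

text \<open>Elements of the localized ring are presented as pairs of numerator and denominator; the
  submodule divided out depends on the numerators alone.\<close>

lemma loc_add_multiples_list:
  assumes S: "mult_set S"
  shows "submodule K R M \<Longrightarrow> set ps \<subseteq> carrier R \<times> S \<Longrightarrow>
    module.add_multiples_list (mod_loc R S M) (loc_sub S K) (map (\<lambda>(a, s). ring_frac R S a s) ps) = loc_sub S (add_multiples_list K (map fst ps))"
proof (induction ps arbitrary: K)
  case Nil
  interpret L: module "ring_loc R S" "mod_loc R S M" by (rule mod_loc_module[OF S])
  show ?case by simp
next
  case (Cons x ps)
  interpret L: module "ring_loc R S" "mod_loc R S M" by (rule mod_loc_module[OF S])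
  obtain a s where x: "x = (a, s)" "a \<in> carrier R" "s \<in> S" using Cons.prems(2) by (cases x) auto
  show ?case using Cons.IH[OF add_multiples_submodule[OF Cons.prems(1) x(2)]] Cons.prems(2)
      loc_add_multiples[OF S Cons.prems(1) x(2,3)] x(1) by simp
qed

lemma loc_regular_at_iff:
  assumes S: "mult_set S" and T: "\<And>K. submodule K R M \<Longrightarrow> module.saturation (mod_loc R S M) T (loc_sub S K) = loc_sub S K"
  shows "submodule K R M \<Longrightarrow> set ps \<subseteq> carrier R \<times> S \<Longrightarrow>
    module.regular_at (mod_loc R S M) T (loc_sub S K) (map (\<lambda>(a, s). ring_frac R S a s) ps) \<longleftrightarrow> regular_at S K (map fst ps)"
proof (induction ps arbitrary: K)
  case Nil
  interpret L: module "ring_loc R S" "mod_loc R S M" by (rule mod_loc_module[OF S])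
  show ?case by simp
next
  case (Cons x ps)
  interpret L: module "ring_loc R S" "mod_loc R S M" by (rule mod_loc_module[OF S])
  obtain a s where x: "x = (a, s)" "a \<in> carrier R" "s \<in> S" using Cons.prems(2) by (cases x) auto
  show ?case using Cons.IH[OF add_multiples_submodule[OF Cons.prems(1) x(2)]] Cons.prems(2)
      loc_add_multiples[OF S Cons.prems(1) x(2,3)] loc_nonzerodivisor_iff[OF S Cons.prems(1) x(2,3) T[OF Cons.prems(1)]] x(1) by simp
qed

lemma loc_sat_one:
  assumes S: "mult_set S" and K: "submodule K R M"
  shows "module.saturation (mod_loc R S M) {\<one>\<^bsub>ring_loc R S\<^esub>} (loc_sub S K) = loc_sub S K"
proof -
  interpret L: module "ring_loc R S" "mod_loc R S M" by (rule mod_loc_module[OF S])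
  show ?thesis by (rule L.sat_one[OF loc_submodule[OF S K]])
qed

lemma strongly_regular_seq_loc_iff:
  assumes S: "mult_set S" and ps: "set ps \<subseteq> carrier R \<times> S"
  shows "strongly_regular_seq (ring_loc R S) (mod_loc R S M) (map (\<lambda>(a, s). ring_frac R S a s) ps)
    \<longleftrightarrow> regular_at S {\<zero>\<^bsub>M\<^esub>} (map fst ps)"
proof -
  interpret L: module "ring_loc R S" "mod_loc R S M" by (rule mod_loc_module[OF S])
  have "set (map (\<lambda>(a, s). ring_frac R S a s) ps) \<subseteq> carrier (ring_loc R S)"
    unfolding ring_loc_carrier using ps by auto
  from L.strongly_regular_seq_iff[OF this] show ?thesis
    using loc_regular_at_iff[OF S loc_sat_one[OF S] zero_submodule ps] by (simp add: loc_zero[OF S])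
qed

section \<open>Support and regular sequences as conditions at primes\<close>

lemma mod_loc_nonzero_iff:
  assumes S: "mult_set S"
  shows "carrier (mod_loc R S M) \<noteq> {\<zero>\<^bsub>mod_loc R S M\<^esub>} \<longleftrightarrow> (\<exists>x\<in>carrier M. x \<notin> saturation S {\<zero>\<^bsub>M\<^esub>})"
proof -
  have "\<zero>\<^bsub>mod_loc R S M\<^esub> \<in> carrier (mod_loc R S M)"
    unfolding mod_loc_zero mod_loc_carrier using mult_setD(2)[OF S] by blast
  then have "carrier (mod_loc R S M) \<noteq> {\<zero>\<^bsub>mod_loc R S M\<^esub>} \<longleftrightarrow> (\<exists>X\<in>carrier (mod_loc R S M). X \<notin> loc_sub S {\<zero>\<^bsub>M\<^esub>})"
    unfolding loc_zero[OF S] by blast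
  also have "\<dots> \<longleftrightarrow> (\<exists>x\<in>carrier M. \<exists>s\<in>S. x \<notin> saturation S {\<zero>\<^bsub>M\<^esub>})"
    unfolding mod_loc_carrier using mod_frac_in_loc_iff[OF S zero_submodule] by blast
  also have "\<dots> \<longleftrightarrow> (\<exists>x\<in>carrier M. x \<notin> saturation S {\<zero>\<^bsub>M\<^esub>})" using mult_setD(2)[OF S] by blast
  finally show ?thesis .
qed

lemma Supp_quot_module:
  assumes K: "submodule K R M"
  shows "Supp R (quot_module M K) = {p. primeideal p R \<and> (\<exists>x\<in>carrier M. x \<notin> saturation (carrier R - p) K)}"
proof -
  interpret Q: module R "quot_module M K" by (rule quot_module_module[OF K])
  have saturation: "K +>\<^bsub>M\<^esub> x \<in> Q.saturation S {\<zero>\<^bsub>quot_module M K\<^esub>} \<longleftrightarrow> x \<in> saturation S K"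
    if x: "x \<in> carrier M" and S: "mult_set S" for x S
  proof -
    have "u \<odot>\<^bsub>quot_module M K\<^esub> (K +>\<^bsub>M\<^esub> x) = \<zero>\<^bsub>quot_module M K\<^esub> \<longleftrightarrow> u \<odot>\<^bsub>M\<^esub> x \<in> K" if "u \<in> S" for u
      using quot_smult[OF K _ x] coset_zero_iff[OF K] x mult_setD(1)[OF S that] by simp
    moreover have "K +>\<^bsub>M\<^esub> x \<in> carrier (quot_module M K)" unfolding quot_carrier using x by blast
    ultimately show ?thesis unfolding Q.saturation_def saturation_def using x by blast
  qed
  have "carrier (mod_at R p (quot_module M K)) \<noteq> {\<zero>\<^bsub>mod_at R p (quot_module M K)\<^esub>} \<longleftrightarrow>
      (\<exists>x\<in>carrier M. x \<notin> saturation (carrier R - p) K)" if p: "primeideal p R" for p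
  proof -
    have S: "mult_set (carrier R - p)" "Q.mult_set (carrier R - p)"
      using mult_set_prime[OF p] Q.mult_set_prime[OF p] by auto
    show ?thesis unfolding mod_at_def Q.mod_loc_nonzero_iff[OF S(2)]
      using saturation[OF _ S(1)] by (auto simp: quot_carrier)
  qed
  then show ?thesis unfolding Supp_def by blast
qed

lemma regular_seq_iff:
  assumes fs: "set fs \<subseteq> carrier R"
  shows "regular_seq R M fs \<longleftrightarrow>
    (\<forall>p. primeideal p R \<longrightarrow> (\<exists>x\<in>carrier M. x \<notin> saturation (carrier R - p) (add_multiples_list {\<zero>\<^bsub>M\<^esub>} fs)) \<longrightarrow>
      regular_at (carrier R - p) {\<zero>\<^bsub>M\<^esub>} fs)"
proof -
  have "strongly_regular_seq (ring_at R p) (mod_at R p M) (map (to_ring_at R p) fs) \<longleftrightarrow>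
      regular_at (carrier R - p) {\<zero>\<^bsub>M\<^esub>} fs" if p: "primeideal p R" for p
  proof -
    note S = mult_set_prime[OF p]
    have "set (map (\<lambda>a. (a, \<one>)) fs) \<subseteq> carrier R \<times> (carrier R - p)" using fs mult_setD(2)[OF S] by auto
    from strongly_regular_seq_loc_iff[OF S this] show ?thesis
      by (simp add: ring_at_def mod_at_def to_ring_at_def[abs_def] comp_def)
  qed
  then show ?thesis
    unfolding regular_seq_def quot_seq_eq[OF fs] Supp_quot_module[OF add_multiples_list_submodule[OF zero_submodule fs]]
    using fs by auto
qed

section \<open>Depth of a localization\<close>

text \<open>The extension of \<open>p\<close> to \<open>R_p\<close>, which is its maximal
  ideal.\<close>

definition loc_max :: "'a set \<Rightarrow> ('a \<times> 'a) set set"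
  where "loc_max p = {ring_frac R (carrier R - p) a s | a s. a \<in> p \<and> s \<in> carrier R - p}"

text \<open>Primeness makes membership independent of the representing fraction: factors outside
  \<open>p\<close> can be cancelled.\<close>

lemma ring_frac_in_loc_max_iff:
  assumes p: "primeideal p R" and a: "a \<in> carrier R" and s: "s \<in> carrier R - p"
  shows "ring_frac R (carrier R - p) a s \<in> loc_max p \<longleftrightarrow> a \<in> p"
proof
  interpret p: primeideal p R by fact
  note S = mult_set_prime[OF p]
  assume "ring_frac R (carrier R - p) a s \<in> loc_max p"
  then obtain b t where b: "b \<in> p" "t \<in> carrier R - p"
    and eq: "ring_frac R (carrier R - p) a s = ring_frac R (carrier R - p) b t" unfolding loc_max_def by blast
  have bR: "b \<in> carrier R" using prime_carrier[OF p b(1)] .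
  obtain u where u: "u \<in> carrier R - p" "u \<otimes> (t \<otimes> a) = u \<otimes> (s \<otimes> b)"
    using eq ring_frac_eq_iff[OF S a s bR b(2)] by blast
  have "u \<otimes> (s \<otimes> b) \<in> p" using b(1) s u(1) p.I_l_closed by blast
  then have "u \<otimes> (t \<otimes> a) \<in> p" using u(2) by simp
  then show "a \<in> p" using p.I_prime a b(2) u(1) by (meson DiffD1 DiffD2 R.m_closed)
qed (use s in \<open>auto simp: loc_max_def\<close>)

lemma loc_unit:
  assumes p: "primeideal p R" and X: "X \<in> carrier (ring_loc R (carrier R - p))" "X \<notin> loc_max p"
  obtains Y where "Y \<in> carrier (ring_loc R (carrier R - p))"
    "Y \<otimes>\<^bsub>ring_loc R (carrier R - p)\<^esub> X = \<one>\<^bsub>ring_loc R (carrier R - p)\<^esub>"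
proof -
  note S = mult_set_prime[OF p]
  obtain a s where a: "a \<in> carrier R" "s \<in> carrier R - p" "X = ring_frac R (carrier R - p) a s"
    using X(1) unfolding ring_loc_carrier by blast
  have as: "a \<in> carrier R - p" "s \<in> carrier R" using X(2) a ring_frac_in_loc_max_iff[OF p a(1,2)] by auto
  show thesis
  proof (rule that[of "ring_frac R (carrier R - p) s a"])
    show "ring_frac R (carrier R - p) s a \<in> carrier (ring_loc R (carrier R - p))"
      unfolding ring_loc_carrier using as by blast
    show "ring_frac R (carrier R - p) s a \<otimes>\<^bsub>ring_loc R (carrier R - p)\<^esub> X = \<one>\<^bsub>ring_loc R (carrier R - p)\<^esub>"
      unfolding a(3) ring_loc_ops(2)[OF S as(2,1) a(1,2)] ring_loc_one
      using as a(1,2) mult_setD(2,3)[OF S] by (intro ring_frac_eqI[OF S]) (auto simp: R.m_comm)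
  qed
qed

lemma loc_max_ideal:
  assumes p: "primeideal p R"
  shows "ideal (loc_max p) (ring_loc R (carrier R - p))"
proof -
  interpret p: primeideal p R by fact
  note S = mult_set_prime[OF p]
  interpret L: cring "ring_loc R (carrier R - p)" by (rule ring_loc_cring[OF S])
  note pR = prime_carrier[OF p] and Sm = mult_setD(3)[OF S]
  have sub: "loc_max p \<subseteq> carrier (ring_loc R (carrier R - p))"
    unfolding loc_max_def ring_loc_carrier using pR by blast
  have mul: "Y \<otimes>\<^bsub>ring_loc R (carrier R - p)\<^esub> X \<in> loc_max p"
    if X: "X \<in> loc_max p" and Y: "Y \<in> carrier (ring_loc R (carrier R - p))" for X Y
  proof -
    obtain a s where a: "a \<in> p" "s \<in> carrier R - p" "X = ring_frac R (carrier R - p) a s"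
      using X unfolding loc_max_def by blast
    obtain b t where b: "b \<in> carrier R" "t \<in> carrier R - p" "Y = ring_frac R (carrier R - p) b t"
      using Y unfolding ring_loc_carrier by blast
    show ?thesis unfolding a(3) b(3) ring_loc_ops(2)[OF S b(1,2) pR[OF a(1)] a(2)]
      unfolding loc_max_def using p.I_l_closed[OF a(1) b(1)] Sm[OF b(2) a(2)] by blast
  qed
  show ?thesis
  proof (rule idealI)
    show "ring (ring_loc R (carrier R - p))" by (rule L.ring_axioms)
    show "subgroup (loc_max p) (add_monoid (ring_loc R (carrier R - p)))"
    proof (rule L.add.subgroupI[OF sub])
      show "loc_max p \<noteq> {}" unfolding loc_max_def using p.zero_closed mult_setD(2)[OF S] by blast
      show "\<ominus>\<^bsub>ring_loc R (carrier R - p)\<^esub> X \<in> loc_max p" if X: "X \<in> loc_max p" for X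
      proof -
        have "\<ominus>\<^bsub>ring_loc R (carrier R - p)\<^esub> X
            = (\<ominus>\<^bsub>ring_loc R (carrier R - p)\<^esub> \<one>\<^bsub>ring_loc R (carrier R - p)\<^esub>) \<otimes>\<^bsub>ring_loc R (carrier R - p)\<^esub> X"
          using X sub by (subst L.l_minus) auto
        then show ?thesis using mul[OF X] by simp
      qed
      show "X \<oplus>\<^bsub>ring_loc R (carrier R - p)\<^esub> Y \<in> loc_max p" if X: "X \<in> loc_max p" and Y: "Y \<in> loc_max p" for X Y
      proof -
        obtain a s where a: "a \<in> p" "s \<in> carrier R - p" "X = ring_frac R (carrier R - p) a s"
          using X unfolding loc_max_def by blast
        obtain b t where b: "b \<in> p" "t \<in> carrier R - p" "Y = ring_frac R (carrier R - p) b t"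
          using Y unfolding loc_max_def by blast
        have "t \<otimes> a \<oplus> s \<otimes> b \<in> p" using a b p.I_l_closed p.a_closed by blast
        then show ?thesis unfolding a(3) b(3) ring_loc_ops(1)[OF S pR[OF a(1)] a(2) pR[OF b(1)] b(2)]
          unfolding loc_max_def using Sm[OF a(2) b(2)] by blast
      qed
    qed
    show "Y \<otimes>\<^bsub>ring_loc R (carrier R - p)\<^esub> X \<in> loc_max p" "X \<otimes>\<^bsub>ring_loc R (carrier R - p)\<^esub> Y \<in> loc_max p"
      if "X \<in> loc_max p" "Y \<in> carrier (ring_loc R (carrier R - p))" for X Y
      using mul[OF that] L.m_comm[of X Y] that sub by auto
  qed
qed

lemma loc_ideal_cases:
  assumes p: "primeideal p R" and J: "ideal J (ring_loc R (carrier R - p))"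
  shows "J \<subseteq> loc_max p \<or> J = carrier (ring_loc R (carrier R - p))"
proof (cases "J \<subseteq> loc_max p")
  case False
  interpret J: ideal J "ring_loc R (carrier R - p)" by fact
  obtain X where X: "X \<in> J" "X \<notin> loc_max p" using False by blast
  obtain Y where "Y \<in> carrier (ring_loc R (carrier R - p))"
    "Y \<otimes>\<^bsub>ring_loc R (carrier R - p)\<^esub> X = \<one>\<^bsub>ring_loc R (carrier R - p)\<^esub>"
    using loc_unit[OF p J.Icarr[OF X(1)] X(2)] by blast
  then have "\<one>\<^bsub>ring_loc R (carrier R - p)\<^esub> \<in> J" using J.I_l_closed[OF X(1)] by metis
  then show ?thesis using J.one_imp_carrier by blast
qed simp

lemma loc_max_proper:
  assumes p: "primeideal p R" shows "carrier (ring_loc R (carrier R - p)) \<noteq> loc_max p"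
proof -
  note S = mult_set_prime[OF p]
  have "\<one> \<notin> p" using mult_setD(2)[OF S] by blast
  then have "ring_frac R (carrier R - p) \<one> \<one> \<notin> loc_max p"
    using ring_frac_in_loc_max_iff[OF p R.one_closed mult_setD(2)[OF S]] by blast
  moreover have "ring_frac R (carrier R - p) \<one> \<one> \<in> carrier (ring_loc R (carrier R - p))"
    unfolding ring_loc_carrier using mult_setD(2)[OF S] by blast
  ultimately show ?thesis by blast
qed

lemma loc_max_maximalideal:
  assumes p: "primeideal p R" shows "maximalideal (loc_max p) (ring_loc R (carrier R - p))"
proof (rule maximalidealI[OF loc_max_ideal[OF p] loc_max_proper[OF p]])
  fix J assume "ideal J (ring_loc R (carrier R - p))" "loc_max p \<subseteq> J"
  then show "J = loc_max p \<or> J = carrier (ring_loc R (carrier R - p))" using loc_ideal_cases[OF p] by blast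
qed

lemma max_ideal_ring_at:
  assumes p: "primeideal p R" shows "max_ideal (ring_at R p) = loc_max p"
  unfolding max_ideal_def ring_at_def
proof (rule the_equality[where P = "\<lambda>m. maximalideal m (ring_loc R (carrier R - p))", OF loc_max_maximalideal[OF p]])
  fix J assume "maximalideal J (ring_loc R (carrier R - p))"
  then interpret J: maximalideal J "ring_loc R (carrier R - p)" .
  have "J \<subseteq> loc_max p" using loc_ideal_cases[OF p J.is_ideal] J.I_notcarr by blast
  then show "J = loc_max p"
    using J.I_maximal[OF loc_max_ideal[OF p]] loc_max_proper[OF p] ideal.Icarr[OF loc_max_ideal[OF p]] by blast
qed

text \<open>Fractions outside the maximal ideal have a numerator outside \<open>p\<close>, so they
  already act invertibly and localizing \<open>R_p\<close> at its maximal ideal changes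
  nothing.\<close>

lemma loc_sat_max:
  assumes p: "primeideal p R" and K: "submodule K R M"
  shows "module.saturation (mod_loc R (carrier R - p) M) (carrier (ring_loc R (carrier R - p)) - loc_max p) (loc_sub (carrier R - p) K)
    = loc_sub (carrier R - p) K"
proof -
  let ?S = "carrier R - p" and ?T = "carrier (ring_loc R (carrier R - p)) - loc_max p"
  note S = mult_set_prime[OF p]
  interpret L: module "ring_loc R ?S" "mod_loc R ?S M" by (rule mod_loc_module[OF S])
  have T: "L.mult_set ?T"
    using L.mult_set_prime L.R.maximalideal_prime[OF loc_max_maximalideal[OF p]] by blast
  have "X \<in> loc_sub ?S K" if Xs: "X \<in> L.saturation ?T (loc_sub ?S K)" for X
  proof -
    obtain U where X: "X \<in> carrier (mod_loc R ?S M)" and U: "U \<in> ?T" "U \<odot>\<^bsub>mod_loc R ?S M\<^esub> X \<in> loc_sub ?S K"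
      using Xs by (rule L.satE)
    obtain m t where m: "m \<in> carrier M" "t \<in> ?S" "X = mod_frac R ?S M m t" using X unfolding mod_loc_carrier by blast
    obtain a s where a: "a \<in> carrier R" "s \<in> ?S" "U = ring_frac R ?S a s" using U(1) unfolding ring_loc_carrier by blast
    have ap: "a \<in> ?S" using U(1) a ring_frac_in_loc_max_iff[OF p a(1,2)] by blast
    have am: "a \<odot>\<^bsub>M\<^esub> m \<in> carrier M" using a m by simp
    have "a \<odot>\<^bsub>M\<^esub> m \<in> saturation ?S K"
      using U(2) unfolding a(3) m(3) mod_loc_smult[OF S a(1,2) m(1,2)]
        mod_frac_in_loc_iff[OF S K am mult_setD(3)[OF S a(2) m(2)]] .
    then have "m \<in> saturation ?S K" by (rule sat_cancel[OF S m(1) ap])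
    then show ?thesis unfolding m(3) mod_frac_in_loc_iff[OF S K m(1,2)] .
  qed
  then show ?thesis using L.sat_superset[OF T loc_submodule[OF S K]] by blast
qed

text \<open>For one direction, Nakayama and \<open>M_p\<close> nonzero put the maximal ideal of
  \<open>R_p\<close> into the support of the quotient, where the second localization is invisible.
  For the other, regularity on \<open>M_p\<close> passes to every further localization.\<close>

lemma regular_seq_loc_iff:
  assumes no: noetherian_module and p: "primeideal p R" and nz: "x \<in> carrier M" "x \<notin> saturation (carrier R - p) {\<zero>\<^bsub>M\<^esub>}"
    and ps: "set ps \<subseteq> p \<times> (carrier R - p)"
  shows "regular_seq (ring_at R p) (mod_at R p M) (map (\<lambda>(a, s). ring_frac R (carrier R - p) a s) ps)
    \<longleftrightarrow> regular_at (carrier R - p) {\<zero>\<^bsub>M\<^esub>} (map fst ps)"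
proof -
  let ?S = "carrier R - p" and ?gs = "map (\<lambda>(a, s). ring_frac R (carrier R - p) a s) ps"
  let ?L = "ring_loc R ?S" and ?N = "mod_loc R ?S M"
  note S = mult_set_prime[OF p]
  interpret L: module ?L ?N by (rule mod_loc_module[OF S])
  have maxp: "primeideal (loc_max p) ?L" using L.R.maximalideal_prime[OF loc_max_maximalideal[OF p]] .
  have ps': "set ps \<subseteq> carrier R \<times> ?S" using ps prime_carrier[OF p] by auto
  have gs: "set ?gs \<subseteq> carrier ?L" unfolding ring_loc_carrier using ps' by auto
  have fst: "set (map fst ps) \<subseteq> p" "set (map fst ps) \<subseteq> carrier R" using ps ps' by auto
  have accK: "submodule (add_multiples_list {\<zero>\<^bsub>M\<^esub>} (map fst ps)) R M" by (rule add_multiples_list_submodule[OF zero_submodule fst(2)])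
  have add_multiples_list: "L.add_multiples_list {\<zero>\<^bsub>?N\<^esub>} ?gs = loc_sub ?S (add_multiples_list {\<zero>\<^bsub>M\<^esub>} (map fst ps))"
    using loc_add_multiples_list[OF S zero_submodule ps'] loc_zero[OF S] by simp
  have one: "L.regular_at {\<one>\<^bsub>?L\<^esub>} {\<zero>\<^bsub>?N\<^esub>} ?gs \<longleftrightarrow> regular_at ?S {\<zero>\<^bsub>M\<^esub>} (map fst ps)"
    using loc_regular_at_iff[OF S loc_sat_one[OF S] zero_submodule ps'] loc_zero[OF S] by simp
  have max: "L.regular_at (carrier ?L - loc_max p) {\<zero>\<^bsub>?N\<^esub>} ?gs \<longleftrightarrow> regular_at ?S {\<zero>\<^bsub>M\<^esub>} (map fst ps)"
    using loc_regular_at_iff[OF S loc_sat_max[OF p] zero_submodule ps'] loc_zero[OF S] by simp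
  have "\<not> carrier M \<subseteq> saturation ?S (add_multiples_list {\<zero>\<^bsub>M\<^esub>} (map fst ps))"
    using nakayama_list[OF no p zero_submodule fst(1)] nz by blast
  then obtain y where y: "y \<in> carrier M" "y \<notin> saturation ?S (add_multiples_list {\<zero>\<^bsub>M\<^esub>} (map fst ps))" by blast
  have y1: "mod_frac R ?S M y \<one> \<notin> loc_sub ?S (add_multiples_list {\<zero>\<^bsub>M\<^esub>} (map fst ps))"
    using mod_frac_in_loc_iff[OF S accK y(1) mult_setD(2)[OF S]] y(2) by blast
  have yN: "mod_frac R ?S M y \<one> \<in> carrier ?N" unfolding mod_loc_carrier using y(1) mult_setD(2)[OF S] by blast
  show ?thesis unfolding ring_at_def mod_at_def L.regular_seq_iff[OF gs] add_multiples_list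
  proof
    assume "\<forall>q. primeideal q ?L \<longrightarrow> (\<exists>X\<in>carrier ?N. X \<notin> L.saturation (carrier ?L - q) (loc_sub ?S (add_multiples_list {\<zero>\<^bsub>M\<^esub>} (map fst ps)))) \<longrightarrow>
      L.regular_at (carrier ?L - q) {\<zero>\<^bsub>?N\<^esub>} ?gs"
    from this[rule_format, OF maxp] show "regular_at ?S {\<zero>\<^bsub>M\<^esub>} (map fst ps)"
      unfolding max loc_sat_max[OF p accK] using y1 yN by blast
  next
    assume "regular_at ?S {\<zero>\<^bsub>M\<^esub>} (map fst ps)"
    then have r: "L.regular_at {\<one>\<^bsub>?L\<^esub>} {\<zero>\<^bsub>?N\<^esub>} ?gs" using one by blast
    have "L.regular_at (carrier ?L - q) {\<zero>\<^bsub>?N\<^esub>} ?gs" if q: "primeideal q ?L" for q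
    proof -
      have "{\<one>\<^bsub>?L\<^esub>} \<subseteq> carrier ?L - q" using L.mult_setD(2)[OF L.mult_set_prime[OF q]] by blast
      then show ?thesis using L.regular_at_mono[OF L.mult_set_one L.mult_set_prime[OF q] _ gs r L.zero_submodule] by blast
    qed
    then show "\<forall>q. primeideal q ?L \<longrightarrow> (\<exists>X\<in>carrier ?N. X \<notin> L.saturation (carrier ?L - q) (loc_sub ?S (add_multiples_list {\<zero>\<^bsub>M\<^esub>} (map fst ps)))) \<longrightarrow>
      L.regular_at (carrier ?L - q) {\<zero>\<^bsub>?N\<^esub>} ?gs" by blast
  qed
qed

text \<open>A prolonging element is a fraction with numerator in \<open>p\<close>, and its numerator
  decides regularity. So the existence of a prolongation is the condition \<open>depth_ge\<close>
  with value \<open>1\<close> on the quotient.\<close>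

lemma maximal_regular_seq_loc_iff:
  assumes no: noetherian_module and p: "primeideal p R" and nz: "x \<in> carrier M" "x \<notin> saturation (carrier R - p) {\<zero>\<^bsub>M\<^esub>}"
    and ps: "set ps \<subseteq> p \<times> (carrier R - p)"
  shows "maximal_regular_seq (ring_at R p) (mod_at R p M) (map (\<lambda>(a, s). ring_frac R (carrier R - p) a s) ps)
    \<longleftrightarrow> regular_at (carrier R - p) {\<zero>\<^bsub>M\<^esub>} (map fst ps) \<and> \<not> depth_ge p (add_multiples_list {\<zero>\<^bsub>M\<^esub>} (map fst ps)) 1"
proof -
  let ?S = "carrier R - p" and ?f = "\<lambda>(a, s). ring_frac R (carrier R - p) a s"
  have sub: "set (map ?f ps) \<subseteq> loc_max p" unfolding loc_max_def using ps by auto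
  have ext: "regular_seq (ring_at R p) (mod_at R p M) (map ?f ps @ [ring_frac R ?S a s]) \<longleftrightarrow>
      regular_at ?S {\<zero>\<^bsub>M\<^esub>} (map fst ps) \<and> nonzerodivisor ?S (add_multiples_list {\<zero>\<^bsub>M\<^esub>} (map fst ps)) a"
    if "a \<in> p" "s \<in> ?S" for a s
    using regular_seq_loc_iff[OF no p nz, of "ps @ [(a, s)]"] ps that by (simp add: regular_at_append)
  have "\<one> \<in> ?S" using mult_setD(2)[OF mult_set_prime[OF p]] .
  then have "(\<exists>g\<in>loc_max p. regular_seq (ring_at R p) (mod_at R p M) (map ?f ps @ [g])) \<longleftrightarrow>
      regular_at ?S {\<zero>\<^bsub>M\<^esub>} (map fst ps) \<and> depth_ge p (add_multiples_list {\<zero>\<^bsub>M\<^esub>} (map fst ps)) 1"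
    unfolding loc_max_def using ext by auto
  then show ?thesis
    unfolding maximal_regular_seq_def max_ideal_ring_at[OF p] regular_seq_loc_iff[OF no p nz ps]
    using sub by blast
qed

text \<open>If a maximal regular sequence exists, exchange fixes its length, so the definite
  description in \<open>depth\<close> is meaningful. If none exists, prolongation gives sequences of
  every length, in agreement with the value \<infinity>.\<close>

lemma enat_le_depth_iff:
  assumes no: noetherian_module and nr: "noetherian_ring R" and p: "primeideal p R"
    and nz: "x \<in> carrier M" "x \<notin> saturation (carrier R - p) {\<zero>\<^bsub>M\<^esub>}"
  shows "depth (ring_at R p) (mod_at R p M) \<ge> enat r \<longleftrightarrow> depth_ge p {\<zero>\<^bsub>M\<^esub>} r"
proof -
  let ?S = "carrier R - p" and ?f = "\<lambda>(a, s). ring_frac R (carrier R - p) a s"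
  let ?max = "maximal_regular_seq (ring_at R p) (mod_at R p M)"
  \<comment> \<open>Every element of the maximal ideal is written with a numerator in
    \<open>p\<close>, so a sequence over \<open>R_p\<close> yields one in \<open>p\<close>.\<close>
  have lift: "\<exists>ps. gs = map ?f ps \<and> set ps \<subseteq> p \<times> ?S" if "set gs \<subseteq> loc_max p" for gs
    using that
  proof (induction gs)
    case (Cons g gs)
    then obtain ps where ps: "gs = map ?f ps" "set ps \<subseteq> p \<times> ?S" by auto
    obtain a s where "g = ring_frac R ?S a s" "a \<in> p" "s \<in> ?S" using Cons.prems unfolding loc_max_def by auto
    then have "g # gs = map ?f ((a, s) # ps)" "set ((a, s) # ps) \<subseteq> p \<times> ?S" using ps by auto
    then show ?case by (intro exI[of _ "(a, s) # ps"] conjI)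
  qed simp
  have len: "depth_ge p {\<zero>\<^bsub>M\<^esub>} n \<longleftrightarrow> n \<le> length gs" if gs: "?max gs" for gs n
  proof -
    have "set gs \<subseteq> loc_max p" using gs unfolding maximal_regular_seq_def max_ideal_ring_at[OF p] by blast
    then obtain ps where ps: "gs = map ?f ps" "set ps \<subseteq> p \<times> ?S" using lift by blast
    have r: "regular_at ?S {\<zero>\<^bsub>M\<^esub>} (map fst ps)" and n: "\<not> depth_ge p (add_multiples_list {\<zero>\<^bsub>M\<^esub>} (map fst ps)) 1"
      using gs maximal_regular_seq_loc_iff[OF no p nz ps(2)] unfolding ps(1) by auto
    have fst: "set (map fst ps) \<subseteq> p" using ps(2) by auto
    have "depth_ge p {\<zero>\<^bsub>M\<^esub>} (length gs)"
      unfolding depth_ge_iff_regular_at using r fst ps(1) by (intro exI[of _ "map fst ps"]) simp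
    moreover have "\<not> depth_ge p {\<zero>\<^bsub>M\<^esub>} (length gs + 1)"
      using depth_ge_add_multiples_list[OF no nr p zero_submodule fst r, of 1] n unfolding ps(1) length_map by blast
    ultimately show ?thesis using depth_ge_antimono by (metis Suc_eq_plus1 not_less_eq_eq)
  qed
  show ?thesis
  proof (cases "\<exists>gs. ?max gs")
    case True
    then obtain gs where gs: "?max gs" by blast
    have "(THE n. \<exists>fs. ?max fs \<and> length fs = n) = length gs"
    proof (rule the_equality)
      show "\<exists>fs. ?max fs \<and> length fs = length gs" using gs by blast
      show "n = length gs" if "\<exists>fs. ?max fs \<and> length fs = n" for n
        using that len[OF gs] len by (metis dual_order.refl order_antisym)
    qed
    then have "depth (ring_at R p) (mod_at R p M) = enat (length gs)" unfolding depth_def using gs by auto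
    then show ?thesis using len[OF gs] by simp
  next
    case False
    have "\<exists>as. set as \<subseteq> p \<and> length as = n \<and> regular_at ?S {\<zero>\<^bsub>M\<^esub>} as" for n
    proof (induction n)
      case (Suc n)
      then obtain as where as: "set as \<subseteq> p" "length as = n" "regular_at ?S {\<zero>\<^bsub>M\<^esub>} as" by blast
      \<comment> \<open>Denominator \<open>1\<close> turns a sequence in \<open>p\<close> into one
        over \<open>R_p\<close>; as that one is not maximal, some \<open>y\<close> in
        \<open>p\<close> prolongs the original.\<close>
      let ?ps = "map (\<lambda>a. (a, \<one>)) as"
      have "set ?ps \<subseteq> p \<times> ?S" using as(1) mult_setD(2)[OF mult_set_prime[OF p]] by auto
      from maximal_regular_seq_loc_iff[OF no p nz this] False as(3)
      have "depth_ge p (add_multiples_list {\<zero>\<^bsub>M\<^esub>} as) 1" by (auto simp: comp_def)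
      then obtain y where "y \<in> p" "nonzerodivisor ?S (add_multiples_list {\<zero>\<^bsub>M\<^esub>} as) y" by auto
      then show ?case using as by (intro exI[of _ "as @ [y]"]) (auto simp: regular_at_append)
    qed simp
    then have "depth_ge p {\<zero>\<^bsub>M\<^esub>} r" unfolding depth_ge_iff_regular_at by blast
    moreover have "depth (ring_at R p) (mod_at R p M) = \<infinity>" unfolding depth_def using False by simp
    ultimately show ?thesis by simp
  qed
qed

text \<open>A member of \<open>fs\<close> outside \<open>p\<close> would be a unit at
  \<open>p\<close> that kills the quotient, which is nonzero there. A class that survives in the
  quotient also survives in \<open>M_p\<close>.\<close>

lemma Supp_quot_seq_props:
  assumes fs: "set fs \<subseteq> carrier R" and p: "p \<in> Supp R (quot_seq R M fs)"
  shows "primeideal p R" "set fs \<subseteq> p" "\<exists>x\<in>carrier M. x \<notin> saturation (carrier R - p) {\<zero>\<^bsub>M\<^esub>}"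
proof -
  have *: "primeideal p R" "\<exists>x\<in>carrier M. x \<notin> saturation (carrier R - p) (add_multiples_list {\<zero>\<^bsub>M\<^esub>} fs)"
    using p unfolding quot_seq_eq[OF fs] Supp_quot_module[OF add_multiples_list_submodule[OF zero_submodule fs]] by auto
  then show "primeideal p R" by blast
  obtain x where x: "x \<in> carrier M" "x \<notin> saturation (carrier R - p) (add_multiples_list {\<zero>\<^bsub>M\<^esub>} fs)" using *(2) by blast
  show "set fs \<subseteq> p"
    using x smult_in_add_multiples_list[OF zero_submodule fs _ x(1)] fs satI[OF x(1)] by blast
  show "\<exists>x\<in>carrier M. x \<notin> saturation (carrier R - p) {\<zero>\<^bsub>M\<^esub>}"
    using x sat_mono[OF add_multiples_list_superset[OF zero_submodule fs] subset_refl] by blast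
qed

text \<open>An element whose annihilator is \<open>p\<close> is killed by nothing outside
  \<open>p\<close>, so it survives in the localization.\<close>

lemma Ass_subset_Supp_quot_seq:
  assumes fs: "set fs \<subseteq> carrier R" shows "Ass R (quot_seq R M fs) \<subseteq> Supp R (quot_seq R M fs)"
proof
  note A = add_multiples_list_submodule[OF zero_submodule fs]
  fix p assume "p \<in> Ass R (quot_seq R M fs)"
  then have "p \<in> assoc_primes (add_multiples_list {\<zero>\<^bsub>M\<^esub>} fs)" unfolding quot_seq_eq[OF fs] Ass_quot_module[OF A] .
  then obtain x where p: "primeideal p R" and x: "x \<in> carrier M" "p = colon (add_multiples_list {\<zero>\<^bsub>M\<^esub>} fs) x"
    unfolding assoc_primes_def by blast
  have "t \<in> p \<longleftrightarrow> t \<in> carrier R \<and> t \<odot>\<^bsub>M\<^esub> x \<in> add_multiples_list {\<zero>\<^bsub>M\<^esub>} fs" for t using x(2) in_colon_iff by metis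
  then have "x \<notin> saturation (carrier R - p) (add_multiples_list {\<zero>\<^bsub>M\<^esub>} fs)" unfolding saturation_def by blast
  then show "p \<in> Supp R (quot_seq R M fs)" unfolding quot_seq_eq[OF fs] Supp_quot_module[OF A] using p x(1) by blast
qed

theorem regular_seq_depth:
  assumes nr: "noetherian_ring R" and fg: "fin_gen_module R M" and fs: "set fs \<subseteq> carrier R"
  shows "(regular_seq R M fs \<longleftrightarrow>
           (\<forall>p \<in> Supp R (quot_seq R M fs). depth (ring_at R p) (mod_at R p M) \<ge> enat (length fs)))
       \<and> ((\<forall>p \<in> Supp R (quot_seq R M fs). depth (ring_at R p) (mod_at R p M) \<ge> enat (length fs)) \<longleftrightarrow>
           (\<forall>p \<in> Ass R (quot_seq R M fs). depth (ring_at R p) (mod_at R p M) \<ge> enat (length fs)))"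
    (is "(?i \<longleftrightarrow> ?ii) \<and> (_ \<longleftrightarrow> ?iii)")
proof -
  note no = noetherian_module_if_fin_gen[OF nr fg]
  let ?A = "add_multiples_list {\<zero>\<^bsub>M\<^esub>} fs"
  note A = add_multiples_list_submodule[OF zero_submodule fs]
  have depth: "depth (ring_at R p) (mod_at R p M) \<ge> enat (length fs) \<longleftrightarrow> depth_ge p {\<zero>\<^bsub>M\<^esub>} (length fs)"
    if p: "p \<in> Supp R (quot_seq R M fs)" for p
    using enat_le_depth_iff[OF no nr] Supp_quot_seq_props[OF fs p] by blast
  have i: "?i \<longleftrightarrow> (\<forall>p\<in>Supp R (quot_seq R M fs). regular_at (carrier R - p) {\<zero>\<^bsub>M\<^esub>} fs)"
    unfolding regular_seq_iff[OF fs] quot_seq_eq[OF fs] Supp_quot_module[OF A] by blast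
  \<comment> \<open>The sequence itself lies in \<open>p\<close> and witnesses the required
    depth.\<close>
  have "?i \<Longrightarrow> ?ii"
    using depth Supp_quot_seq_props(2)[OF fs] depth_ge_iff_regular_at unfolding i by blast
  moreover have "?ii \<Longrightarrow> ?iii" using Ass_subset_Supp_quot_seq[OF fs] by blast
  moreover have "?iii \<Longrightarrow> ?i"
  proof -
    assume iii: ?iii
    have "depth_ge p {\<zero>\<^bsub>M\<^esub>} (length fs)" if p: "p \<in> assoc_primes ?A" for p
    proof -
      have "p \<in> Ass R (quot_seq R M fs)" using p unfolding quot_seq_eq[OF fs] Ass_quot_module[OF A] .
      then show ?thesis using iii depth Ass_subset_Supp_quot_seq[OF fs] by blast
    qed
    then have "regular_at (carrier R - p) {\<zero>\<^bsub>M\<^esub>} fs" if "p \<in> Supp R (quot_seq R M fs)" for p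
      using regular_at_if_depth_ge_at_assoc[OF no nr zero_submodule fs] Supp_quot_seq_props(1,2)[OF fs that] by blast
    then show ?i unfolding i by blast
  qed
  ultimately show ?thesis by blast
qed

end

theorem mainTheorem1:
  fixes R :: "('a, 'c) ring_scheme" and M :: "('a, 'b, 'd) module_scheme" and fs :: "'a list"
  assumes "cring R" and "noetherian_ring R"
    and "module R M" and "fin_gen_module R M"
    and "set fs \<subseteq> carrier R"
  shows "(regular_seq R M fs \<longleftrightarrow>
           (\<forall>p \<in> Supp R (quot_seq R M fs). depth (ring_at R p) (mod_at R p M) \<ge> enat (length fs)))
       \<and> ((\<forall>p \<in> Supp R (quot_seq R M fs). depth (ring_at R p) (mod_at R p M) \<ge> enat (length fs)) \<longleftrightarrow>
           (\<forall>p \<in> Ass R (quot_seq R M fs). depth (ring_at R p) (mod_at R p M) \<ge> enat (length fs)))"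
  using module.regular_seq_depth[OF assms(3,2,4,5)] .

end
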